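(* Let $N=(N(t):t\ge 0)$ be a simple arrival counting process adapted to a filtration $\mathcal{F}=(\mathcal{F}_t:t\ge 0)$, possessing a right continuous non-decreasing $\mathcal{F}$-compensator $A=(A(t):t\ge 0)$, so that $N-A$ is an $\mathcal{F}$-adapted martingale. For $0<\epsilon\le 1$ let $\beta^\epsilon=(\beta^\epsilon_i:i\ge 1)$ be an iid sequence of Bernoulli($\epsilon$) random variables independent of $N$, and set $$N_\epsilon(t)=\sum_{i=1}^{N(t/\epsilon)}\beta_i^\epsilon,\qquad t\ge 0.$$ Assume that there exists a deterministic $\lambda^*\in(0,\infty)$ such that $$\frac{1}{t}A(t)\Rightarrow\lambda^*\quad\text{as } t\to\infty.$$ Then $$N_\epsilon\Rightarrow N_0\quad\text{in } D[0,\infty)\text{ as }\epsilon\downarrow 0,$$ where $N_0=(N_0(t):t\ge 0)$ is a Poisson process with constant intensity $\lambda^*$.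
   Context: A counting process $N$ is simple if it increases by exactly one at each arrival epoch (no batch arrivals). $\Rightarrow$ denotes weak convergence (convergence in distribution). $D[0,\infty)$ is the space of right continuous functions on $[0,\infty)$ having left limits, endowed with the Skorohod $J_1$ topology. $N$ is not required to be a doubly stochastic Poisson process. *)

theory Defs
  imports "HOL-Probability.Probability"
begin

text \<open>
  Paths indexed by \<open>[0,\<infinity>)\<close> are functions on the reals that are \<^const>\<open>undefined\<close> at negative
  times, so that equality of paths is equality on \<open>[0,\<infinity>)\<close>.
\<close>

definition cadlag :: "(real \<Rightarrow> real) set" where
  "cadlag = {x \<in> extensional {0..}.
     (\<forall>t\<ge>0. (x \<longlongrightarrow> x t) (at_right t)) \<and> (\<forall>t>0. \<exists>l. (x \<longlongrightarrow> l) (at_left t))}"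

definition time_changes :: "(real \<Rightarrow> real) set" where
  "time_changes = {\<mu>. \<mu> 0 = 0 \<and> strict_mono_on {0..} \<mu> \<and> continuous_on {0..} \<mu> \<and>
     filterlim \<mu> at_top at_top}"

text \<open>
  The \<open>J\<^sub>1\<close> topology on \<open>D[0,\<infinity>)\<close> is the metrizable topology whose convergent sequences are given by
  \<open>J1_converges\<close> (Jacod and Shiryaev, Limit Theorems for Stochastic Processes, Theorem VI.1.14).
  Being metrizable, it is determined by its convergent sequences: its open sets are the
  sequentially open ones, which is how \<open>skorohod_J1\<close> is defined.
\<close>

definition J1_converges :: "(nat \<Rightarrow> real \<Rightarrow> real) \<Rightarrow> (real \<Rightarrow> real) \<Rightarrow> bool" where
  "J1_converges xs x \<longleftrightarrow> (\<exists>\<mu>. (\<forall>n. \<mu> n \<in> time_changes) \<and>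
     uniform_limit {0..} \<mu> (\<lambda>s. s) sequentially \<and>
     (\<forall>T. uniform_limit {0..T} (\<lambda>n s. xs n (\<mu> n s)) x sequentially))"

definition J1_open :: "(real \<Rightarrow> real) set \<Rightarrow> bool" where
  "J1_open U \<longleftrightarrow> U \<subseteq> cadlag \<and>
     (\<forall>x\<in>U. \<forall>xs. (\<forall>n. xs n \<in> cadlag) \<longrightarrow> J1_converges xs x \<longrightarrow>
        (\<forall>\<^sub>F n in sequentially. xs n \<in> U))"

definition skorohod_J1 :: "(real \<Rightarrow> real) topology" where
  "skorohod_J1 = topology J1_open"

lemma openin_skorohod_J1: "openin skorohod_J1 U \<longleftrightarrow> J1_open U"
proof -
  have "istopology J1_open"
    unfolding istopology_def
  proof (intro conjI allI impI)
    fix S T assume "J1_open S" "J1_open T"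
    then show "J1_open (S \<inter> T)"
      unfolding J1_open_def by (auto simp: eventually_conj_iff)
  next
    fix \<K> assume K: "\<forall>K\<in>\<K>. J1_open K"
    show "J1_open (\<Union>\<K>)"
      unfolding J1_open_def
    proof (intro conjI ballI allI impI)
      show "\<Union>\<K> \<subseteq> cadlag"
        using K by (auto simp: J1_open_def)
      fix x xs assume x: "x \<in> \<Union>\<K>" and xs: "\<forall>n. xs n \<in> cadlag" "J1_converges xs x"
      then obtain K where "K \<in> \<K>" "x \<in> K" by blast
      then have "\<forall>\<^sub>F n in sequentially. xs n \<in> K"
        using K xs by (auto simp: J1_open_def)
      then show "\<forall>\<^sub>F n in sequentially. xs n \<in> \<Union>\<K>"
        by (rule eventually_mono) (use \<open>K \<in> \<K>\<close> in blast)
    qed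
  qed
  then show ?thesis
    by (simp add: skorohod_J1_def topology_inverse')
qed

lemma topspace_skorohod_J1: "topspace skorohod_J1 = cadlag"
proof -
  have "J1_open cadlag" by (simp add: J1_open_def)
  then show ?thesis
    unfolding topspace_def openin_skorohod_J1 by (auto simp: J1_open_def)
qed

definition borel_of :: "'a topology \<Rightarrow> 'a measure" where
  "borel_of T = sigma (topspace T) {U. openin T U}"

text \<open>
  Convergence in distribution of \<open>T\<close>-valued random elements \<open>X i\<close> along the filter \<open>Fi\<close>; the limit
  \<open>X0\<close> may live on another probability space.
\<close>

definition converges_in_law ::
  "'s topology \<Rightarrow> 'a measure \<Rightarrow> ('i \<Rightarrow> 'a \<Rightarrow> 's) \<Rightarrow> 'b measure \<Rightarrow> ('b \<Rightarrow> 's) \<Rightarrow> 'i filter \<Rightarrow> bool" where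
  "converges_in_law T M X M0 X0 Fi \<longleftrightarrow>
     (\<forall>\<^sub>F i in Fi. X i \<in> M \<rightarrow>\<^sub>M borel_of T) \<and> X0 \<in> M0 \<rightarrow>\<^sub>M borel_of T \<and>
     (\<forall>f. continuous_map T euclideanreal f \<and> bounded (f ` topspace T) \<longrightarrow>
        ((\<lambda>i. \<integral>\<omega>. f (X i \<omega>) \<partial>M) \<longlongrightarrow> (\<integral>\<omega>. f (X0 \<omega>) \<partial>M0)) Fi)"

text \<open>
  Only times \<open>t \<ge> 0\<close> matter; the library locale \<^locale>\<open>filtration\<close> at index type \<^typ>\<open>real\<close> would also
  constrain negative times. No completeness or right continuity of the filtration is assumed.
\<close>

definition is_filtration :: "'a measure \<Rightarrow> (real \<Rightarrow> 'a measure) \<Rightarrow> bool" where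
  "is_filtration M F \<longleftrightarrow> (\<forall>t\<ge>0. subalgebra M (F t)) \<and>
     (\<forall>s\<ge>0. \<forall>t\<ge>s. sets (F s) \<subseteq> sets (F t))"

definition is_martingale ::
  "'a measure \<Rightarrow> (real \<Rightarrow> 'a measure) \<Rightarrow> (real \<Rightarrow> 'a \<Rightarrow> real) \<Rightarrow> bool" where
  "is_martingale M F X \<longleftrightarrow>
     (\<forall>t\<ge>0. X t \<in> borel_measurable (F t) \<and> integrable M (X t)) \<and>
     (\<forall>s\<ge>0. \<forall>t\<ge>s. AE \<omega> in M. real_cond_exp M (F s) (X t) \<omega> = X s \<omega>)"

definition predictable_sigma :: "'a measure \<Rightarrow> (real \<Rightarrow> 'a measure) \<Rightarrow> (real \<times> 'a) measure" where
  "predictable_sigma M F = sigma ({0..} \<times> space M)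
     ({{0} \<times> B |B. B \<in> sets (F 0)} \<union>
      {{s<..t} \<times> B |s t B. 0 \<le> s \<and> s < t \<and> B \<in> sets (F s)})"

text \<open>
  A compensator is predictable by definition. Without this the martingale property would be too weak:
  every counting process would be a compensator of itself, and \<open>A\<close> could grow by rare huge jumps.
  \<open>N t\<close> itself need not be integrable.
\<close>

definition is_compensator ::
  "'a measure \<Rightarrow> (real \<Rightarrow> 'a measure) \<Rightarrow> (real \<Rightarrow> 'a \<Rightarrow> nat) \<Rightarrow> (real \<Rightarrow> 'a \<Rightarrow> real) \<Rightarrow> bool" where
  "is_compensator M F N A \<longleftrightarrow>
     (\<forall>\<omega>\<in>space M. A 0 \<omega> = 0 \<and> mono_on {0..} (\<lambda>t. A t \<omega>) \<and>
        (\<forall>t\<ge>0. ((\<lambda>s. A s \<omega>) \<longlongrightarrow> A t \<omega>) (at_right t))) \<and>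
     (\<lambda>(t, \<omega>). A t \<omega>) \<in> borel_measurable (predictable_sigma M F) \<and>
     is_martingale M F (\<lambda>t \<omega>. real (N t \<omega>) - A t \<omega>)"

definition counting_path :: "(real \<Rightarrow> nat) \<Rightarrow> bool" where
  "counting_path x \<longleftrightarrow> x 0 = 0 \<and> mono_on {0..} x \<and> (\<forall>t\<ge>0. (x \<longlongrightarrow> x t) (at_right t))"

definition simple_path :: "(real \<Rightarrow> nat) \<Rightarrow> bool" where
  "simple_path x \<longleftrightarrow> (\<forall>t>0. \<exists>l. (x \<longlongrightarrow> l) (at_left t) \<and> (x t = l \<or> x t = l + 1))"

definition is_simple_counting_process :: "'a measure \<Rightarrow> (real \<Rightarrow> 'a \<Rightarrow> nat) \<Rightarrow> bool" where
  "is_simple_counting_process M N \<longleftrightarrow>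
     (\<forall>\<omega>\<in>space M. counting_path (\<lambda>t. N t \<omega>) \<and> simple_path (\<lambda>t. N t \<omega>)) \<and>
     (\<forall>t\<ge>0. N t \<in> M \<rightarrow>\<^sub>M count_space UNIV)"

definition is_poisson_process :: "'a measure \<Rightarrow> (real \<Rightarrow> 'a \<Rightarrow> nat) \<Rightarrow> real \<Rightarrow> bool" where
  "is_poisson_process M N r \<longleftrightarrow>
     (\<forall>\<omega>\<in>space M. counting_path (\<lambda>t. N t \<omega>)) \<and>
     (\<forall>t\<ge>0. N t \<in> M \<rightarrow>\<^sub>M count_space UNIV) \<and>
     (\<forall>s t. 0 \<le> s \<and> s < t \<longrightarrow>
        distr M (count_space UNIV) (\<lambda>\<omega>. N t \<omega> - N s \<omega>) = measure_pmf (poisson_pmf (r * (t - s)))) \<and>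
     (\<forall>(k::nat) \<tau>. 0 \<le> \<tau> 0 \<and> mono_on {..k} \<tau> \<longrightarrow>
        prob_space.indep_vars M (\<lambda>_. count_space UNIV)
          (\<lambda>i \<omega>. N (\<tau> (Suc i)) \<omega> - N (\<tau> i) \<omega>) {..<k})"

definition sample_path :: "(real \<Rightarrow> 'a \<Rightarrow> nat) \<Rightarrow> 'a \<Rightarrow> real \<Rightarrow> real" where
  "sample_path N \<omega> = (\<lambda>t\<in>{0..}. real (N t \<omega>))"

definition iid_bernoulli :: "'a measure \<Rightarrow> real \<Rightarrow> (nat \<Rightarrow> 'a \<Rightarrow> nat) \<Rightarrow> bool" where
  "iid_bernoulli M p b \<longleftrightarrow>
     prob_space.indep_vars M (\<lambda>_. count_space UNIV) b {1..} \<and>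
     (\<forall>i\<ge>1. distr M (count_space UNIV) (b i) = measure_pmf (map_pmf of_bool (bernoulli_pmf p)))"

definition independent_of_process ::
  "'a measure \<Rightarrow> (nat \<Rightarrow> 'a \<Rightarrow> nat) \<Rightarrow> (real \<Rightarrow> 'a \<Rightarrow> nat) \<Rightarrow> bool" where
  "independent_of_process M b N \<longleftrightarrow>
     prob_space.indep_var M
       (PiM {1..} (\<lambda>_. count_space UNIV)) (\<lambda>\<omega>. \<lambda>i\<in>{1..}. b i \<omega>)
       (PiM {0..} (\<lambda>_. count_space UNIV)) (\<lambda>\<omega>. \<lambda>t\<in>{0..}. N t \<omega>)"

definition thinned ::
  "(real \<Rightarrow> 'a \<Rightarrow> nat) \<Rightarrow> (real \<Rightarrow> nat \<Rightarrow> 'a \<Rightarrow> nat) \<Rightarrow> real \<Rightarrow> real \<Rightarrow> 'a \<Rightarrow> nat" where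
  "thinned N \<beta> \<epsilon> t \<omega> = (\<Sum>i = 1..N (t / \<epsilon>) \<omega>. \<beta> \<epsilon> i \<omega>)"

end

theory Submission
  imports Defs
begin

text \<open>
  The thinned process converges as soon as \<open>N(t)/t \<rightarrow> \<lambda>\<^sup>*\<close> in probability: given \<open>N\<close>, its increments are
  independent binomial variables with success probability \<open>\<epsilon>\<close>, to which the Poisson limit theorem
  applies.

  For the law of large numbers, let \<open>D\<close> be the predictable set of times \<open>r \<le> T\<close> with \<open>N(r-) < n\<close> and
  \<open>A(r) \<le> c\<close>. On \<open>D\<close> the measures \<open>dN dP\<close> and \<open>dA dP\<close> on the predictable sigma-algebra coincide (by optional
  stopping at the first time when \<open>N \<ge> n\<close>), and integrating the predictable integrand \<open>2(N(r-) - A(r))\<close>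
  against \<open>d(N - A)\<close> bounds the second moment of \<open>N - A\<close>, stopped on leaving \<open>D\<close>, by \<open>c\<close>. With \<open>c\<close>
  proportional to \<open>T\<close>, Chebyshev's inequality gives \<open>(N(T) - A(T))/T \<rightarrow> 0\<close> in probability.

  Convergence in \<open>J\<^sub>1\<close> follows from the finite-dimensional distributions without a tightness argument:
  a counting path with the same values as \<open>x\<close> on a fine dyadic grid (and the same range) is \<open>J\<^sub>1\<close>-close
  to \<open>x\<close>, so a continuous bounded functional is squeezed between functionals of countably many grid
  patterns.
\<close>

subsection \<open>Optional stopping\<close>

text \<open>Neither \<open>N t\<close> nor \<open>A t\<close> is assumed integrable, only their
  difference, so neither process can be integrated alone. The restriction to \<open>D\<close>
  restores finiteness on both sides: \<open>N\<close> below n before r, together with unit jumps,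
  keeps the stopped \<open>N\<close> at most n, and \<open>A r \<le> c\<close> is a cut without
  overshoot, legitimate because \<open>A\<close> is predictable. The resulting bound contains c but
  not n, so n can go to infinity afterwards with c fixed. The filtration is raw, neither completed
  nor right continuous. Hence left limits are expressed through rational times, and stopping times
  are reached from above along finite grids. In the Skorohod part the obstacle is a jump of size 2
  in the limit, which could arise from two nearby jumps and is invisible on a grid. Patterns
  therefore carry the range of the path as well, and the range is recovered from grid values once
  all jumps are known to be at most 1. For the Poisson process, given by its increments only, this
  has to be derived.\<close>

lemma uniformly_integrable_tendsto_L1:
  fixes X :: "nat \<Rightarrow> 'a \<Rightarrow> real" and Y Z :: "'a \<Rightarrow> real"
  assumes [measurable]: "\<And>m. X m \<in> borel_measurable M"
    and Z: "integrable M Z"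
    and lim: "\<And>\<omega>. \<omega> \<in> space M \<Longrightarrow> (\<lambda>m. X m \<omega>) \<longlonglongrightarrow> Y \<omega>"
    and int: "\<And>m. integrable M (X m)"
    and dom: "\<And>m K. (\<integral>\<omega>. \<bar>X m \<omega>\<bar> * indicator {\<omega>. K < \<bar>X m \<omega>\<bar>} \<omega> \<partial>M)
                \<le> (\<integral>\<omega>. \<bar>Z \<omega>\<bar> * indicator {\<omega>. K < \<bar>X m \<omega>\<bar>} \<omega> \<partial>M)"
    and fin: "finite_measure M"
  shows "integrable M Y" "(\<lambda>m. \<integral>\<omega>. \<bar>X m \<omega> - Y \<omega>\<bar> \<partial>M) \<longlonglongrightarrow> 0"
proof -
  interpret finite_measure M by fact
  have [measurable]: "Z \<in> borel_measurable M" using Z by simp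
  have [measurable]: "Y \<in> borel_measurable M"
    using lim by (rule borel_measurable_LIMSEQ_real) auto
  have bnd: "(\<integral>\<omega>. \<bar>X m \<omega>\<bar> \<partial>M) \<le> (\<integral>\<omega>. \<bar>Z \<omega>\<bar> \<partial>M)" for m
  proof -
    \<comment> \<open>The level \<open>-1\<close> makes the indicator identically 1, so
      \<open>dom\<close> also yields the bound in L1.\<close>
    have "(\<integral>\<omega>. \<bar>X m \<omega>\<bar> \<partial>M) = (\<integral>\<omega>. \<bar>X m \<omega>\<bar> * indicator {\<omega>. -1 < \<bar>X m \<omega>\<bar>} \<omega> \<partial>M)"
      by (intro Bochner_Integration.integral_cong) (auto simp: indicator_def)
    also have "\<dots> \<le> (\<integral>\<omega>. \<bar>Z \<omega>\<bar> * indicator {\<omega>. -1 < \<bar>X m \<omega>\<bar>} \<omega> \<partial>M)" by (rule dom)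
    also have "\<dots> = (\<integral>\<omega>. \<bar>Z \<omega>\<bar> \<partial>M)"
      by (intro Bochner_Integration.integral_cong) (auto simp: indicator_def)
    finally show ?thesis .
  qed
  show Y: "integrable M Y"
  proof (rule integrableI_bounded)
    have "(\<integral>\<^sup>+\<omega>. ennreal (norm (Y \<omega>)) \<partial>M) = (\<integral>\<^sup>+\<omega>. liminf (\<lambda>m. ennreal (norm (X m \<omega>))) \<partial>M)"
    proof (rule nn_integral_cong)
      fix \<omega> assume "\<omega> \<in> space M"
      then have "(\<lambda>m. ennreal (norm (X m \<omega>))) \<longlonglongrightarrow> ennreal (norm (Y \<omega>))"
        by (intro tendsto_intros lim)
      then show "ennreal (norm (Y \<omega>)) = liminf (\<lambda>m. ennreal (norm (X m \<omega>)))"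
        by (rule lim_imp_Liminf[OF trivial_limit_sequentially, symmetric])
    qed
    also have "\<dots> \<le> liminf (\<lambda>m. \<integral>\<^sup>+\<omega>. ennreal (norm (X m \<omega>)) \<partial>M)"
      by (rule nn_integral_liminf) simp
    also have "\<dots> \<le> ennreal (\<integral>\<omega>. \<bar>Z \<omega>\<bar> \<partial>M)"
    proof (rule Liminf_le)
      show "\<forall>\<^sub>F m in sequentially. (\<integral>\<^sup>+\<omega>. ennreal (norm (X m \<omega>)) \<partial>M) \<le> ennreal (\<integral>\<omega>. \<bar>Z \<omega>\<bar> \<partial>M)"
      proof (rule always_eventually, rule allI)
        fix m
        have "(\<integral>\<^sup>+\<omega>. ennreal (norm (X m \<omega>)) \<partial>M) = ennreal (\<integral>\<omega>. \<bar>X m \<omega>\<bar> \<partial>M)"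
          using nn_integral_eq_integral[of M "\<lambda>\<omega>. \<bar>X m \<omega>\<bar>"] int[of m] by simp
        then show "(\<integral>\<^sup>+\<omega>. ennreal (norm (X m \<omega>)) \<partial>M) \<le> ennreal (\<integral>\<omega>. \<bar>Z \<omega>\<bar> \<partial>M)"
          using bnd[of m] by (simp add: ennreal_leI)
      qed
    qed simp
    also have "\<dots> < \<infinity>" by simp
    finally show "(\<integral>\<^sup>+\<omega>. ennreal (norm (Y \<omega>)) \<partial>M) < \<infinity>" .
  qed measurable
  \<comment> \<open>\<open>\<psi> K\<close> is a continuous majorant of the indicator of
    \<open>K < \<bar>x\<bar>\<close> that vanishes for \<open>\<bar>x\<bar> \<le> K - 1\<close>. The
    indicator itself need not converge along \<open>X m\<close>; its majorant does. For
    \<open>K \<ge> 0\<close>, \<open>\<phi> K\<close> truncates to the interval from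
    \<open>- K\<close> to \<open>K\<close>.\<close>
  define \<psi> :: "real \<Rightarrow> real \<Rightarrow> real" where "\<psi> K x = min 1 (max 0 (\<bar>x\<bar> - K + 1))" for K x
  define \<phi> :: "real \<Rightarrow> real \<Rightarrow> real" where "\<phi> K x = max (- K) (min K x)" for K x
  have psi_cont: "(\<lambda>m. \<psi> K (X m \<omega>)) \<longlonglongrightarrow> \<psi> K (Y \<omega>)" if "\<omega> \<in> space M" for K \<omega>
    unfolding \<psi>_def by (intro tendsto_intros lim that)
  have phi_cont: "(\<lambda>m. \<phi> K (X m \<omega>)) \<longlonglongrightarrow> \<phi> K (Y \<omega>)" if "\<omega> \<in> space M" for K \<omega>
    unfolding \<phi>_def by (intro tendsto_intros lim that)
  have [measurable]: "(\<lambda>\<omega>. \<psi> K (X m \<omega>)) \<in> borel_measurable M" "(\<lambda>\<omega>. \<psi> K (Y \<omega>)) \<in> borel_measurable M"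
    "(\<lambda>\<omega>. \<phi> K (X m \<omega>)) \<in> borel_measurable M" "(\<lambda>\<omega>. \<phi> K (Y \<omega>)) \<in> borel_measurable M" for K m
    unfolding \<psi>_def \<phi>_def by measurable
  have psi01: "0 \<le> \<psi> K x" "\<psi> K x \<le> 1" for K x by (auto simp: \<psi>_def)
  have z1: "(\<lambda>k. \<integral>\<omega>. (\<bar>Z \<omega>\<bar> + \<bar>Y \<omega>\<bar>) * \<psi> (real k) (Y \<omega>) \<partial>M) \<longlonglongrightarrow> (\<integral>\<omega>. 0 \<partial>M)"
  proof (rule integral_dominated_convergence[where w = "\<lambda>\<omega>. \<bar>Z \<omega>\<bar> + \<bar>Y \<omega>\<bar>"])
    show "integrable M (\<lambda>\<omega>. \<bar>Z \<omega>\<bar> + \<bar>Y \<omega>\<bar>)" using Y Z by auto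
    show "AE \<omega> in M. norm ((\<bar>Z \<omega>\<bar> + \<bar>Y \<omega>\<bar>) * \<psi> (real k) (Y \<omega>)) \<le> \<bar>Z \<omega>\<bar> + \<bar>Y \<omega>\<bar>" for k
      using psi01[of "real k"] by (intro AE_I2) (simp add: abs_mult mult_left_le)
    show "AE \<omega> in M. (\<lambda>k. (\<bar>Z \<omega>\<bar> + \<bar>Y \<omega>\<bar>) * \<psi> (real k) (Y \<omega>)) \<longlonglongrightarrow> 0"
    proof (intro AE_I2)
      fix \<omega>
      obtain k0 where "\<bar>Y \<omega>\<bar> + 1 < real k0" using reals_Archimedean2 by blast
      then have "\<forall>\<^sub>F k in sequentially. (\<bar>Z \<omega>\<bar> + \<bar>Y \<omega>\<bar>) * \<psi> (real k) (Y \<omega>) = 0"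
        by (intro eventually_sequentiallyI[of k0]) (auto simp: \<psi>_def min_def max_def)
      then show "(\<lambda>k. (\<bar>Z \<omega>\<bar> + \<bar>Y \<omega>\<bar>) * \<psi> (real k) (Y \<omega>)) \<longlonglongrightarrow> 0"
        by (simp add: tendsto_eventually)
    qed
  qed auto
  have z2: "(\<lambda>m. \<integral>\<omega>. \<bar>Z \<omega>\<bar> * \<psi> K (X m \<omega>) \<partial>M) \<longlonglongrightarrow> (\<integral>\<omega>. \<bar>Z \<omega>\<bar> * \<psi> K (Y \<omega>) \<partial>M)" for K
  proof (rule integral_dominated_convergence[where w = "\<lambda>\<omega>. \<bar>Z \<omega>\<bar>"])
    show "AE \<omega> in M. norm (\<bar>Z \<omega>\<bar> * \<psi> K (X m \<omega>)) \<le> \<bar>Z \<omega>\<bar>" for m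
      using psi01 by (intro AE_I2) (simp add: abs_mult mult_left_le)
  qed (use Z in \<open>auto intro!: tendsto_intros psi_cont AE_I2\<close>)
  have z3: "(\<lambda>m. \<integral>\<omega>. \<bar>\<phi> K (X m \<omega>) - \<phi> K (Y \<omega>)\<bar> \<partial>M) \<longlonglongrightarrow> (\<integral>\<omega>. 0 \<partial>M)" if "0 \<le> K" for K
  proof (rule integral_dominated_convergence[where w = "\<lambda>\<omega>. 2 * K"])
    show "AE \<omega> in M. norm \<bar>\<phi> K (X m \<omega>) - \<phi> K (Y \<omega>)\<bar> \<le> 2 * K" for m
      using that by (intro AE_I2) (auto simp: \<phi>_def min_def max_def)
    show "AE \<omega> in M. (\<lambda>m. \<bar>\<phi> K (X m \<omega>) - \<phi> K (Y \<omega>)\<bar>) \<longlonglongrightarrow> 0"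
    proof (intro AE_I2)
      fix \<omega> assume "\<omega> \<in> space M"
      then have "(\<lambda>m. \<bar>\<phi> K (X m \<omega>) - \<phi> K (Y \<omega>)\<bar>) \<longlonglongrightarrow> \<bar>\<phi> K (Y \<omega>) - \<phi> K (Y \<omega>)\<bar>"
        by (intro tendsto_intros phi_cont)
      then show "(\<lambda>m. \<bar>\<phi> K (X m \<omega>) - \<phi> K (Y \<omega>)\<bar>) \<longlonglongrightarrow> 0" by simp
    qed
  qed auto
  show "(\<lambda>m. \<integral>\<omega>. \<bar>X m \<omega> - Y \<omega>\<bar> \<partial>M) \<longlonglongrightarrow> 0"
  proof (rule order_tendstoI)
    fix \<eta> :: real assume "0 < \<eta>"
    then have "\<forall>\<^sub>F k in sequentially. (\<integral>\<omega>. (\<bar>Z \<omega>\<bar> + \<bar>Y \<omega>\<bar>) * \<psi> (real k) (Y \<omega>) \<partial>M) < \<eta>"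
      by (intro order_tendstoD(2)[OF z1]) simp
    from eventually_happens'[OF sequentially_bot this]
    obtain k where k: "(\<integral>\<omega>. (\<bar>Z \<omega>\<bar> + \<bar>Y \<omega>\<bar>) * \<psi> (real k) (Y \<omega>) \<partial>M) < \<eta>" ..
    \<comment> \<open>The level is chosen from \<open>Y\<close> and \<open>Z\<close> alone, before
      m; the quantity just made small is the limit of the bound \<open>le\<close> below.\<close>
    define K where "K = real k"
    have iYp: "integrable M (\<lambda>\<omega>. \<bar>Y \<omega>\<bar> * \<psi> K (Y \<omega>))" "integrable M (\<lambda>\<omega>. \<bar>Z \<omega>\<bar> * \<psi> K (Y \<omega>))"
      "integrable M (\<lambda>\<omega>. \<bar>Z \<omega>\<bar> * \<psi> K (X m \<omega>))" for m
    proof -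
      show "integrable M (\<lambda>\<omega>. \<bar>Y \<omega>\<bar> * \<psi> K (Y \<omega>))"
        by (rule Bochner_Integration.integrable_bound[of M "\<lambda>\<omega>. \<bar>Y \<omega>\<bar>"])
           (use Y psi01 in \<open>auto simp: abs_mult mult_left_le\<close>)
      show "integrable M (\<lambda>\<omega>. \<bar>Z \<omega>\<bar> * \<psi> K (Y \<omega>))"
        by (rule Bochner_Integration.integrable_bound[of M "\<lambda>\<omega>. \<bar>Z \<omega>\<bar>"])
           (use Z psi01 in \<open>auto simp: abs_mult mult_left_le\<close>)
      show "integrable M (\<lambda>\<omega>. \<bar>Z \<omega>\<bar> * \<psi> K (X m \<omega>))"
        by (rule Bochner_Integration.integrable_bound[of M "\<lambda>\<omega>. \<bar>Z \<omega>\<bar>"])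
           (use Z psi01 in \<open>auto simp: abs_mult mult_left_le\<close>)
    qed
    have i1: "integrable M (\<lambda>\<omega>. \<bar>X m \<omega>\<bar> * indicator {\<omega>. K < \<bar>X m \<omega>\<bar>} \<omega>)"
      "integrable M (\<lambda>\<omega>. \<bar>Z \<omega>\<bar> * indicator {\<omega>. K < \<bar>X m \<omega>\<bar>} \<omega>)"
      "integrable M (\<lambda>\<omega>. \<bar>\<phi> K (X m \<omega>) - \<phi> K (Y \<omega>)\<bar>)" for m
    proof -
      show "integrable M (\<lambda>\<omega>. \<bar>X m \<omega>\<bar> * indicator {\<omega>. K < \<bar>X m \<omega>\<bar>} \<omega>)"
        by (rule Bochner_Integration.integrable_bound[of M "\<lambda>\<omega>. \<bar>X m \<omega>\<bar>"])
           (use int in \<open>auto simp: indicator_def\<close>)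
      show "integrable M (\<lambda>\<omega>. \<bar>Z \<omega>\<bar> * indicator {\<omega>. K < \<bar>X m \<omega>\<bar>} \<omega>)"
        by (rule Bochner_Integration.integrable_bound[of M "\<lambda>\<omega>. \<bar>Z \<omega>\<bar>"])
           (use Z in \<open>auto simp: indicator_def\<close>)
      show "integrable M (\<lambda>\<omega>. \<bar>\<phi> K (X m \<omega>) - \<phi> K (Y \<omega>)\<bar>)"
        by (rule integrable_const_bound[of _ "2 * K"]) (auto simp: \<phi>_def K_def min_def max_def)
    qed
    have le: "(\<integral>\<omega>. \<bar>X m \<omega> - Y \<omega>\<bar> \<partial>M) \<le> (\<integral>\<omega>. \<bar>\<phi> K (X m \<omega>) - \<phi> K (Y \<omega>)\<bar> \<partial>M)
       + (\<integral>\<omega>. \<bar>Z \<omega>\<bar> * \<psi> K (X m \<omega>) \<partial>M) + (\<integral>\<omega>. \<bar>Y \<omega>\<bar> * \<psi> K (Y \<omega>) \<partial>M)" for m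
    proof -
      have "(\<integral>\<omega>. \<bar>X m \<omega> - Y \<omega>\<bar> \<partial>M) \<le> (\<integral>\<omega>. \<bar>\<phi> K (X m \<omega>) - \<phi> K (Y \<omega>)\<bar>
          + \<bar>X m \<omega>\<bar> * indicator {\<omega>. K < \<bar>X m \<omega>\<bar>} \<omega> + \<bar>Y \<omega>\<bar> * \<psi> K (Y \<omega>) \<partial>M)"
      proof (rule integral_mono)
        fix \<omega>
        have "\<bar>X m \<omega> - \<phi> K (X m \<omega>)\<bar> \<le> \<bar>X m \<omega>\<bar> * indicator {\<omega>. K < \<bar>X m \<omega>\<bar>} \<omega>"
          by (auto simp: \<phi>_def K_def indicator_def min_def max_def)
        moreover have "\<bar>Y \<omega> - \<phi> K (Y \<omega>)\<bar> \<le> \<bar>Y \<omega>\<bar> * \<psi> K (Y \<omega>)"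
        proof (cases "K < \<bar>Y \<omega>\<bar>")
          case True
          then have "\<psi> K (Y \<omega>) = 1" by (auto simp: \<psi>_def)
          then show ?thesis using True by (auto simp: \<phi>_def K_def min_def max_def)
        next
          case False
          then have "\<phi> K (Y \<omega>) = Y \<omega>" by (auto simp: \<phi>_def K_def min_def max_def)
          then show ?thesis using psi01 by simp
        qed
        ultimately show "\<bar>X m \<omega> - Y \<omega>\<bar> \<le> \<bar>\<phi> K (X m \<omega>) - \<phi> K (Y \<omega>)\<bar>
          + \<bar>X m \<omega>\<bar> * indicator {\<omega>. K < \<bar>X m \<omega>\<bar>} \<omega> + \<bar>Y \<omega>\<bar> * \<psi> K (Y \<omega>)"
          by linarith
      qed (use i1 iYp Y int in auto)
      also have "\<dots> = (\<integral>\<omega>. \<bar>\<phi> K (X m \<omega>) - \<phi> K (Y \<omega>)\<bar> \<partial>M)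
          + (\<integral>\<omega>. \<bar>X m \<omega>\<bar> * indicator {\<omega>. K < \<bar>X m \<omega>\<bar>} \<omega> \<partial>M) + (\<integral>\<omega>. \<bar>Y \<omega>\<bar> * \<psi> K (Y \<omega>) \<partial>M)"
        using i1 iYp by simp
      also have "(\<integral>\<omega>. \<bar>X m \<omega>\<bar> * indicator {\<omega>. K < \<bar>X m \<omega>\<bar>} \<omega> \<partial>M) \<le> (\<integral>\<omega>. \<bar>Z \<omega>\<bar> * \<psi> K (X m \<omega>) \<partial>M)"
        using dom[of m K]
        by (rule order_trans) (intro integral_mono i1 iYp mult_left_mono,
            auto simp: \<psi>_def indicator_def)
      finally show ?thesis by simp
    qed
    have "(\<lambda>m. (\<integral>\<omega>. \<bar>\<phi> K (X m \<omega>) - \<phi> K (Y \<omega>)\<bar> \<partial>M)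
       + (\<integral>\<omega>. \<bar>Z \<omega>\<bar> * \<psi> K (X m \<omega>) \<partial>M) + (\<integral>\<omega>. \<bar>Y \<omega>\<bar> * \<psi> K (Y \<omega>) \<partial>M)) \<longlonglongrightarrow>
       0 + (\<integral>\<omega>. \<bar>Z \<omega>\<bar> * \<psi> K (Y \<omega>) \<partial>M) + (\<integral>\<omega>. \<bar>Y \<omega>\<bar> * \<psi> K (Y \<omega>) \<partial>M)"
      by (intro tendsto_intros z2) (use z3[of K] in \<open>simp add: K_def\<close>)
    moreover have "0 + (\<integral>\<omega>. \<bar>Z \<omega>\<bar> * \<psi> K (Y \<omega>) \<partial>M) + (\<integral>\<omega>. \<bar>Y \<omega>\<bar> * \<psi> K (Y \<omega>) \<partial>M) < \<eta>"
      using k iYp by (simp add: K_def distrib_right)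
    ultimately have "\<forall>\<^sub>F m in sequentially. (\<integral>\<omega>. \<bar>\<phi> K (X m \<omega>) - \<phi> K (Y \<omega>)\<bar> \<partial>M)
       + (\<integral>\<omega>. \<bar>Z \<omega>\<bar> * \<psi> K (X m \<omega>) \<partial>M) + (\<integral>\<omega>. \<bar>Y \<omega>\<bar> * \<psi> K (Y \<omega>) \<partial>M) < \<eta>"
      by (rule order_tendstoD(2))
    then show "\<forall>\<^sub>F m in sequentially. (\<integral>\<omega>. \<bar>X m \<omega> - Y \<omega>\<bar> \<partial>M) < \<eta>"
      by (rule eventually_mono) (use le order_le_less_trans in blast)
  next
    fix a :: real assume "a < 0"
    moreover have "0 \<le> (\<integral>\<omega>. \<bar>X m \<omega> - Y \<omega>\<bar> \<partial>M)" for m by simp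
    ultimately show "\<forall>\<^sub>F m in sequentially. a < (\<integral>\<omega>. \<bar>X m \<omega> - Y \<omega>\<bar> \<partial>M)"
      by (intro always_eventually allI) (meson order_less_le_trans)
  qed
qed

section \<open>Martingales at bounded stopping times\<close>

lemma martingale_set_integral_eq:
  assumes "prob_space M" and "is_filtration M F" and X: "is_martingale M F X"
    and s: "0 \<le> s" "s \<le> t" and B: "B \<in> sets (F s)"
  shows "(\<integral>\<omega>. X s \<omega> * indicator B \<omega> \<partial>M) = (\<integral>\<omega>. X t \<omega> * indicator B \<omega> \<partial>M)"
proof -
  interpret prob_space M by fact
  have sub: "subalgebra M (F s)" using assms(2) s by (auto simp: is_filtration_def)
  interpret finite_measure_subalgebra M "F s"
    by unfold_locales (rule sub)
  have int: "integrable M (X t)" "integrable M (X s)" and ad: "X s \<in> borel_measurable (F s)"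
    using X s by (auto simp: is_martingale_def)
  have BM[measurable]: "B \<in> sets M" using B sub by (auto simp: subalgebra_def)
  have [measurable]: "real_cond_exp M (F s) (X t) \<in> borel_measurable M" "X s \<in> borel_measurable M"
    "X t \<in> borel_measurable M"
    using int by (auto simp: borel_measurable_cond_exp2)
  have ae: "AE \<omega> in M. real_cond_exp M (F s) (X t) \<omega> = X s \<omega>"
    using X s by (auto simp: is_martingale_def)
  have "(\<integral>\<omega>\<in>B. X t \<omega> \<partial>M) = (\<integral>\<omega>\<in>B. real_cond_exp M (F s) (X t) \<omega> \<partial>M)"
    by (rule real_cond_exp_intA) (use int B in auto)
  also have "\<dots> = (\<integral>\<omega>\<in>B. X s \<omega> \<partial>M)"
    unfolding set_lebesgue_integral_def
    by (rule integral_cong_AE) (use ae in \<open>auto elim!: eventually_mono\<close>)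
  finally show ?thesis by (simp add: set_lebesgue_integral_def mult.commute)
qed

text \<open>Conditional Jensen for the absolute value, done by hand: \<open>B\<close> is cut by the
  sign of \<open>X s\<close>, which leaves two sets of \<open>F s\<close>, and the martingale
  identity applies on each.\<close>

lemma martingale_set_integral_abs_le:
  assumes P: "prob_space M" and F: "is_filtration M F" and X: "is_martingale M F X"
    and s: "0 \<le> s" "s \<le> t" and B: "B \<in> sets (F s)"
  shows "(\<integral>\<omega>. \<bar>X s \<omega>\<bar> * indicator B \<omega> \<partial>M) \<le> (\<integral>\<omega>. \<bar>X t \<omega>\<bar> * indicator B \<omega> \<partial>M)"
proof -
  have int: "integrable M (X t)" "integrable M (X s)" and ad[measurable]: "X s \<in> borel_measurable (F s)"
    using X s by (auto simp: is_martingale_def)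
  have sub: "sets (F s) \<subseteq> sets M" using F s by (auto simp: is_filtration_def subalgebra_def)
  note B[measurable]
  define P where "P = {\<omega> \<in> space (F s). 0 \<le> X s \<omega>} \<inter> B"
  define Q where "Q = {\<omega> \<in> space (F s). X s \<omega> < 0} \<inter> B"
  have PQ: "P \<in> sets (F s)" "Q \<in> sets (F s)" unfolding P_def Q_def by measurable
  then have PQM: "P \<in> sets M" "Q \<in> sets M" "B \<in> sets M" using sub B by auto
  have BS: "B \<subseteq> space (F s)" by (rule sets.sets_into_space[OF B])
  have inti: "integrable M (\<lambda>\<omega>. f \<omega> * indicator H \<omega>)"
    if "H \<in> sets M" "integrable M f" for f :: "'a \<Rightarrow> real" and H
    using integrable_mult_indicator[OF that] by (simp add: mult.commute)
  note i = inti[OF PQM(1) int(1)] inti[OF PQM(1) int(2)] inti[OF PQM(2) int(1)] inti[OF PQM(2) int(2)]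
    inti[OF PQM(3) integrable_abs[OF int(1)]]
  have "(\<integral>\<omega>. \<bar>X s \<omega>\<bar> * indicator B \<omega> \<partial>M)
      = (\<integral>\<omega>. X s \<omega> * indicator P \<omega> - X s \<omega> * indicator Q \<omega> \<partial>M)"
    using BS by (intro Bochner_Integration.integral_cong) (auto simp: P_def Q_def indicator_def)
  also have "\<dots> = (\<integral>\<omega>. X s \<omega> * indicator P \<omega> \<partial>M) - (\<integral>\<omega>. X s \<omega> * indicator Q \<omega> \<partial>M)"
    by (intro Bochner_Integration.integral_diff i)
  also have "\<dots> = (\<integral>\<omega>. X t \<omega> * indicator P \<omega> \<partial>M) - (\<integral>\<omega>. X t \<omega> * indicator Q \<omega> \<partial>M)"
    by (simp only: martingale_set_integral_eq[OF P F X s] PQ)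
  also have "\<dots> = (\<integral>\<omega>. X t \<omega> * indicator P \<omega> - X t \<omega> * indicator Q \<omega> \<partial>M)"
    by (intro Bochner_Integration.integral_diff[symmetric] i)
  also have "\<dots> \<le> (\<integral>\<omega>. \<bar>X t \<omega>\<bar> * indicator B \<omega> \<partial>M)"
    by (intro integral_mono Bochner_Integration.integrable_diff i)
      (auto simp: P_def Q_def indicator_def)
  finally show ?thesis .
qed

text \<open>The hypothesis on \<open>C\<close> is membership in the sigma-algebra of events up to
  time \<open>\<rho>\<close>. As \<open>\<rho>\<close> takes finitely many values, everything
  reduces to the martingale property between a value r and the fixed time u, on the part of
  \<open>C\<close> where \<open>\<rho> = r\<close>. The third claim is the domination behind uniform
  integrability, with the single variable \<open>X u\<close> as bound.\<close>

lemma optional_stopping_discrete: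
  assumes P: "prob_space M" and F: "is_filtration M F" and X: "is_martingale M F X"
    and G: "finite G" "G \<subseteq> {0..u}"
    and \<rho>: "\<And>\<omega>. \<omega> \<in> space M \<Longrightarrow> \<rho> \<omega> \<in> G"
    and st: "\<And>r. r \<in> G \<Longrightarrow> {\<omega> \<in> space M. \<rho> \<omega> = r} \<in> sets (F r)"
    and C: "\<And>r. r \<in> G \<Longrightarrow> C \<inter> {\<omega> \<in> space M. \<rho> \<omega> = r} \<in> sets (F r)"
  shows "integrable M (\<lambda>\<omega>. X (\<rho> \<omega>) \<omega>)"
    and "(\<integral>\<omega>. X (\<rho> \<omega>) \<omega> * indicator C \<omega> \<partial>M) = (\<integral>\<omega>. X u \<omega> * indicator C \<omega> \<partial>M)"
    and "(\<integral>\<omega>. \<bar>X (\<rho> \<omega>) \<omega>\<bar> * indicator C \<omega> \<partial>M) \<le> (\<integral>\<omega>. \<bar>X u \<omega>\<bar> * indicator C \<omega> \<partial>M)"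
proof -
  define E where "E r = {\<omega> \<in> space M. \<rho> \<omega> = r}" for r
  have G0: "0 \<le> r" "r \<le> u" if "r \<in> G" for r using G that by auto
  have int: "integrable M (X r)" if "0 \<le> r" for r using X that by (auto simp: is_martingale_def)
  have sub: "sets (F r) \<subseteq> sets M" if "0 \<le> r" for r
    using F that by (auto simp: is_filtration_def subalgebra_def)
  have inti: "integrable M (\<lambda>\<omega>. X r \<omega> * indicator H \<omega>)" "integrable M (\<lambda>\<omega>. \<bar>X r \<omega>\<bar> * indicator H \<omega>)"
    if "H \<in> sets M" "0 \<le> r" for r H
    using integrable_mult_indicator[OF that(1) int[OF that(2)]]
      integrable_mult_indicator[OF that(1) integrable_abs[OF int[OF that(2)]]]
    by (simp_all add: mult.commute)
  have EM: "E r \<in> sets M" "C \<inter> E r \<in> sets M" if "r \<in> G" for r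
    using st[OF that] C[OF that] sub[OF G0(1)[OF that]] by (auto simp: E_def)
  have dec: "(\<Sum>r\<in>G. f r * indicator (H \<inter> E r) \<omega>) = f (\<rho> \<omega>) * indicator H \<omega>"
    if "\<omega> \<in> space M" for f :: "real \<Rightarrow> real" and H \<omega>
  proof -
    have "(\<Sum>r\<in>G. f r * indicator (H \<inter> E r) \<omega>) = (\<Sum>r\<in>G. if r = \<rho> \<omega> then f r * indicator H \<omega> else 0)"
      using that by (intro sum.cong) (auto simp: E_def indicator_def)
    then show ?thesis using G \<rho>[OF that] by (simp add: sum.delta')
  qed
  have "integrable M (\<lambda>\<omega>. \<Sum>r\<in>G. X r \<omega> * indicator (UNIV \<inter> E r) \<omega>)"
    by (intro Bochner_Integration.integrable_sum inti) (use EM G0 in auto)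
  then show "integrable M (\<lambda>\<omega>. X (\<rho> \<omega>) \<omega>)"
    using dec[where H = UNIV] by (subst (asm) Bochner_Integration.integrable_cong[OF refl]) auto
  have "(\<integral>\<omega>. X (\<rho> \<omega>) \<omega> * indicator C \<omega> \<partial>M) = (\<integral>\<omega>. (\<Sum>r\<in>G. X r \<omega> * indicator (C \<inter> E r) \<omega>) \<partial>M)"
    by (intro Bochner_Integration.integral_cong refl dec[symmetric])
  also have "\<dots> = (\<Sum>r\<in>G. \<integral>\<omega>. X r \<omega> * indicator (C \<inter> E r) \<omega> \<partial>M)"
    by (intro Bochner_Integration.integral_sum inti) (use EM G0 in auto)
  also have "\<dots> = (\<Sum>r\<in>G. \<integral>\<omega>. X u \<omega> * indicator (C \<inter> E r) \<omega> \<partial>M)"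
    by (intro sum.cong refl martingale_set_integral_eq[OF P F X]) (use C G0 in \<open>auto simp: E_def\<close>)
  also have "\<dots> = (\<integral>\<omega>. (\<Sum>r\<in>G. X u \<omega> * indicator (C \<inter> E r) \<omega>) \<partial>M)"
    by (intro Bochner_Integration.integral_sum[symmetric] inti) (use EM G0 in force)+
  also have "\<dots> = (\<integral>\<omega>. X u \<omega> * indicator C \<omega> \<partial>M)"
    by (intro Bochner_Integration.integral_cong refl dec)
  finally show "(\<integral>\<omega>. X (\<rho> \<omega>) \<omega> * indicator C \<omega> \<partial>M) = (\<integral>\<omega>. X u \<omega> * indicator C \<omega> \<partial>M)" .
  have "(\<integral>\<omega>. \<bar>X (\<rho> \<omega>) \<omega>\<bar> * indicator C \<omega> \<partial>M) = (\<integral>\<omega>. (\<Sum>r\<in>G. \<bar>X r \<omega>\<bar> * indicator (C \<inter> E r) \<omega>) \<partial>M)"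
    by (intro Bochner_Integration.integral_cong refl dec[symmetric])
  also have "\<dots> = (\<Sum>r\<in>G. \<integral>\<omega>. \<bar>X r \<omega>\<bar> * indicator (C \<inter> E r) \<omega> \<partial>M)"
    by (intro Bochner_Integration.integral_sum inti) (use EM G0 in auto)
  also have "\<dots> \<le> (\<Sum>r\<in>G. \<integral>\<omega>. \<bar>X u \<omega>\<bar> * indicator (C \<inter> E r) \<omega> \<partial>M)"
    by (intro sum_mono martingale_set_integral_abs_le[OF P F X]) (use C G0 in \<open>auto simp: E_def\<close>)
  also have "\<dots> = (\<integral>\<omega>. (\<Sum>r\<in>G. \<bar>X u \<omega>\<bar> * indicator (C \<inter> E r) \<omega>) \<partial>M)"
    by (intro Bochner_Integration.integral_sum[symmetric] inti) (use EM G0 in force)+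
  also have "\<dots> = (\<integral>\<omega>. \<bar>X u \<omega>\<bar> * indicator C \<omega> \<partial>M)"
    by (intro Bochner_Integration.integral_cong refl dec)
  finally show "(\<integral>\<omega>. \<bar>X (\<rho> \<omega>) \<omega>\<bar> * indicator C \<omega> \<partial>M) \<le> (\<integral>\<omega>. \<bar>X u \<omega>\<bar> * indicator C \<omega> \<partial>M)" .
qed

lemma right_continuous_sequentially:
  fixes x :: "real \<Rightarrow> real"
  assumes "(x \<longlongrightarrow> x r) (at_right r)" "\<And>m. r \<le> \<rho> m" "\<rho> \<longlonglongrightarrow> r"
  shows "(\<lambda>m. x (\<rho> m)) \<longlonglongrightarrow> x r"
proof (rule tendstoI)
  fix e :: real assume "0 < e"
  from tendstoD[OF assms(1) this]
  obtain b where b: "r < b" "\<And>y. r < y \<Longrightarrow> y < b \<Longrightarrow> dist (x y) (x r) < e"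
    by (auto simp: eventually_at_right_field)
  have "\<forall>\<^sub>F m in sequentially. \<rho> m < b"
    using assms(3) b(1) by (rule order_tendstoD)
  then show "\<forall>\<^sub>F m in sequentially. dist (x (\<rho> m)) (x r) < e"
  proof (rule eventually_mono)
    fix m assume "\<rho> m < b"
    then show "dist (x (\<rho> m)) (x r) < e"
      using b(2)[of "\<rho> m"] assms(2)[of m] \<open>0 < e\<close> by (cases "\<rho> m = r") auto
  qed
qed

text \<open>\<open>R\<close> enters only as a limit from above of grid-valued stopping times, which
  is enough for right continuous paths. The integrals converge by uniform integrability, obtained
  from \<open>optional_stopping_discrete\<close> with \<open>C\<close> the event that the stopped
  value exceeds K.\<close>

lemma optional_stopping:
  assumes P: "prob_space M" and F: "is_filtration M F" and X: "is_martingale M F X"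
    and rc: "\<And>\<omega> r. \<omega> \<in> space M \<Longrightarrow> 0 \<le> r \<Longrightarrow> ((\<lambda>s. X s \<omega>) \<longlongrightarrow> X r \<omega>) (at_right r)"
    and s: "0 \<le> s" "s \<le> u"
    and G: "\<And>m. finite (G m)" "\<And>m. G m \<subseteq> {s..u}"
    and \<rho>: "\<And>m \<omega>. \<omega> \<in> space M \<Longrightarrow> \<rho> m \<omega> \<in> G m"
    and st: "\<And>m r. r \<in> G m \<Longrightarrow> {\<omega> \<in> space M. \<rho> m \<omega> = r} \<in> sets (F r)"
    and R: "\<And>\<omega>. \<omega> \<in> space M \<Longrightarrow> 0 \<le> R \<omega>" "\<And>m \<omega>. \<omega> \<in> space M \<Longrightarrow> R \<omega> \<le> \<rho> m \<omega>"
      "\<And>\<omega>. \<omega> \<in> space M \<Longrightarrow> (\<lambda>m. \<rho> m \<omega>) \<longlonglongrightarrow> R \<omega>"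
    and B: "B \<in> sets (F s)"
  shows "integrable M (\<lambda>\<omega>. X (R \<omega>) \<omega>)"
    and "(\<integral>\<omega>. X (R \<omega>) \<omega> * indicator B \<omega> \<partial>M) = (\<integral>\<omega>. X s \<omega> * indicator B \<omega> \<partial>M)"
proof -
  interpret prob_space M by fact
  have G': "G m \<subseteq> {0..u}" "r \<in> G m \<Longrightarrow> 0 \<le> r \<and> s \<le> r" for m r using G[of m] s by auto
  note osd = optional_stopping_discrete[OF P F X G(1) G'(1) \<rho> st]
  have mon: "sets (F a) \<subseteq> sets (F b)" if "0 \<le> a" "a \<le> b" for a b
    using F that by (auto simp: is_filtration_def)
  have sp: "space (F a) = space M" if "0 \<le> a" for a
    using F that by (auto simp: is_filtration_def subalgebra_def)
  have C: "{\<omega>. K < \<bar>X (\<rho> m \<omega>) \<omega>\<bar>} \<inter> {\<omega> \<in> space M. \<rho> m \<omega> = r} \<in> sets (F r)" if "r \<in> G m" for m r K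
  proof -
    have [measurable]: "X r \<in> borel_measurable (F r)" using X G'(2)[OF that] by (auto simp: is_martingale_def)
    have "{\<omega> \<in> space (F r). K < \<bar>X r \<omega>\<bar>} \<inter> {\<omega> \<in> space M. \<rho> m \<omega> = r} \<in> sets (F r)"
      using st[OF that] by (intro sets.Int) auto
    also have "{\<omega> \<in> space (F r). K < \<bar>X r \<omega>\<bar>} \<inter> {\<omega> \<in> space M. \<rho> m \<omega> = r}
      = {\<omega>. K < \<bar>X (\<rho> m \<omega>) \<omega>\<bar>} \<inter> {\<omega> \<in> space M. \<rho> m \<omega> = r}"
      using sp G'(2)[OF that] by auto
    finally show ?thesis .
  qed
  have BC: "B \<inter> {\<omega> \<in> space M. \<rho> m \<omega> = r} \<in> sets (F r)" if "r \<in> G m" for m r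
    using mon[OF s(1), of r] B G'(2)[OF that] st[OF that] by auto
  have intm: "integrable M (\<lambda>\<omega>. X (\<rho> m \<omega>) \<omega>)" for m
    by (rule osd(1)[where C = B]) (use BC in auto)
  have intu: "integrable M (X u)" "integrable M (X s)" using X s by (auto simp: is_martingale_def)
  have lim: "(\<lambda>m. X (\<rho> m \<omega>) \<omega>) \<longlonglongrightarrow> X (R \<omega>) \<omega>" if "\<omega> \<in> space M" for \<omega>
    using right_continuous_sequentially[OF rc[OF that R(1)[OF that]] R(2)[OF that] R(3)[OF that]] .
  have ui: "integrable M (\<lambda>\<omega>. X (R \<omega>) \<omega>)"
    "(\<lambda>m. \<integral>\<omega>. \<bar>X (\<rho> m \<omega>) \<omega> - X (R \<omega>) \<omega>\<bar> \<partial>M) \<longlonglongrightarrow> 0"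
    using uniformly_integrable_tendsto_L1[of "\<lambda>m \<omega>. X (\<rho> m \<omega>) \<omega>" M "X u" "\<lambda>\<omega>. X (R \<omega>) \<omega>",
        OF borel_measurable_integrable[OF intm] intu(1) lim intm osd(3)[OF _ _ C] finite_measure_axioms]
    by blast+
  show "integrable M (\<lambda>\<omega>. X (R \<omega>) \<omega>)" by (rule ui)
  have BM: "B \<in> sets M" using B F s by (auto simp: is_filtration_def subalgebra_def)
  have im: "integrable M (\<lambda>\<omega>. f \<omega> * indicator B \<omega>)" if "integrable M f" for f :: "'a \<Rightarrow> real"
    using integrable_mult_indicator[OF BM that] by (simp add: mult.commute)
  have eq: "(\<integral>\<omega>. X (\<rho> m \<omega>) \<omega> * indicator B \<omega> \<partial>M) = (\<integral>\<omega>. X s \<omega> * indicator B \<omega> \<partial>M)" for m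
    using osd(2)[of m B, OF _ _ BC] martingale_set_integral_eq[OF P F X s B] by simp
  have "\<bar>(\<integral>\<omega>. X s \<omega> * indicator B \<omega> \<partial>M) - (\<integral>\<omega>. X (R \<omega>) \<omega> * indicator B \<omega> \<partial>M)\<bar>
     \<le> (\<integral>\<omega>. \<bar>X (\<rho> m \<omega>) \<omega> - X (R \<omega>) \<omega>\<bar> \<partial>M)" for m
  proof -
    have "\<bar>(\<integral>\<omega>. X s \<omega> * indicator B \<omega> \<partial>M) - (\<integral>\<omega>. X (R \<omega>) \<omega> * indicator B \<omega> \<partial>M)\<bar>
      = \<bar>\<integral>\<omega>. X (\<rho> m \<omega>) \<omega> * indicator B \<omega> - X (R \<omega>) \<omega> * indicator B \<omega> \<partial>M\<bar>"
      unfolding eq[symmetric, of m] by (subst Bochner_Integration.integral_diff[OF im[OF intm] im[OF ui(1)]]) simp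
    also have "\<dots> \<le> (\<integral>\<omega>. \<bar>X (\<rho> m \<omega>) \<omega> * indicator B \<omega> - X (R \<omega>) \<omega> * indicator B \<omega>\<bar> \<partial>M)"
      by (rule integral_abs_bound)
    also have "\<dots> \<le> (\<integral>\<omega>. \<bar>X (\<rho> m \<omega>) \<omega> - X (R \<omega>) \<omega>\<bar> \<partial>M)"
      by (intro integral_mono integrable_abs Bochner_Integration.integrable_diff im intm ui(1))
        (simp add: indicator_def)
    finally show ?thesis .
  qed
  then have "\<bar>(\<integral>\<omega>. X s \<omega> * indicator B \<omega> \<partial>M) - (\<integral>\<omega>. X (R \<omega>) \<omega> * indicator B \<omega> \<partial>M)\<bar> \<le> 0"
    by (intro LIMSEQ_le_const[OF ui(2)]) auto
  then show "(\<integral>\<omega>. X (R \<omega>) \<omega> * indicator B \<omega> \<partial>M) = (\<integral>\<omega>. X s \<omega> * indicator B \<omega> \<partial>M)" by simp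
qed

subsection \<open>Stieltjes measures on the predictable sigma-algebra\<close>

definition inc_path :: "(real \<Rightarrow> real) \<Rightarrow> bool" where
  "inc_path x \<longleftrightarrow> x 0 = 0 \<and> mono_on {0..} x \<and> (\<forall>t\<ge>0. (x \<longlongrightarrow> x t) (at_right t))"

text \<open>The generalised inverse of an increasing path. If the level is never reached, this is an
  infimum over the empty set and says nothing; hence the premise \<open>v \<le> x T\<close> in the
  lemmas about it.\<close>

definition first_passage :: "(real \<Rightarrow> real) \<Rightarrow> real \<Rightarrow> real" where
  "first_passage x v = Inf {s. 0 \<le> s \<and> v \<le> x s}"

lemma inc_path_mono: "inc_path x \<Longrightarrow> 0 \<le> s \<Longrightarrow> s \<le> t \<Longrightarrow> x s \<le> x t"
  by (auto simp: inc_path_def mono_on_def)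

lemma inc_path_nonneg: "inc_path x \<Longrightarrow> 0 \<le> t \<Longrightarrow> 0 \<le> x t"
  using inc_path_mono[of x 0 t] by (simp add: inc_path_def)

text \<open>Right continuity makes the infimum attained. Therefore passing a level by time r is
  decided by the value at r, and passage times are stopping times of the raw filtration.\<close>

lemma first_passage_le_iff:
  assumes x: "inc_path x" and T: "0 \<le> T" "v \<le> x T" and r: "0 \<le> r"
  shows "first_passage x v \<le> r \<longleftrightarrow> v \<le> x r"
proof
  have bdd: "bdd_below {s. 0 \<le> s \<and> v \<le> x s}" by (rule bdd_belowI[of _ 0]) auto
  show "first_passage x v \<le> r" if "v \<le> x r"
    unfolding first_passage_def using that r by (intro cInf_lower bdd) auto
  show "v \<le> x r" if le: "first_passage x v \<le> r"
  proof (rule ccontr)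
    assume "\<not> v \<le> x r"
    then have lt: "x r < v" by simp
    have "(x \<longlongrightarrow> x r) (at_right r)" using x r by (auto simp: inc_path_def)
    from order_tendstoD(2)[OF this lt]
    obtain b where b: "r < b" "\<And>y. r < y \<Longrightarrow> y < b \<Longrightarrow> x y < v"
      by (auto simp: eventually_at_right_field)
    have "b \<le> first_passage x v"
      unfolding first_passage_def
    proof (rule cInf_greatest)
      fix s assume s: "s \<in> {s. 0 \<le> s \<and> v \<le> x s}"
      show "b \<le> s"
      proof (rule ccontr)
        assume "\<not> b \<le> s"
        then have "x s < v"
          using b(2)[of s] inc_path_mono[OF x, of s r] s lt by (cases "r < s") auto
        then show False using s by auto
      qed
    qed (use T in auto)
    then show False using le b by simp
  qed
qed

lemma first_passage_bounds:
  assumes x: "inc_path x" and T: "0 \<le> T" "v \<le> x T" and v: "0 < v"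
  shows "0 < first_passage x v" "first_passage x v \<le> T" "v \<le> x (first_passage x v)"
proof -
  show 0: "0 < first_passage x v"
    using first_passage_le_iff[OF x T, of 0] v x by (auto simp: inc_path_def not_le[symmetric])
  show "first_passage x v \<le> T" using first_passage_le_iff[OF x T T(1)] T by simp
  show "v \<le> x (first_passage x v)"
    using first_passage_le_iff[OF x T, of "first_passage x v"] 0 by simp
qed

text \<open>Density of the rationals, and monotonicity after the passage. The rational times are
  what later turns conditions on \<open>N\<close> strictly before r into countable unions.\<close>

lemma first_passage_less_iff:
  assumes x: "inc_path x" and T: "0 \<le> T" "v \<le> x T" and v: "0 < v"
  shows "first_passage x v < r \<longleftrightarrow> (\<exists>q\<in>\<rat>. 0 \<le> q \<and> q < r \<and> v \<le> x q)"
proof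
  assume "first_passage x v < r"
  then obtain q where q: "q \<in> \<rat>" "first_passage x v < q" "q < r"
    using Rats_dense_in_real by blast
  then show "\<exists>q\<in>\<rat>. 0 \<le> q \<and> q < r \<and> v \<le> x q"
    using first_passage_le_iff[OF x T, of q] first_passage_bounds[OF x T v]
    by (intro bexI[of _ q]) auto
next
  assume "\<exists>q\<in>\<rat>. 0 \<le> q \<and> q < r \<and> v \<le> x q"
  then show "first_passage x v < r" using first_passage_le_iff[OF x T] by force
qed

lemma predictable_generator_Pow:
  assumes "is_filtration M F"
  shows "({{0} \<times> B |B. B \<in> sets (F 0)} \<union> {{s<..t} \<times> B |s t B. 0 \<le> s \<and> s < t \<and> B \<in> sets (F s)})
    \<subseteq> Pow ({0..} \<times> space M)"
proof -
  have "B \<subseteq> space M" if "B \<in> sets (F s)" "0 \<le> s" for s B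
    using assms sets.sets_into_space[OF that(1)] that(2) by (auto simp: is_filtration_def subalgebra_def)
  then show ?thesis by fastforce
qed

lemma space_predictable: "space (predictable_sigma M F) = {0..} \<times> space M"
  by (simp add: predictable_sigma_def space_measure_of_conv)

lemma sets_predictable:
  "is_filtration M F \<Longrightarrow> sets (predictable_sigma M F) = sigma_sets ({0..} \<times> space M)
   ({{0} \<times> B |B. B \<in> sets (F 0)} \<union> {{s<..t} \<times> B |s t B. 0 \<le> s \<and> s < t \<and> B \<in> sets (F s)})"
  unfolding predictable_sigma_def by (rule sets_measure_of[OF predictable_generator_Pow])

text \<open>One interface for \<open>N\<close> and \<open>A\<close>, so that both Stieltjes measures
  come from a single construction and live on the same sigma-algebra.\<close>

locale increasing_process =
  fixes M :: "'a measure" and F :: "real \<Rightarrow> 'a measure" and X :: "real \<Rightarrow> 'a \<Rightarrow> real"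
  assumes filt: "is_filtration M F"
    and adapted: "0 \<le> t \<Longrightarrow> X t \<in> borel_measurable (F t)"
    and paths: "\<omega> \<in> space M \<Longrightarrow> inc_path (\<lambda>t. X t \<omega>)"
begin

definition passage :: "'a \<times> real \<Rightarrow> real \<times> 'a" where
  "passage = (\<lambda>(\<omega>, v). (first_passage (\<lambda>s. X s \<omega>) v, \<omega>))"

definition levels :: "real \<Rightarrow> ('a \<times> real) set" where
  "levels T = {(\<omega>, v). \<omega> \<in> space M \<and> 0 < v \<and> v \<le> X T \<omega>}"

text \<open>The measure that integrates a predictable \<open>g\<close> to the expectation of the Stieltjes integral
  of \<open>g\<close> with respect to \<open>X\<close> over \<open>(0, T]\<close>, obtained by the time change \<open>v \<mapsto> first_passage\<close>.\<close>

definition stieltjes :: "real \<Rightarrow> (real \<times> 'a) measure" where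
  "stieltjes T = distr (restrict_space (M \<Otimes>\<^sub>M lborel) (levels T)) (predictable_sigma M F) passage"

lemma meas_M [measurable]: "0 \<le> t \<Longrightarrow> X t \<in> borel_measurable M"
  using adapted filt by (auto simp: is_filtration_def intro: measurable_from_subalg)

lemma sets_levels: "0 \<le> T \<Longrightarrow> levels T \<in> sets (M \<Otimes>\<^sub>M lborel)"
proof -
  assume [simp]: "0 \<le> T"
  have "{z \<in> space (M \<Otimes>\<^sub>M lborel). 0 < snd z \<and> snd z \<le> X T (fst z)} \<in> sets (M \<Otimes>\<^sub>M lborel)"
    by measurable
  also have "{z \<in> space (M \<Otimes>\<^sub>M lborel). 0 < snd z \<and> snd z \<le> X T (fst z)} = levels T"
    by (auto simp: levels_def space_pair_measure)
  finally show ?thesis .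
qed

text \<open>\<open>first_passage_le_iff\<close> pulls \<open>{s<..t} \<times> B\<close> back to the
  levels between \<open>X s\<close> and \<open>X t\<close> over \<open>B\<close>, a region that is
  visibly measurable. Sets at time 0 have empty preimage, since positive levels are passed after
  0.\<close>

lemma measurable_passage:
  assumes T: "0 \<le> T"
  shows "passage \<in> restrict_space (M \<Otimes>\<^sub>M lborel) (levels T) \<rightarrow>\<^sub>M predictable_sigma M F"
  unfolding predictable_sigma_def
proof (rule measurable_measure_of[OF predictable_generator_Pow[OF filt]])
  have sp: "space (restrict_space (M \<Otimes>\<^sub>M lborel) (levels T)) = levels T"
    by (auto simp: space_restrict_space space_pair_measure levels_def)
  show "passage \<in> space (restrict_space (M \<Otimes>\<^sub>M lborel) (levels T)) \<rightarrow> {0..} \<times> space M"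
    using first_passage_bounds(1)[OF paths T] unfolding sp
    by (force simp: levels_def passage_def)
  fix y assume "y \<in> {{0} \<times> B |B. B \<in> sets (F 0)} \<union>
    {{s<..t} \<times> B |s t B. 0 \<le> s \<and> s < t \<and> B \<in> sets (F s)}"
  then consider B where "y = {0} \<times> B" | s t B where "0 \<le> s" "s < t" "B \<in> sets (F s)" "y = {s<..t} \<times> B"
    by auto
  then show "passage -` y \<inter> space (restrict_space (M \<Otimes>\<^sub>M lborel) (levels T))
    \<in> sets (restrict_space (M \<Otimes>\<^sub>M lborel) (levels T))"
  proof cases
    case 1
    have "passage -` y \<inter> levels T = {}"
      using first_passage_bounds(1)[OF paths T] unfolding 1 by (force simp: levels_def passage_def)
    then show ?thesis by (simp add: sp)
  next
    case 2
    then have [measurable]: "B \<in> sets M" using filt by (auto simp: is_filtration_def subalgebra_def)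
    have [simp]: "0 \<le> t" using 2 by simp
    note [simp] = 2(1)
    have "{z \<in> space (M \<Otimes>\<^sub>M lborel). fst z \<in> B \<and> X s (fst z) < snd z \<and> snd z \<le> X t (fst z)} \<inter> levels T
      \<in> sets (restrict_space (M \<Otimes>\<^sub>M lborel) (levels T))"
      unfolding sets_restrict_space by (subst Int_commute, rule imageI) measurable
    also have "{z \<in> space (M \<Otimes>\<^sub>M lborel). fst z \<in> B \<and> X s (fst z) < snd z \<and> snd z \<le> X t (fst z)} \<inter> levels T
      = passage -` y \<inter> levels T"
      unfolding 2(4) using first_passage_le_iff[OF paths T] 2(1)
      by (auto simp: levels_def passage_def space_pair_measure not_le[symmetric])
    finally show ?thesis by (simp add: sp)
  qed
qed

lemma sets_stieltjes [simp, measurable_cong]: "sets (stieltjes T) = sets (predictable_sigma M F)"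
  by (simp add: stieltjes_def)

text \<open>The inner integral is the Stieltjes integral of g along one path, after substitution of
  levels for times. Its measurability is kept as a second claim because it later supplies the
  measurability of a stopped value.\<close>

lemma nn_integral_stieltjes:
  assumes T: "0 \<le> T" and g: "g \<in> borel_measurable (predictable_sigma M F)"
  shows "(\<integral>\<^sup>+z. g z \<partial>stieltjes T) =
    (\<integral>\<^sup>+\<omega>. \<integral>\<^sup>+v. g (first_passage (\<lambda>s. X s \<omega>) v, \<omega>) * indicator {0<..X T \<omega>} v \<partial>lborel \<partial>M)"
    and "(\<lambda>\<omega>. \<integral>\<^sup>+v. g (first_passage (\<lambda>s. X s \<omega>) v, \<omega>) * indicator {0<..X T \<omega>} v \<partial>lborel)
      \<in> borel_measurable M"
proof -
  note meas = measurable_compose[OF measurable_passage[OF T] g]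
  have lev: "levels T \<inter> space (M \<Otimes>\<^sub>M lborel) \<in> sets (M \<Otimes>\<^sub>M lborel)"
    using sets_levels[OF T] by auto
  have m2: "(\<lambda>z. g (passage z) * indicator (levels T) z) \<in> borel_measurable (M \<Otimes>\<^sub>M lborel)"
    using meas borel_measurable_restrict_space_iff_ennreal[OF lev] by simp
  have "(\<integral>\<^sup>+z. g z \<partial>stieltjes T) = (\<integral>\<^sup>+z. g (passage z) * indicator (levels T) z \<partial>(M \<Otimes>\<^sub>M lborel))"
    unfolding stieltjes_def using measurable_passage[OF T] g lev
    by (simp add: nn_integral_distr nn_integral_restrict_space)
  also have "\<dots> = (\<integral>\<^sup>+\<omega>. \<integral>\<^sup>+v. g (passage (\<omega>, v)) * indicator (levels T) (\<omega>, v) \<partial>lborel \<partial>M)"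
    by (rule lborel.nn_integral_fst[symmetric, OF m2])
  also have "\<dots> = (\<integral>\<^sup>+\<omega>. \<integral>\<^sup>+v. g (first_passage (\<lambda>s. X s \<omega>) v, \<omega>) * indicator {0<..X T \<omega>} v \<partial>lborel \<partial>M)"
    by (intro nn_integral_cong) (auto simp: passage_def levels_def indicator_def)
  finally show "(\<integral>\<^sup>+z. g z \<partial>stieltjes T) =
    (\<integral>\<^sup>+\<omega>. \<integral>\<^sup>+v. g (first_passage (\<lambda>s. X s \<omega>) v, \<omega>) * indicator {0<..X T \<omega>} v \<partial>lborel \<partial>M)" .
  have "(\<lambda>\<omega>. \<integral>\<^sup>+v. g (passage (\<omega>, v)) * indicator (levels T) (\<omega>, v) \<partial>lborel) \<in> borel_measurable M"
    by (rule lborel.borel_measurable_nn_integral_fst[OF m2])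
  also have "?this \<longleftrightarrow> (\<lambda>\<omega>. \<integral>\<^sup>+v. g (first_passage (\<lambda>s. X s \<omega>) v, \<omega>) * indicator {0<..X T \<omega>} v \<partial>lborel)
      \<in> borel_measurable M"
    by (intro measurable_cong nn_integral_cong) (auto simp: passage_def levels_def indicator_def)
  finally show "(\<lambda>\<omega>. \<integral>\<^sup>+v. g (first_passage (\<lambda>s. X s \<omega>) v, \<omega>) * indicator {0<..X T \<omega>} v \<partial>lborel)
      \<in> borel_measurable M" .
qed

end

section \<open>Passage times of simple counting paths and their discretisation\<close>

lemma inc_path_of_counting_path:
  assumes "counting_path x"
  shows "inc_path (\<lambda>t. real (x t))"
proof -
  have "((\<lambda>s. real (x s)) \<longlongrightarrow> real (x t)) (at_right t)" if "0 \<le> t" for t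
  proof (rule tendsto_eventually)
    have "(x \<longlongrightarrow> x t) (at_right t)" using assms that by (auto simp: counting_path_def)
    then show "\<forall>\<^sub>F s in at_right t. real (x s) = real (x t)"
      by (simp add: tendsto_discrete)
  qed
  then show ?thesis using assms by (auto simp: inc_path_def counting_path_def mono_on_def)
qed

text \<open>Just before the passage the path sits at some \<open>l < n\<close>, and simplicity
  limits the landing to \<open>l + 1\<close>. This exact landing keeps the stopped \<open>N\<close>
  bounded by n.\<close>

lemma simple_path_first_passage:
  assumes x: "counting_path x" "simple_path x" and T: "0 \<le> T" "n \<le> x T" and n: "0 < n"
  shows "x (first_passage (\<lambda>t. real (x t)) (real n)) = n"
proof -
  let ?S = "first_passage (\<lambda>t. real (x t)) (real n)"
  note ip = inc_path_of_counting_path[OF x(1)]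
  have b: "0 < ?S" "n \<le> x ?S"
    using first_passage_bounds[OF ip T(1), of "real n"] T n by auto
  then obtain l where l: "(x \<longlongrightarrow> l) (at_left ?S)" "x ?S = l \<or> x ?S = l + 1"
    using x(2) unfolding simple_path_def by blast
  have "\<forall>\<^sub>F s in at_left ?S. x s = l" using l(1) by (simp add: tendsto_discrete)
  moreover have "\<forall>\<^sub>F s in at_left ?S. 0 < s"
    using eventually_at_left_real[OF b(1)] by (auto elim!: eventually_mono)
  moreover have "\<forall>\<^sub>F s in at_left ?S. s < ?S" by (simp add: eventually_at_filter)
  ultimately have "\<forall>\<^sub>F s in at_left ?S. x s = l \<and> 0 < s \<and> s < ?S" by eventually_elim auto
  from eventually_happens'[OF _ this] obtain s where s: "x s = l" "0 < s" "s < ?S" by auto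
  have "\<not> n \<le> x s"
    using first_passage_le_iff[OF ip T(1), of "real n" s] T s by auto
  then show ?thesis using s l b by auto
qed

text \<open>\<open>\<rho> m\<close> is the first point of an equidistant grid on
  \<open>[s, u]\<close> where \<open>N\<close> has reached n, or u if there is none. Whether it
  equals r depends on \<open>N\<close> at grid points up to r only, so the event lies in
  \<open>F r\<close>.\<close>

lemma stopping_grid:
  fixes N :: "real \<Rightarrow> 'a \<Rightarrow> nat" and n :: nat
  assumes cp: "\<And>\<omega>. \<omega> \<in> space M \<Longrightarrow> counting_path (\<lambda>t. N t \<omega>)"
    and F: "is_filtration M F" and ad: "\<And>t. 0 \<le> t \<Longrightarrow> N t \<in> F t \<rightarrow>\<^sub>M count_space UNIV"
    and s: "0 \<le> s" "s < u"
    and R_def: "\<And>\<omega>. R \<omega> = (if N u \<omega> < n then u else max s (first_passage (\<lambda>t. real (N t \<omega>)) (real n)))"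
  obtains G \<rho> where "\<And>m::nat. finite (G m)" "\<And>m. G m \<subseteq> {s..u}"
    "\<And>m \<omega>. \<omega> \<in> space M \<Longrightarrow> \<rho> m \<omega> \<in> G m"
    "\<And>m r. r \<in> G m \<Longrightarrow> {\<omega> \<in> space M. \<rho> m \<omega> = r} \<in> sets (F r)"
    "\<And>m \<omega>. \<omega> \<in> space M \<Longrightarrow> R \<omega> \<le> \<rho> m \<omega>"
    "\<And>\<omega>. \<omega> \<in> space M \<Longrightarrow> (\<lambda>m. \<rho> m \<omega>) \<longlonglongrightarrow> R \<omega>"
proof -
  \<comment> \<open>\<open>Suc m\<close> cells rather than m avoid a division by 0 at
    \<open>m = 0\<close>.\<close>
  define g where "g m j = s + (u - s) * real j / real (Suc m)" for m j :: nat
  \<comment> \<open>The last index qualifies by fiat, so that \<open>LEAST\<close> always has a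
    witness and an unreached level yields the time u.\<close>
  define P where "P m \<omega> j \<longleftrightarrow> j = Suc m \<or> n \<le> N (g m j) \<omega>" for m j \<omega>
  define idx where "idx m \<omega> = (LEAST j. P m \<omega> j)" for m \<omega>
  have u0: "0 \<le> u" using s by simp
  have gm: "g m i < g m j \<longleftrightarrow> i < j" for m i j
    using s by (simp add: g_def divide_less_cancel mult_less_cancel_left)
  have g0: "g m 0 = s" "g m (Suc m) = u" for m by (simp_all add: g_def)
  have gs: "s \<le> g m j" "0 \<le> g m j" for m j using s by (auto simp: g_def)
  have gle: "g m i \<le> g m j \<longleftrightarrow> i \<le> j" for m i j using gm[of m j i] by auto
  have gu: "j \<le> Suc m \<Longrightarrow> g m j \<le> u" for m j using gle[of m j "Suc m"] g0 by auto
  have Pidx: "P m \<omega> (idx m \<omega>)" for m \<omega>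
    unfolding idx_def by (rule LeastI[of _ "Suc m"]) (simp add: P_def)
  have idx_less: "j < idx m \<omega> \<Longrightarrow> \<not> P m \<omega> j" for m \<omega> j
    unfolding idx_def by (rule not_less_Least)
  have idx_le: "idx m \<omega> \<le> Suc m" for m \<omega>
    unfolding idx_def by (rule Least_le) (simp add: P_def)
  have idx_eq: "idx m \<omega> = j \<longleftrightarrow> P m \<omega> j \<and> (\<forall>i<j. \<not> P m \<omega> i)" for m \<omega> j
    using Pidx idx_less by (metis linorder_neqE_nat)
  have sp: "space (F t) = space M" if "0 \<le> t" for t
    using F that by (auto simp: is_filtration_def subalgebra_def)
  have fp: "first_passage (\<lambda>t. real (N t \<omega>)) (real n) \<le> r \<longleftrightarrow> n \<le> N r \<omega>"
    if "\<omega> \<in> space M" "n \<le> N u \<omega>" "0 \<le> r" for \<omega> r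
    using first_passage_le_iff[OF inc_path_of_counting_path[OF cp[OF that(1)]] u0, of "real n" r] that by simp
  have mono: "N a \<omega> \<le> N b \<omega>" if "\<omega> \<in> space M" "0 \<le> a" "a \<le> b" for a b \<omega>
    using cp[OF that(1)] that(2,3) by (auto simp: counting_path_def mono_on_def)
  have lower: "R \<omega> \<le> g m (idx m \<omega>)" if w: "\<omega> \<in> space M" for m \<omega>
  proof (cases "idx m \<omega> = Suc m")
    case True
    then show ?thesis using fp[OF w _ u0] s by (auto simp: R_def g0)
  next
    case False
    then have "n \<le> N (g m (idx m \<omega>)) \<omega>" using Pidx[of m \<omega>] by (auto simp: P_def)
    moreover from this have "n \<le> N u \<omega>"
      using mono[OF w gs(2) gu[OF idx_le]] by (meson le_trans)
    ultimately show ?thesis using fp[OF w _ gs(2)] gs by (auto simp: R_def)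
  qed
  show thesis
  proof (rule that[of "\<lambda>m. g m ` {..Suc m}" "\<lambda>m \<omega>. g m (idx m \<omega>)"])
    fix m :: nat
    show "finite (g m ` {..Suc m})" by simp
    show "g m ` {..Suc m} \<subseteq> {s..u}" using gs gu by auto
    show "g m (idx m \<omega>) \<in> g m ` {..Suc m}" for \<omega> using idx_le by auto
    show "{\<omega> \<in> space M. g m (idx m \<omega>) = r} \<in> sets (F r)" if r: "r \<in> g m ` {..Suc m}" for r
    proof -
      obtain j where j: "r = g m j" "j \<le> Suc m" using r by auto
      have r0: "0 \<le> r" using j gs by simp
      have ev: "{\<omega> \<in> space (F r). n \<le> N (g m i) \<omega>} \<in> sets (F r)" if "i \<le> j" for i
      proof -
        have "{\<omega> \<in> space (F (g m i)). n \<le> N (g m i) \<omega>} \<in> sets (F (g m i))"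
          using measurable_sets[OF ad[OF gs(2)], of "{n..}" m i] by (simp add: vimage_def Int_def conj_commute)
        moreover have "sets (F (g m i)) \<subseteq> sets (F r)"
          using F that gs(2) unfolding j(1) by (auto simp: is_filtration_def gle)
        ultimately show ?thesis using sp[OF r0] sp[OF gs(2), of m i] by auto
      qed
      have Pev: "{\<omega> \<in> space (F r). P m \<omega> i} \<in> sets (F r)" if "i \<le> j" for i
        unfolding P_def using ev[OF that] by (cases "i = Suc m") auto
      have "{\<omega> \<in> space (F r). P m \<omega> j \<and> (\<forall>i\<in>{..<j}. \<not> P m \<omega> i)} \<in> sets (F r)"
        by (intro sets.sets_Collect_conj sets.sets_Collect_finite_All' sets.sets_Collect_neg Pev
              sets.sets_Collect_finite_All) auto
      also have "{\<omega> \<in> space (F r). P m \<omega> j \<and> (\<forall>i\<in>{..<j}. \<not> P m \<omega> i)}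
        = {\<omega> \<in> space M. g m (idx m \<omega>) = r}"
      proof -
        have "g m (idx m \<omega>) = g m j \<longleftrightarrow> idx m \<omega> = j" for \<omega>
          using gle[of m "idx m \<omega>" j] gle[of m j "idx m \<omega>"] by (metis order_antisym order_refl)
        then show ?thesis unfolding j(1)[symmetric] sp[OF r0] using idx_eq j(1) by auto
      qed
      finally show ?thesis .
    qed
    show "R \<omega> \<le> g m (idx m \<omega>)" if "\<omega> \<in> space M" for \<omega> by (rule lower[OF that])
  next
    fix \<omega> assume w: "\<omega> \<in> space M"
    \<comment> \<open>The grid point before the chosen one has not reached n and so does not lie
      beyond \<open>R\<close>; the error is one mesh width.\<close>
    have upper: "g m (idx m \<omega>) \<le> R \<omega> + (u - s) * inverse (real (Suc m))" for m
    proof (cases "idx m \<omega>")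
      case 0
      have "s \<le> R \<omega>" using s by (auto simp: R_def)
      moreover have "0 \<le> (u - s) * inverse (real (Suc m))" using s by simp
      ultimately show ?thesis unfolding 0 g0 by linarith
    next
      case (Suc j)
      have st: "g m (Suc j) = g m j + (u - s) * inverse (real (Suc m))"
      proof -
        have "(u - s) * real (Suc j) = (u - s) * real j + (u - s)" by (simp add: algebra_simps)
        then show ?thesis by (simp only: g_def add_divide_distrib divide_inverse add.assoc distrib_right)
      qed
      have "\<not> P m \<omega> j" using idx_less[of j m \<omega>] Suc by simp
      then have "\<not> n \<le> N (g m j) \<omega>" by (auto simp: P_def)
      then have "g m j \<le> R \<omega>"
        using fp[OF w _ gs(2)[of m j]] gu[of j m] idx_le[of m \<omega>] Suc by (auto simp: R_def)
      then show ?thesis unfolding Suc st by simp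
    qed
    show "(\<lambda>m. g m (idx m \<omega>)) \<longlonglongrightarrow> R \<omega>"
    proof (rule tendsto_sandwich[where f = "\<lambda>_. R \<omega>"])
      show "(\<lambda>m. R \<omega> + (u - s) * inverse (real (Suc m))) \<longlonglongrightarrow> R \<omega>"
        using tendsto_add[OF tendsto_const tendsto_mult[OF tendsto_const LIMSEQ_inverse_real_of_nat], of "R \<omega>" "u - s"]
        by simp
    qed (use lower[OF w] upper in auto)
  qed
qed


section \<open>Equality of the Stieltjes measures of N and A on predictable sets\<close>

locale compensated =
  fixes M :: "'a measure" and F :: "real \<Rightarrow> 'a measure"
    and N :: "real \<Rightarrow> 'a \<Rightarrow> nat" and A :: "real \<Rightarrow> 'a \<Rightarrow> real"
  assumes prob: "prob_space M" and filtration: "is_filtration M F"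
    and simple: "is_simple_counting_process M N"
    and N_adapted: "\<forall>t\<ge>0. N t \<in> F t \<rightarrow>\<^sub>M count_space UNIV"
    and comp: "is_compensator M F N A"
begin

sublocale prob_space M by (rule prob)

lemma counting: "\<omega> \<in> space M \<Longrightarrow> counting_path (\<lambda>t. N t \<omega>)"
  and simple_paths: "\<omega> \<in> space M \<Longrightarrow> simple_path (\<lambda>t. N t \<omega>)"
  using simple by (auto simp: is_simple_counting_process_def)

lemma martingale: "is_martingale M F (\<lambda>t \<omega>. real (N t \<omega>) - A t \<omega>)"
  using comp by (auto simp: is_compensator_def)

lemma N_real_adapted: "0 \<le> t \<Longrightarrow> (\<lambda>\<omega>. real (N t \<omega>)) \<in> borel_measurable (F t)"
  using N_adapted by (auto intro: measurable_compose[where g = real])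

sublocale NP: increasing_process M F "\<lambda>t \<omega>. real (N t \<omega>)"
  by unfold_locales (auto simp: filtration N_real_adapted inc_path_of_counting_path counting)

sublocale AP: increasing_process M F A
proof
  show "is_filtration M F" by (rule filtration)
  show "A t \<in> borel_measurable (F t)" if "0 \<le> t" for t
  proof -
    have "(\<lambda>\<omega>. real (N t \<omega>) - A t \<omega>) \<in> borel_measurable (F t)"
      using martingale that by (auto simp: is_martingale_def)
    from borel_measurable_diff[OF N_real_adapted[OF that] this] show ?thesis by simp
  qed
  show "inc_path (\<lambda>t. A t \<omega>)" if "\<omega> \<in> space M" for \<omega>
    using comp that by (auto simp: is_compensator_def inc_path_def)
qed

text \<open>\<open>below n T\<close> is the predictable set \<open>{(r, \<omega>). 0 < r \<le> T, N (r-) < n}\<close>.\<close>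

definition below :: "nat \<Rightarrow> real \<Rightarrow> (real \<times> 'a) set" where
  "below n T = {(r, \<omega>). 0 < r \<and> r \<le> T \<and> \<omega> \<in> space M \<and> \<not> (\<exists>q\<in>\<rat>. 0 \<le> q \<and> q < r \<and> n \<le> N q \<omega>)}"

lemma rectangle_predictable:
  assumes "0 \<le> s" "B \<in> sets (F s)"
  shows "{s<..t} \<times> B \<in> sets (predictable_sigma M F)"
proof (cases "s < t")
  case True
  then show ?thesis
    unfolding sets_predictable[OF filtration] using assms by (intro sigma_sets.Basic) blast
qed simp

lemma ray_predictable:
  assumes "0 \<le> s" "B \<in> sets (F s)"
  shows "{s<..} \<times> B \<in> sets (predictable_sigma M F)"
proof -
  have "(\<Union>k::nat. {s<..real k} \<times> B) \<in> sets (predictable_sigma M F)"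
    by (intro sets.countable_UN) (use rectangle_predictable[OF assms] in auto)
  also have "(\<Union>k::nat. {s<..real k} \<times> B) = {s<..} \<times> B"
    using real_arch_simple by fastforce
  finally show ?thesis .
qed

lemma space_F: "0 \<le> t \<Longrightarrow> space (F t) = space M"
  using filtration by (auto simp: is_filtration_def subalgebra_def)

lemma sets_F: "0 \<le> t \<Longrightarrow> B \<in> sets (F t) \<Longrightarrow> B \<in> sets M"
  using filtration by (auto simp: is_filtration_def subalgebra_def)

lemma level_F: "0 \<le> t \<Longrightarrow> {\<omega> \<in> space M. n \<le> N t \<omega>} \<in> sets (F t)"
  using measurable_sets[of "N t" "F t" "count_space UNIV" "{n..}"] N_adapted space_F[of t]
  by (simp add: vimage_def Int_def conj_commute)

text \<open>The complement inside \<open>(0, T]\<close> is a countable union of rays, each starting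
  at a rational q over an event of \<open>F q\<close>. This is the predictability of the left limit
  of \<open>N\<close>.\<close>

lemma sets_below: "below n T \<in> sets (predictable_sigma M F)"
proof -
  have top: "space M \<in> sets (F 0)" using space_F[of 0] sets.top[of "F 0"] by simp
  have "{0<..T} \<times> space M - (\<Union>q\<in>\<rat> \<inter> {0..}. {q<..} \<times> {\<omega> \<in> space M. n \<le> N q \<omega>})
    \<in> sets (predictable_sigma M F)"
    by (intro sets.Diff sets.countable_UN' rectangle_predictable ray_predictable level_F top)
       (auto simp: countable_rat intro: ray_predictable level_F)
  also have "{0<..T} \<times> space M - (\<Union>q\<in>\<rat> \<inter> {0..}. {q<..} \<times> {\<omega> \<in> space M. n \<le> N q \<omega>}) = below n T"
    by (auto simp: below_def)
  finally show ?thesis .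
qed

lemma N_mono: "\<omega> \<in> space M \<Longrightarrow> 0 \<le> a \<Longrightarrow> a \<le> b \<Longrightarrow> N a \<omega> \<le> N b \<omega>"
  using counting by (auto simp: counting_path_def mono_on_def)

text \<open>On this piece of \<open>below n T\<close> each measure gives the mean increment of its
  process from s to \<open>R\<close> over \<open>B'\<close>, where \<open>R\<close> is the time at
  which \<open>N\<close> reaches n, clipped to \<open>[s, u]\<close>. The two means agree because
  \<open>N - A\<close> is a martingale stopped at \<open>R\<close>, and they are finite because
  \<open>N\<close> at \<open>R\<close> is at most n on \<open>B'\<close>.\<close>

lemma stieltjes_rectangle_eq:
  assumes n: "0 < n" and s: "0 \<le> s" "s < u" "u \<le> T" and B: "B \<in> sets (F s)"
  shows "emeasure (NP.stieltjes T) (below n T \<inter> {s<..u} \<times> B) = emeasure (AP.stieltjes T) (below n T \<inter> {s<..u} \<times> B)"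
    and "emeasure (NP.stieltjes T) (below n T \<inter> {s<..u} \<times> B) < \<infinity>"
proof -
  define R where "R = (\<lambda>\<omega>. if N u \<omega> < n then u else max s (first_passage (\<lambda>t. real (N t \<omega>)) (real n)))"
  \<comment> \<open>Where \<open>N s \<ge> n\<close> already, \<open>below n T\<close> has no point
    after s.\<close>
  define B' where "B' = {\<omega> \<in> B. N s \<omega> < n}"
  define g :: "real \<times> 'a \<Rightarrow> ennreal" where "g = indicator (below n T \<inter> {s<..u} \<times> B)"
  have u: "0 \<le> u" and T: "0 \<le> T" using s by auto
  have E: "below n T \<inter> {s<..u} \<times> B \<in> sets (predictable_sigma M F)"
    using sets_below rectangle_predictable[OF s(1) B] by auto
  then have g: "g \<in> borel_measurable (predictable_sigma M F)" by (simp add: g_def)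
  have Bsp: "B \<subseteq> space M" using sets.sets_into_space[OF B] space_F[OF s(1)] by simp
  have B'F: "B' \<in> sets (F s)"
  proof -
    have "B - {\<omega> \<in> space M. n \<le> N s \<omega>} \<in> sets (F s)" using B level_F[OF s(1)] by auto
    also have "B - {\<omega> \<in> space M. n \<le> N s \<omega>} = B'" using Bsp by (auto simp: B'_def)
    finally show ?thesis .
  qed
  have B'M: "B' \<in> sets M" using sets_F[OF s(1) B'F] .
  have Rb: "s \<le> R \<omega>" "R \<omega> \<le> u" if "\<omega> \<in> space M" for \<omega>
    using s first_passage_bounds(2)[OF NP.paths[OF that] u, of "real n"] n by (auto simp: R_def not_less)
  have RN: "N (R \<omega>) \<omega> \<le> n" if w: "\<omega> \<in> space M" and lt: "N s \<omega> < n" for \<omega>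
  proof (cases "N u \<omega> < n")
    case False
    then have "\<not> first_passage (\<lambda>t. real (N t \<omega>)) (real n) \<le> s"
      using first_passage_le_iff[OF NP.paths[OF w] u _ s(1), of "real n"] lt by simp
    then have "R \<omega> = first_passage (\<lambda>t. real (N t \<omega>)) (real n)" using False by (simp add: R_def)
    then show ?thesis
      using simple_path_first_passage[OF counting[OF w] simple_paths[OF w] u _ n] False by simp
  qed (simp add: R_def)
  \<comment> \<open>Generic in \<open>X\<close>, to serve \<open>N\<close> and \<open>A\<close>
    alike: read in levels, the section of the set is the interval from \<open>X s\<close> (excluded)
    to the value of \<open>X\<close> at \<open>R\<close> (included).\<close>
  have inner: "(\<integral>\<^sup>+v. g (first_passage (\<lambda>s. X s \<omega>) v, \<omega>) * indicator {0<..X T \<omega>} v \<partial>lborel)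
      = ennreal ((X (R \<omega>) \<omega> - X s \<omega>) * indicator B' \<omega>)"
    if w: "\<omega> \<in> space M" and X: "inc_path (\<lambda>t. X t \<omega>)" for \<omega> and X :: "real \<Rightarrow> 'a \<Rightarrow> real"
  proof -
    have Xm: "X s \<omega> \<le> X (R \<omega>) \<omega>" "0 \<le> X s \<omega>" "X (R \<omega>) \<omega> \<le> X T \<omega>"
      using inc_path_mono[OF X] inc_path_nonneg[OF X] Rb[OF w] s by auto
    have "g (first_passage (\<lambda>s. X s \<omega>) v, \<omega>) * indicator {0<..X T \<omega>} v
        = indicator (if \<omega> \<in> B' then {X s \<omega><..X (R \<omega>) \<omega>} else {}) v" for v
    proof (cases "0 < v \<and> v \<le> X T \<omega>")
      case True
      define r where "r = first_passage (\<lambda>s. X s \<omega>) v"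
      have r: "0 < r" "r \<le> T" using first_passage_bounds[OF X T] True by (auto simp: r_def)
      have rle: "r \<le> t \<longleftrightarrow> v \<le> X t \<omega>" if "0 \<le> t" for t
        unfolding r_def using first_passage_le_iff[OF X T _ that] True by simp
      have "(r, \<omega>) \<in> below n T \<inter> {s<..u} \<times> B \<longleftrightarrow> \<omega> \<in> B' \<and> s < r \<and> r \<le> R \<omega>"
      proof (cases "\<omega> \<in> B \<and> s < r \<and> r \<le> u")
        case c: True
        \<comment> \<open>The condition forbids reaching n strictly before r, so the passage time
          itself still belongs to the set and the jump of \<open>N\<close> to n is counted.\<close>
        have "(\<exists>q\<in>\<rat>. 0 \<le> q \<and> q < r \<and> n \<le> N q \<omega>) \<longleftrightarrow> \<not> (N s \<omega> < n \<and> r \<le> R \<omega>)"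
        proof (cases "N s \<omega> < n")
          case False
          obtain q where q: "q \<in> \<rat>" "s < q" "q < r" using Rats_dense_in_real c by blast
          have "n \<le> N q \<omega>" using False N_mono[OF w s(1), of q] q by simp
          then have "\<exists>q\<in>\<rat>. 0 \<le> q \<and> q < r \<and> n \<le> N q \<omega>" using q s by (intro bexI[of _ q]) auto
          then show ?thesis using False by simp
        next
          case lt: True
          show ?thesis
          proof (cases "N u \<omega> < n")
            case True
            have "\<not> n \<le> N q \<omega>" if "0 \<le> q" "q < r" for q
              using N_mono[OF w that(1), of u] that c True by auto
            then show ?thesis using True c lt by (auto simp: R_def)
          next
            case False
            then have nu: "real n \<le> real (N u \<omega>)" by simp
            have "\<not> first_passage (\<lambda>t. real (N t \<omega>)) (real n) \<le> s"
              using first_passage_le_iff[OF NP.paths[OF w] u nu s(1)] lt by simp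
            then have "R \<omega> = first_passage (\<lambda>t. real (N t \<omega>)) (real n)" using False by (simp add: R_def)
            then show ?thesis
              using first_passage_less_iff[OF NP.paths[OF w] u nu, of r] n lt by auto
          qed
        qed
        then show ?thesis using c r w Bsp by (auto simp: below_def B'_def)
      next
        case False
        then show ?thesis using Rb[OF w] by (auto simp: B'_def)
      qed
      moreover have "s < r \<and> r \<le> R \<omega> \<longleftrightarrow> X s \<omega> < v \<and> v \<le> X (R \<omega>) \<omega>"
        using rle[OF s(1)] rle[of "R \<omega>"] Rb[OF w] s by auto
      ultimately show ?thesis
        using True by (auto simp: g_def r_def[symmetric] indicator_def)
    next
      case False
      then show ?thesis using Xm by (auto simp: indicator_def)
    qed
    then show ?thesis using Xm by simp
  qed
  have em: "emeasure (stieltjes_X) (below n T \<inter> {s<..u} \<times> B) = (\<integral>\<^sup>+z. g z \<partial>stieltjes_X)"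
    if "sets stieltjes_X = sets (predictable_sigma M F)" for stieltjes_X
    unfolding g_def using E that by simp
  have eN: "emeasure (NP.stieltjes T) (below n T \<inter> {s<..u} \<times> B)
      = (\<integral>\<^sup>+\<omega>. ennreal ((real (N (R \<omega>) \<omega>) - real (N s \<omega>)) * indicator B' \<omega>) \<partial>M)"
    unfolding em[OF NP.sets_stieltjes] NP.nn_integral_stieltjes[OF T g]
    by (intro nn_integral_cong inner[of _ "\<lambda>t \<omega>. real (N t \<omega>)"] NP.paths)
  have eA: "emeasure (AP.stieltjes T) (below n T \<inter> {s<..u} \<times> B)
      = (\<integral>\<^sup>+\<omega>. ennreal ((A (R \<omega>) \<omega> - A s \<omega>) * indicator B' \<omega>) \<partial>M)"
    unfolding em[OF AP.sets_stieltjes] AP.nn_integral_stieltjes[OF T g]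
    by (intro nn_integral_cong inner AP.paths)
  define hN where "hN \<omega> = (real (N (R \<omega>) \<omega>) - real (N s \<omega>)) * indicator B' \<omega>" for \<omega>
  define hA where "hA \<omega> = (A (R \<omega>) \<omega> - A s \<omega>) * indicator B' \<omega>" for \<omega>
  have hN0: "0 \<le> hN \<omega>" "hN \<omega> \<le> n" if w: "\<omega> \<in> space M" for \<omega>
    using N_mono[OF w s(1) Rb(1)[OF w]] RN[OF w] by (auto simp: hN_def indicator_def B'_def)
  have hA0: "0 \<le> hA \<omega>" if w: "\<omega> \<in> space M" for \<omega>
    using inc_path_mono[OF AP.paths[OF w] s(1) Rb(1)[OF w]] by (auto simp: hA_def indicator_def)
  \<comment> \<open>\<open>N\<close> at the random time \<open>R\<close> inherits its measurability
    from the inner integral of the Stieltjes representation.\<close>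
  have mN: "hN \<in> borel_measurable M"
  proof -
    have "(\<lambda>\<omega>. enn2real (\<integral>\<^sup>+v. g (first_passage (\<lambda>s. real (N s \<omega>)) v, \<omega>) * indicator {0<..real (N T \<omega>)} v \<partial>lborel))
      \<in> borel_measurable M"
      using NP.nn_integral_stieltjes(2)[OF T g] by measurable
    also have "?this \<longleftrightarrow> hN \<in> borel_measurable M"
      using inner[of _ "\<lambda>t \<omega>. real (N t \<omega>)", OF _ NP.paths] hN0
      by (intro measurable_cong) (auto simp: hN_def)
    finally show ?thesis .
  qed
  have iN: "integrable M hN"
    by (rule integrable_const_bound[of _ "real n"]) (use hN0 mN in auto)
  have Req: "R \<omega> = (if N u \<omega> < n then u else max s (first_passage (\<lambda>t. real (N t \<omega>)) (real n)))" for \<omega>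
    by (simp add: R_def)
  obtain G \<rho> where G: "\<And>m::nat. finite (G m)" "\<And>m. G m \<subseteq> {s..u}"
    "\<And>m \<omega>. \<omega> \<in> space M \<Longrightarrow> \<rho> m \<omega> \<in> G m"
    "\<And>m r. r \<in> G m \<Longrightarrow> {\<omega> \<in> space M. \<rho> m \<omega> = r} \<in> sets (F r)"
    "\<And>m \<omega>. \<omega> \<in> space M \<Longrightarrow> R \<omega> \<le> \<rho> m \<omega>"
    "\<And>\<omega>. \<omega> \<in> space M \<Longrightarrow> (\<lambda>m. \<rho> m \<omega>) \<longlonglongrightarrow> R \<omega>"
    by (rule stopping_grid[OF counting filtration N_adapted[rule_format] s(1,2) Req]) (assumption | (rule that; assumption))+
  have rc: "((\<lambda>s. real (N s \<omega>) - A s \<omega>) \<longlongrightarrow> real (N r \<omega>) - A r \<omega>) (at_right r)"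
    if "\<omega> \<in> space M" "0 \<le> r" for \<omega> r
    using NP.paths[OF that(1)] AP.paths[OF that(1)] that(2)
    by (intro tendsto_diff) (auto simp: inc_path_def)
  have R0: "\<omega> \<in> space M \<Longrightarrow> 0 \<le> R \<omega>" for \<omega> using Rb s by force
  have os: "integrable M (\<lambda>\<omega>. real (N (R \<omega>) \<omega>) - A (R \<omega>) \<omega>)"
    "(\<integral>\<omega>. (real (N (R \<omega>) \<omega>) - A (R \<omega>) \<omega>) * indicator B' \<omega> \<partial>M)
     = (\<integral>\<omega>. (real (N s \<omega>) - A s \<omega>) * indicator B' \<omega> \<partial>M)"
    by (rule optional_stopping[OF prob filtration martingale, where G = G and \<rho> = \<rho> and R = R and u = u
          and s = s and B = B']; use rc G R0 B'F s in simp)+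
  define d where "d \<omega> = (real (N (R \<omega>) \<omega>) - A (R \<omega>) \<omega>) * indicator B' \<omega> - (real (N s \<omega>) - A s \<omega>) * indicator B' \<omega>" for \<omega>
  have ii: "integrable M (\<lambda>\<omega>. f \<omega> * indicator B' \<omega>)" if "integrable M f" for f :: "'a \<Rightarrow> real"
    using integrable_mult_indicator[OF B'M that] by (simp add: mult.commute)
  have iMs: "integrable M (\<lambda>\<omega>. real (N s \<omega>) - A s \<omega>)" using martingale s by (simp add: is_martingale_def)
  have d: "integrable M d" "(\<integral>\<omega>. d \<omega> \<partial>M) = 0"
  proof -
    show "integrable M d"
      unfolding d_def by (intro Bochner_Integration.integrable_diff ii os(1) iMs)
    show "(\<integral>\<omega>. d \<omega> \<partial>M) = 0"
      unfolding d_def by (subst Bochner_Integration.integral_diff[OF ii[OF os(1)] ii[OF iMs]])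
        (use os(2) in auto)
  qed
  \<comment> \<open>Integrability of the stopped increment of \<open>A\<close> is a consequence: it
    is the bounded increment of \<open>N\<close> minus an integrable increment of the
    martingale.\<close>
  have hA: "hA = (\<lambda>\<omega>. hN \<omega> - d \<omega>)" by (auto simp: hA_def hN_def d_def algebra_simps)
  have iA: "integrable M hA" "(\<integral>\<omega>. hA \<omega> \<partial>M) = (\<integral>\<omega>. hN \<omega> \<partial>M)"
    unfolding hA using iN d by auto
  have "emeasure (NP.stieltjes T) (below n T \<inter> {s<..u} \<times> B) = ennreal (\<integral>\<omega>. hN \<omega> \<partial>M)"
    unfolding eN hN_def[symmetric] by (rule nn_integral_eq_integral[OF iN]) (use hN0 in auto)
  moreover have "emeasure (AP.stieltjes T) (below n T \<inter> {s<..u} \<times> B) = ennreal (\<integral>\<omega>. hA \<omega> \<partial>M)"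
    unfolding eA hA_def[symmetric] by (rule nn_integral_eq_integral[OF iA(1)]) (use hA0 in auto)
  ultimately show "emeasure (NP.stieltjes T) (below n T \<inter> {s<..u} \<times> B) = emeasure (AP.stieltjes T) (below n T \<inter> {s<..u} \<times> B)"
    "emeasure (NP.stieltjes T) (below n T \<inter> {s<..u} \<times> B) < \<infinity>"
    using iA(2) by auto
qed


text \<open>Uniqueness of measures on an intersection-stable generator. The rectangle lemma provides
  the agreement and, thanks to the restriction to \<open>below n T\<close>, the finiteness on an
  exhausting sequence.\<close>

lemma restricted_stieltjes_eq:
  assumes n: "0 < n" and T: "0 \<le> T"
  shows "density (NP.stieltjes T) (indicator (below n T)) = density (AP.stieltjes T) (indicator (below n T))"
proof -
  let ?E = "{{0::real} \<times> B |B. B \<in> sets (F 0)} \<union> {{s<..t} \<times> B |s t B. 0 \<le> s \<and> s < t \<and> B \<in> sets (F s)}"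
  have mono: "sets (F s) \<subseteq> sets (F t)" if "0 \<le> s" "s \<le> t" for s t
    using filtration that unfolding is_filtration_def by blast
  \<comment> \<open>Rectangles may extend past T, while the rectangle lemma asks for
    \<open>u \<le> T\<close>; \<open>below n T\<close> contains no later times.\<close>
  have clip: "below n T \<inter> {s<..t} \<times> B = below n T \<inter> {s<..min t T} \<times> B" for s t :: real and B
    by (auto simp: below_def)
  have zero: "below n T \<inter> {0} \<times> B = {}" for B by (auto simp: below_def)
  have rect: "emeasure (NP.stieltjes T) (below n T \<inter> {s<..t} \<times> B) = emeasure (AP.stieltjes T) (below n T \<inter> {s<..t} \<times> B)"
    "emeasure (NP.stieltjes T) (below n T \<inter> {s<..t} \<times> B) < \<infinity>"
    if "0 \<le> s" "B \<in> sets (F s)" for s t B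
  proof (atomize (full), cases "s < min t T")
    case True
    then show "emeasure (NP.stieltjes T) (below n T \<inter> {s<..t} \<times> B) = emeasure (AP.stieltjes T) (below n T \<inter> {s<..t} \<times> B)
      \<and> emeasure (NP.stieltjes T) (below n T \<inter> {s<..t} \<times> B) < \<infinity>"
      using stieltjes_rectangle_eq[OF n that(1) True min.cobounded2 that(2)] unfolding clip[of s t B] by blast
  next
    case False
    then have "below n T \<inter> {s<..t} \<times> B = {}" unfolding clip[of s t B] by auto
    then show "emeasure (NP.stieltjes T) (below n T \<inter> {s<..t} \<times> B) = emeasure (AP.stieltjes T) (below n T \<inter> {s<..t} \<times> B)
      \<and> emeasure (NP.stieltjes T) (below n T \<inter> {s<..t} \<times> B) < \<infinity>" by simp
  qed
  have emN: "emeasure (density (NP.stieltjes T) (indicator (below n T))) S = emeasure (NP.stieltjes T) (below n T \<inter> S)"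
    and emA: "emeasure (density (AP.stieltjes T) (indicator (below n T))) S = emeasure (AP.stieltjes T) (below n T \<inter> S)"
    if "S \<in> sets (predictable_sigma M F)" for S
    using sets_below that by (auto intro!: emeasure_restricted)
  have EP: "S \<in> sets (predictable_sigma M F)" if "S \<in> ?E" for S
    unfolding sets_predictable[OF filtration] using that by (rule sigma_sets.Basic)
  have top: "space M \<in> sets (F 0)" using space_F[of 0] sets.top[of "F 0"] by simp
  show ?thesis
  \<comment> \<open>The exhausting sequence has a separate member for time 0, which the half-open
    rectangles miss.\<close>
  proof (rule measure_eqI_generator_eq[where E = ?E and \<Omega> = "{0..} \<times> space M"
        and A = "case_nat ({0} \<times> space M) (\<lambda>k. {0<..real (Suc k)} \<times> space M)"])
    show "Int_stable ?E"
    proof (rule Int_stableI)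
      fix a b assume a: "a \<in> ?E" and b: "b \<in> ?E"
      have empty: "{} \<in> ?E" by (intro UnI1 CollectI exI[of _ "{}"]) auto
      show "a \<inter> b \<in> ?E"
      proof (cases "\<exists>B\<in>sets (F 0). a = {0} \<times> B")
        case True
        then obtain B where B: "B \<in> sets (F 0)" "a = {0} \<times> B" by auto
        from b show ?thesis
        proof
          assume "b \<in> {{0::real} \<times> B |B. B \<in> sets (F 0)}"
          then obtain C where C: "C \<in> sets (F 0)" "b = {0} \<times> C" by auto
          then have "a \<inter> b = {0} \<times> (B \<inter> C)" "B \<inter> C \<in> sets (F 0)" using B by auto
          then show ?thesis by blast
        next
          assume "b \<in> {{s<..t} \<times> B |s t B. 0 \<le> s \<and> s < t \<and> B \<in> sets (F s)}"
          then have "a \<inter> b = {}" using B by auto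
          then show ?thesis using empty by simp
        qed
      next
        case False
        then obtain s t B where B: "0 \<le> s" "s < t" "B \<in> sets (F s)" "a = {s<..t} \<times> B" using a by auto
        from b show ?thesis
        proof
          assume "b \<in> {{0::real} \<times> B |B. B \<in> sets (F 0)}"
          then have "a \<inter> b = {}" using B by auto
          then show ?thesis using empty by simp
        next
          assume "b \<in> {{s<..t} \<times> B |s t B. 0 \<le> s \<and> s < t \<and> B \<in> sets (F s)}"
          then obtain s' t' C where C: "0 \<le> s'" "s' < t'" "C \<in> sets (F s')" "b = {s'<..t'} \<times> C" by auto
          have "a \<inter> b = {max s s'<..min t t'} \<times> (B \<inter> C)" using B C by auto
          moreover have "B \<inter> C \<in> sets (F (max s s'))"
            using mono[OF B(1), of "max s s'"] mono[OF C(1), of "max s s'"] B C by auto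
          moreover have "0 \<le> max s s'" using B by simp
          ultimately show ?thesis
          proof (cases "max s s' < min t t'")
            case True
            then show ?thesis
              using \<open>a \<inter> b = _\<close> \<open>B \<inter> C \<in> _\<close> \<open>0 \<le> max s s'\<close>
              by (intro UnI2 CollectI exI conjI) assumption+
          next
            case False
            then have "{max s s'<..min t t'} = {}" by simp
            then have "a \<inter> b = {}" unfolding \<open>a \<inter> b = _\<close> by blast
            then show ?thesis using empty by simp
          qed
        qed
      qed
    qed
    show "?E \<subseteq> Pow ({0..} \<times> space M)" by (rule predictable_generator_Pow[OF filtration])
    show "emeasure (density (NP.stieltjes T) (indicator (below n T))) S =
       emeasure (density (AP.stieltjes T) (indicator (below n T))) S" if S: "S \<in> ?E" for S
    proof -
      have "emeasure (NP.stieltjes T) (below n T \<inter> S) = emeasure (AP.stieltjes T) (below n T \<inter> S)"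
        using S zero rect(1) by auto
      then show ?thesis using emN emA EP[OF S] by simp
    qed
    show "sets (density (NP.stieltjes T) (indicator (below n T))) = sigma_sets ({0..} \<times> space M) ?E"
      "sets (density (AP.stieltjes T) (indicator (below n T))) = sigma_sets ({0..} \<times> space M) ?E"
      by (simp_all add: sets_predictable[OF filtration])
    show "range (case_nat ({0} \<times> space M) (\<lambda>k. {0<..real (Suc k)} \<times> space M)) \<subseteq> ?E"
    proof (rule image_subsetI)
      have zero_in: "{0} \<times> space M \<in> ?E"
        by (intro UnI1 CollectI exI[of _ "space M"] conjI refl top)
      have ray_in: "{0<..real (Suc k)} \<times> space M \<in> ?E" for k
        by (intro UnI2 CollectI exI[of _ 0] exI[of _ "real (Suc k)"] exI[of _ "space M"] conjI refl top) simp_all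
      fix i show "case_nat ({0} \<times> space M) (\<lambda>k. {0<..real (Suc k)} \<times> space M) i \<in> ?E"
        using zero_in ray_in by (cases i) (simp_all only: nat.case)
    qed
    show "(\<Union>i. case_nat ({0} \<times> space M) (\<lambda>k. {0<..real (Suc k)} \<times> space M) i) = {0..} \<times> space M"
    proof (intro equalityI subsetI)
      fix z :: "real \<times> 'a" assume "z \<in> {0..} \<times> space M"
      then obtain r w where z: "z = (r, w)" "0 \<le> r" "w \<in> space M" by auto
      obtain k where k: "r \<le> real k" using real_arch_simple by blast
      have "z \<in> case_nat ({0} \<times> space M) (\<lambda>k. {0<..real (Suc k)} \<times> space M) (if r = 0 then 0 else Suc k)"
        using z k by auto
      then show "z \<in> (\<Union>i. case_nat ({0} \<times> space M) (\<lambda>k. {0<..real (Suc k)} \<times> space M) i)"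
        by blast
    next
      fix z :: "real \<times> 'a"
      assume "z \<in> (\<Union>i. case_nat ({0} \<times> space M) (\<lambda>k. {0<..real (Suc k)} \<times> space M) i)"
      then obtain i where "z \<in> case_nat ({0} \<times> space M) (\<lambda>k. {0<..real (Suc k)} \<times> space M) i" by blast
      then show "z \<in> {0..} \<times> space M" by (cases i) auto
    qed
    fix i
    have "case_nat ({0} \<times> space M) (\<lambda>k. {0<..real (Suc k)} \<times> space M) i \<in> sets (predictable_sigma M F)"
      using EP top by (cases i) (auto intro!: rectangle_predictable simp del: of_nat_Suc)
    then show "emeasure (density (NP.stieltjes T) (indicator (below n T)))
      (case_nat ({0} \<times> space M) (\<lambda>k. {0<..real (Suc k)} \<times> space M) i) \<noteq> \<infinity>"
      using rect(2)[OF _ top] zero by (cases i) (auto simp: emN less_top)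
  qed
qed

lemma nn_integral_stieltjes_eq:
  assumes n: "0 < n" and T: "0 \<le> T" and D: "D \<in> sets (predictable_sigma M F)" "D \<subseteq> below n T"
    and g: "g \<in> borel_measurable (predictable_sigma M F)"
  shows "(\<integral>\<^sup>+z. g z * indicator D z \<partial>NP.stieltjes T) = (\<integral>\<^sup>+z. g z * indicator D z \<partial>AP.stieltjes T)"
proof -
  have ind: "indicator (below n T) z * (g z * indicator D z) = g z * indicator D z" for z
    using D(2) by (auto simp: indicator_def)
  have "(\<integral>\<^sup>+z. g z * indicator D z \<partial>NP.stieltjes T)
    = (\<integral>\<^sup>+z. g z * indicator D z \<partial>density (NP.stieltjes T) (indicator (below n T)))"
    using g D(1) sets_below by (subst nn_integral_density) (auto simp: ind)
  also have "\<dots> = (\<integral>\<^sup>+z. g z * indicator D z \<partial>AP.stieltjes T)"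
    unfolding restricted_stieltjes_eq[OF n T]
    using g D(1) sets_below by (subst nn_integral_density) (auto simp: ind)
  finally show ?thesis .
qed

end

subsection \<open>The law of large numbers for the counting process\<close>

text \<open>The two sides of \<open>(a - b)\<^sup>2\<close> for the total masses \<open>a\<close>, \<open>b\<close> of two measures on the line are
  compared through Fubini on the regions \<open>{s < r}\<close>, \<open>{s = r}\<close> and \<open>{s > r}\<close>; this replaces the
  integration by parts formula for \<open>(N - A)\<^sup>2\<close>.\<close>

lemma Fubini_less:
  fixes m1 m2 :: "real measure"
  assumes "finite_measure m1" "finite_measure m2" and [measurable_cong]: "sets m1 = sets borel" "sets m2 = sets borel"
  shows "(\<integral>\<^sup>+r. emeasure m1 {..<r} \<partial>m2) = (\<integral>\<^sup>+r. emeasure m2 {r<..} \<partial>m1)"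
proof -
  interpret m1: finite_measure m1 by fact
  interpret m2: finite_measure m2 by fact
  interpret pair_sigma_finite m1 m2 ..
  have "(\<integral>\<^sup>+r. emeasure m1 {..<r} \<partial>m2) = (\<integral>\<^sup>+r. (\<integral>\<^sup>+s. indicator {z. fst z < snd z} (s, r) \<partial>m1) \<partial>m2)"
    by (intro nn_integral_cong) (auto simp: nn_integral_indicator[symmetric] indicator_def intro!: nn_integral_cong simp del: nn_integral_indicator)
  also have "\<dots> = (\<integral>\<^sup>+s. (\<integral>\<^sup>+r. indicator {z. fst z < snd z} (s, r) \<partial>m2) \<partial>m1)"
    by (rule Fubini) measurable
  also have "\<dots> = (\<integral>\<^sup>+r. emeasure m2 {r<..} \<partial>m1)"
    by (intro nn_integral_cong) (auto simp: nn_integral_indicator[symmetric] indicator_def intro!: nn_integral_cong simp del: nn_integral_indicator)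
  finally show ?thesis .
qed

lemma measurable_emeasure_rays [measurable]:
  fixes m :: "real measure"
  assumes "finite_measure m" "sets m = sets borel"
  shows "(\<lambda>r. emeasure m {..r}) \<in> borel_measurable borel" "(\<lambda>r. emeasure m {..<r}) \<in> borel_measurable borel"
    "(\<lambda>r. emeasure m {r<..}) \<in> borel_measurable borel" "(\<lambda>r. emeasure m {r}) \<in> borel_measurable borel"
proof -
  interpret finite_measure m by fact
  note [measurable_cong] = assms(2)
  have eq: "emeasure m (S r) = (\<integral>\<^sup>+s. indicator {z. snd z \<in> S (fst z)} (r, s) \<partial>m)" if "S r \<in> sets borel" for S :: "real \<Rightarrow> real set" and r
    using that assms(2) by (auto simp: nn_integral_indicator[symmetric] indicator_def intro!: nn_integral_cong simp del: nn_integral_indicator)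
  show "(\<lambda>r. emeasure m {..r}) \<in> borel_measurable borel"
    by (subst eq, simp, rule borel_measurable_nn_integral) (measurable, simp)
  show "(\<lambda>r. emeasure m {..<r}) \<in> borel_measurable borel"
    by (subst eq, simp, rule borel_measurable_nn_integral) (measurable, simp)
  show "(\<lambda>r. emeasure m {r<..}) \<in> borel_measurable borel"
    by (subst eq, simp, rule borel_measurable_nn_integral) (measurable, simp)
  show "(\<lambda>r. emeasure m {r}) \<in> borel_measurable borel"
    by (subst eq, simp, rule borel_measurable_nn_integral) (measurable, simp)
qed

text \<open>The diagonal is placed so that the integrands are the mass of \<open>m1\<close> strictly
  before r and the mass of \<open>m2\<close> up to and including r. For the path measures these are
  N(r-) and A(r), both predictable. The atoms of \<open>m1\<close> remain in \<open>a * a\<close>;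
  in \<open>b * b\<close> the diagonal is counted twice, which costs an inequality in the wanted
  direction.\<close>

lemma mass_products:
  fixes m1 m2 :: "real measure"
  assumes fin: "finite_measure m1" "finite_measure m2" and S: "sets m1 = sets borel" "sets m2 = sets borel"
  defines "a \<equiv> emeasure m1 UNIV" and "b \<equiv> emeasure m2 UNIV"
  shows "a * b = (\<integral>\<^sup>+r. emeasure m2 {..r} \<partial>m1) + (\<integral>\<^sup>+r. emeasure m1 {..<r} \<partial>m2)"
    and "a * a = 2 * (\<integral>\<^sup>+r. emeasure m1 {..<r} \<partial>m1) + (\<integral>\<^sup>+r. emeasure m1 {r} \<partial>m1)"
    and "b * b \<le> 2 * (\<integral>\<^sup>+r. emeasure m2 {..r} \<partial>m2)"
proof -
  note [measurable_cong] = S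
  note mr = measurable_emeasure_rays
  note [measurable] = mr[OF fin(1) S(1)] mr[OF fin(2) S(2)]
  have sp: "space m1 = UNIV" "space m2 = UNIV" using S[THEN sets_eq_imp_space_eq] by simp_all
  have c: "a * c = (\<integral>\<^sup>+r. c \<partial>m1)" "b * c = (\<integral>\<^sup>+r. c \<partial>m2)" for c
    by (simp_all add: a_def b_def sp mult.commute)
  have split: "emeasure m UNIV = emeasure m {..r} + emeasure m {r<..}"
    "emeasure m {..r} = emeasure m {..<r} + emeasure m {r}"
    if "sets m = sets borel" for m and r :: real
  proof -
    have "{..r} \<union> {r<..} = UNIV" "{..<r} \<union> {r} = {..r}" "{..r} \<inter> {r<..} = {}" by auto
    then show "emeasure m UNIV = emeasure m {..r} + emeasure m {r<..}"
      "emeasure m {..r} = emeasure m {..<r} + emeasure m {r}"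
      using plus_emeasure[of "{..r}" m "{r<..}"] plus_emeasure[of "{..<r}" m "{r}"] that by auto
  qed
  show "a * b = (\<integral>\<^sup>+r. emeasure m2 {..r} \<partial>m1) + (\<integral>\<^sup>+r. emeasure m1 {..<r} \<partial>m2)"
  proof -
    have "a * b = (\<integral>\<^sup>+r. emeasure m2 {..r} + emeasure m2 {r<..} \<partial>m1)"
      unfolding c(1) unfolding b_def by (intro nn_integral_cong split(1) S)
    then show ?thesis by (simp add: nn_integral_add Fubini_less[OF fin S])
  qed
  show "a * a = 2 * (\<integral>\<^sup>+r. emeasure m1 {..<r} \<partial>m1) + (\<integral>\<^sup>+r. emeasure m1 {r} \<partial>m1)"
  proof -
    have "a * a = (\<integral>\<^sup>+r. emeasure m1 {..<r} + emeasure m1 {r} + emeasure m1 {r<..} \<partial>m1)"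
      unfolding c(1) unfolding a_def by (intro nn_integral_cong) (metis split S(1))
    also have "\<dots> = (\<integral>\<^sup>+r. emeasure m1 {..<r} \<partial>m1) + (\<integral>\<^sup>+r. emeasure m1 {r} \<partial>m1) + (\<integral>\<^sup>+r. emeasure m1 {r<..} \<partial>m1)"
      by (simp add: nn_integral_add)
    also have "(\<integral>\<^sup>+r. emeasure m1 {r<..} \<partial>m1) = (\<integral>\<^sup>+r. emeasure m1 {..<r} \<partial>m1)"
      by (rule Fubini_less[OF fin(1) fin(1) S(1) S(1), symmetric])
    finally show ?thesis by (simp add: mult_2 ac_simps)
  qed
  show "b * b \<le> 2 * (\<integral>\<^sup>+r. emeasure m2 {..r} \<partial>m2)"
  proof -
    have "b * b = (\<integral>\<^sup>+r. emeasure m2 {..r} \<partial>m2) + (\<integral>\<^sup>+r. emeasure m2 {r<..} \<partial>m2)"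
    proof -
      have "b * b = (\<integral>\<^sup>+r. emeasure m2 {..r} + emeasure m2 {r<..} \<partial>m2)"
        unfolding c(2) unfolding b_def by (intro nn_integral_cong split(1) S)
      then show ?thesis by (simp add: nn_integral_add)
    qed
    also have "(\<integral>\<^sup>+r. emeasure m2 {r<..} \<partial>m2) = (\<integral>\<^sup>+r. emeasure m2 {..<r} \<partial>m2)"
      by (rule Fubini_less[OF fin(2) fin(2) S(2) S(2), symmetric])
    also have "\<dots> \<le> (\<integral>\<^sup>+r. emeasure m2 {..r} \<partial>m2)"
      by (intro nn_integral_mono emeasure_mono) (auto simp: S)
    finally show ?thesis by (simp add: mult_2 add_left_mono)
  qed
qed

section \<open>Stieltjes measures of single paths\<close>

context increasing_process
begin

text \<open>The Stieltjes measure of one path, restricted to the section of \<open>D\<close>. As a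
  finite measure on the line it is open to \<open>mass_products\<close>, path by path.\<close>

definition path_measure :: "real \<Rightarrow> (real \<times> 'a) set \<Rightarrow> 'a \<Rightarrow> real measure" where
  "path_measure T D \<omega> = distr (restrict_space lborel {v. 0 < v \<and> v \<le> X T \<omega> \<and> (first_passage (\<lambda>s. X s \<omega>) v, \<omega>) \<in> D})
     borel (first_passage (\<lambda>s. X s \<omega>))"

lemma sets_path_measure [simp]: "sets (path_measure T D \<omega>) = sets borel"
  by (simp add: path_measure_def)

context
  fixes T :: real and D :: "(real \<times> 'a) set" and \<omega> :: 'a assumes T: "0 \<le> T" and D: "D \<in> sets (predictable_sigma M F)" and w: "\<omega> \<in> space M"
begin

lemma sets_path_levels:
  "{v. 0 < v \<and> v \<le> X T \<omega> \<and> (first_passage (\<lambda>s. X s \<omega>) v, \<omega>) \<in> D} \<in> sets borel" (is "?I \<in> _")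
proof -
  have "passage -` D \<inter> space (restrict_space (M \<Otimes>\<^sub>M lborel) (levels T)) \<in> sets (restrict_space (M \<Otimes>\<^sub>M lborel) (levels T))"
    by (rule measurable_sets[OF measurable_passage[OF T] D])
  then have "passage -` D \<inter> space (restrict_space (M \<Otimes>\<^sub>M lborel) (levels T)) \<in> sets (M \<Otimes>\<^sub>M lborel)"
    using sets_levels[OF T] by (subst (asm) sets_restrict_space_iff) auto
  then have "Pair \<omega> -` (passage -` D \<inter> space (restrict_space (M \<Otimes>\<^sub>M lborel) (levels T))) \<in> sets lborel"
    by (rule sets_Pair1)
  also have "Pair \<omega> -` (passage -` D \<inter> space (restrict_space (M \<Otimes>\<^sub>M lborel) (levels T))) = ?I"
    using w by (auto simp: space_restrict_space space_pair_measure levels_def passage_def)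
  finally show ?thesis by simp
qed

lemma measurable_first_passage:
  "first_passage (\<lambda>s. X s \<omega>) \<in> borel_measurable
    (restrict_space lborel {v. 0 < v \<and> v \<le> X T \<omega> \<and> (first_passage (\<lambda>s. X s \<omega>) v, \<omega>) \<in> D})"
    (is "_ \<in> borel_measurable (restrict_space _ ?I)")
proof (rule borel_measurableI_le)
  fix r
  have "{v \<in> space (restrict_space lborel ?I). first_passage (\<lambda>s. X s \<omega>) v \<le> r}
    = (if 0 \<le> r then {..X r \<omega>} else {}) \<inter> ?I"
    using first_passage_le_iff[OF paths[OF w] T] first_passage_bounds(1)[OF paths[OF w] T]
    by (force simp: space_restrict_space)
  then show "{v \<in> space (restrict_space lborel ?I). first_passage (\<lambda>s. X s \<omega>) v \<le> r}
    \<in> sets (restrict_space lborel ?I)"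
    using sets_path_levels by (subst sets_restrict_space_iff) auto
qed

lemma emeasure_path_measure:
  assumes "S \<in> sets borel"
  shows "emeasure (path_measure T D \<omega>) S = emeasure lborel
    {v. 0 < v \<and> v \<le> X T \<omega> \<and> (first_passage (\<lambda>s. X s \<omega>) v, \<omega>) \<in> D \<and> first_passage (\<lambda>s. X s \<omega>) v \<in> S}"
proof -
  let ?I = "{v. 0 < v \<and> v \<le> X T \<omega> \<and> (first_passage (\<lambda>s. X s \<omega>) v, \<omega>) \<in> D}"
  have "emeasure (path_measure T D \<omega>) S
    = emeasure (restrict_space lborel ?I) (first_passage (\<lambda>s. X s \<omega>) -` S \<inter> space (restrict_space lborel ?I))"
    unfolding path_measure_def by (rule emeasure_distr[OF measurable_first_passage assms])
  also have "\<dots> = emeasure lborel (first_passage (\<lambda>s. X s \<omega>) -` S \<inter> space (restrict_space lborel ?I))"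
    using sets_path_levels by (intro emeasure_restrict_space) (auto simp: space_restrict_space)
  also have "first_passage (\<lambda>s. X s \<omega>) -` S \<inter> space (restrict_space lborel ?I) =
    {v. 0 < v \<and> v \<le> X T \<omega> \<and> (first_passage (\<lambda>s. X s \<omega>) v, \<omega>) \<in> D \<and> first_passage (\<lambda>s. X s \<omega>) v \<in> S}"
    by (auto simp: space_restrict_space)
  finally show ?thesis .
qed

lemma finite_path_measure: "finite_measure (path_measure T D \<omega>)"
proof (rule finite_measureI)
  have UNIV_borel: "UNIV \<in> sets (borel :: real measure)" by simp
  have "emeasure (path_measure T D \<omega>) UNIV \<le> emeasure lborel {0..X T \<omega>}"
    unfolding emeasure_path_measure[OF UNIV_borel] by (rule emeasure_mono) auto
  also have "\<dots> < \<infinity>" by (simp add: emeasure_lborel_Icc_eq)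
  finally show "emeasure (path_measure T D \<omega>) (space (path_measure T D \<omega>)) \<noteq> \<infinity>"
    by (simp add: path_measure_def)
qed

lemma nn_integral_path_measure:
  assumes h: "h \<in> borel_measurable borel"
  shows "(\<integral>\<^sup>+r. h r \<partial>path_measure T D \<omega>) = (\<integral>\<^sup>+v. h (first_passage (\<lambda>s. X s \<omega>) v)
    * indicator D (first_passage (\<lambda>s. X s \<omega>) v, \<omega>) * indicator {0<..X T \<omega>} v \<partial>lborel)"
proof -
  have "(\<integral>\<^sup>+r. h r \<partial>path_measure T D \<omega>) = (\<integral>\<^sup>+v. h (first_passage (\<lambda>s. X s \<omega>) v) * indicator
     {v. 0 < v \<and> v \<le> X T \<omega> \<and> (first_passage (\<lambda>s. X s \<omega>) v, \<omega>) \<in> D} v \<partial>lborel)"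
    unfolding path_measure_def using sets_path_levels h
    by (subst nn_integral_distr[OF measurable_first_passage], simp, subst nn_integral_restrict_space) auto
  also have "\<dots> = (\<integral>\<^sup>+v. h (first_passage (\<lambda>s. X s \<omega>) v)
    * indicator D (first_passage (\<lambda>s. X s \<omega>) v, \<omega>) * indicator {0<..X T \<omega>} v \<partial>lborel)"
    by (intro nn_integral_cong) (auto simp: indicator_def)
  finally show ?thesis .
qed

end

text \<open>\<open>g\<close> and \<open>h\<close> need to agree only at passage times inside
  \<open>D\<close>. So \<open>h\<close> can be a mass function of the path measures themselves,
  Borel for each path but with no joint measurability in evidence; measurability of the integral in
  \<open>\<omega>\<close> comes from the predictable \<open>g\<close>.\<close>

lemma nn_integral_stieltjes_path:
  assumes T: "0 \<le> T" and D: "D \<in> sets (predictable_sigma M F)" and g: "g \<in> borel_measurable (predictable_sigma M F)"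
    and h: "\<And>\<omega>. \<omega> \<in> space M \<Longrightarrow> h \<omega> \<in> borel_measurable borel"
    and gh: "\<And>\<omega> v. \<omega> \<in> space M \<Longrightarrow> 0 < v \<Longrightarrow> v \<le> X T \<omega> \<Longrightarrow> (first_passage (\<lambda>s. X s \<omega>) v, \<omega>) \<in> D \<Longrightarrow>
      g (first_passage (\<lambda>s. X s \<omega>) v, \<omega>) = h \<omega> (first_passage (\<lambda>s. X s \<omega>) v)"
  shows "(\<integral>\<^sup>+z. g z * indicator D z \<partial>stieltjes T) = (\<integral>\<^sup>+\<omega>. \<integral>\<^sup>+r. h \<omega> r \<partial>path_measure T D \<omega> \<partial>M)"
    and "(\<lambda>\<omega>. \<integral>\<^sup>+r. h \<omega> r \<partial>path_measure T D \<omega>) \<in> borel_measurable M"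
proof -
  have gD: "(\<lambda>z. g z * indicator D z) \<in> borel_measurable (predictable_sigma M F)" using g D by auto
  have eq: "(\<integral>\<^sup>+v. g (first_passage (\<lambda>s. X s \<omega>) v, \<omega>) * indicator D (first_passage (\<lambda>s. X s \<omega>) v, \<omega>)
     * indicator {0<..X T \<omega>} v \<partial>lborel) = (\<integral>\<^sup>+r. h \<omega> r \<partial>path_measure T D \<omega>)" if w: "\<omega> \<in> space M" for \<omega>
    unfolding nn_integral_path_measure[OF T D w h[OF w]]
    by (intro nn_integral_cong) (auto simp: indicator_def gh[OF w])
  show "(\<integral>\<^sup>+z. g z * indicator D z \<partial>stieltjes T) = (\<integral>\<^sup>+\<omega>. \<integral>\<^sup>+r. h \<omega> r \<partial>path_measure T D \<omega> \<partial>M)"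
    unfolding nn_integral_stieltjes(1)[OF T gD] by (intro nn_integral_cong eq)
  show "(\<lambda>\<omega>. \<integral>\<^sup>+r. h \<omega> r \<partial>path_measure T D \<omega>) \<in> borel_measurable M"
    using nn_integral_stieltjes(2)[OF T gD] by (simp cong: measurable_cong add: eq)
qed

end

section \<open>Second moment of the stopped martingale\<close>

context compensated
begin

lemma A_predictable: "(\<lambda>z. A (fst z) (snd z)) \<in> borel_measurable (predictable_sigma M F)"
  using comp by (simp add: is_compensator_def case_prod_unfold)

text \<open>The bound is on \<open>A\<close> at r with its jump at r included, so the mass of
  \<open>A\<close> inside cannot exceed c. Such a cut is predictable because \<open>A\<close>
  is.\<close>

definition window :: "nat \<Rightarrow> real \<Rightarrow> real \<Rightarrow> (real \<times> 'a) set" where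
  "window n c T = {z \<in> below n T. A (fst z) (snd z) \<le> c}"

text \<open>On \<open>below n T\<close> this is \<open>N (r-)\<close>.\<close>

definition N_minus :: "nat \<Rightarrow> real \<Rightarrow> real \<times> 'a \<Rightarrow> ennreal" where
  "N_minus n T z = (\<Sum>k\<in>{1..n}. indicator (space (predictable_sigma M F) - below k T) z)"

text \<open>Sections of the window are initial intervals of \<open>(0, T]\<close>. Hence, at a time
  r inside, the restricted path measures have lost nothing up to r.\<close>

lemma window_le: "(r, \<omega>) \<in> window n c T \<Longrightarrow> 0 < s \<Longrightarrow> s \<le> r \<Longrightarrow> (s, \<omega>) \<in> window n c T"
  using inc_path_mono[OF AP.paths, of \<omega> s r] by (fastforce simp: window_def below_def)

lemma sets_window: "window n c T \<in> sets (predictable_sigma M F)"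
proof -
  have "{z \<in> space (predictable_sigma M F). A (fst z) (snd z) \<le> c} \<in> sets (predictable_sigma M F)"
    using A_predictable by measurable
  then have "below n T \<inter> {z \<in> space (predictable_sigma M F). A (fst z) (snd z) \<le> c} \<in> sets (predictable_sigma M F)"
    using sets_below by auto
  also have "below n T \<inter> {z \<in> space (predictable_sigma M F). A (fst z) (snd z) \<le> c} = window n c T"
    using sets.sets_into_space[OF sets_below] by (auto simp: window_def)
  finally show ?thesis .
qed

lemma N_minus_measurable: "N_minus n T \<in> borel_measurable (predictable_sigma M F)"
proof -
  have [measurable]: "space (predictable_sigma M F) - below k T \<in> sets (predictable_sigma M F)" for k
    using sets_below by auto
  show ?thesis unfolding N_minus_def[abs_def] by measurable
qed

text \<open>This identifies the first integrand of \<open>mass_products\<close> with a predictable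
  function, the left limit of \<open>N\<close>.\<close>

lemma path_N_minus:
  assumes n: "0 < n" and T: "0 \<le> T" and w: "\<omega> \<in> space M" and r: "(r, \<omega>) \<in> window n c T"
  shows "emeasure (NP.path_measure T (window n c T) \<omega>) {..<r} = N_minus n T (r, \<omega>)"
proof -
  define Q where "Q = {q \<in> \<rat>. 0 \<le> q \<and> q < r}"
  have r': "0 < r" "r \<le> T" "\<And>q. q \<in> Q \<Longrightarrow> N q \<omega> < n"
    using r by (auto simp: window_def below_def Q_def)
  \<comment> \<open>The left limit of \<open>N\<close> at r as a maximum over rational times; it
    exists because \<open>N < n\<close> before r inside the window.\<close>
  define k where "k = Max ((\<lambda>q. N q \<omega>) ` Q)"
  have fin: "finite ((\<lambda>q. N q \<omega>) ` Q)" by (rule finite_subset[of _ "{..<n}"]) (use r' in auto)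
  have ne: "0 \<in> Q" using r' by (auto simp: Q_def)
  have "k \<in> (\<lambda>q. N q \<omega>) ` Q" unfolding k_def using fin ne by (intro Max_in) auto
  then obtain q0 where q0: "q0 \<in> Q" "k = N q0 \<omega>" by auto
  have kmax: "N q \<omega> \<le> k" if "q \<in> Q" for q unfolding k_def using fin that by (intro Max_ge) auto
  have ex: "(\<exists>q\<in>\<rat>. 0 \<le> q \<and> q < r \<and> j \<le> N q \<omega>) \<longleftrightarrow> j \<le> k" for j
    using q0 kmax le_trans by (fastforce simp: Q_def)
  have exr: "(\<exists>q\<in>\<rat>. 0 \<le> q \<and> q < r \<and> v \<le> real (N q \<omega>)) \<longleftrightarrow> v \<le> real k" for v
  proof
    assume "\<exists>q\<in>\<rat>. 0 \<le> q \<and> q < r \<and> v \<le> real (N q \<omega>)"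
    then obtain q where "q \<in> Q" "v \<le> real (N q \<omega>)" by (auto simp: Q_def)
    then show "v \<le> real k" using kmax[of q] by linarith
  qed (use q0 in \<open>auto simp: Q_def\<close>)
  have kT: "k \<le> N T \<omega>" "k < n" using q0 r' N_mono[OF w, of q0 T] by (auto simp: Q_def)
  have "emeasure (NP.path_measure T (window n c T) \<omega>) {..<r} = emeasure lborel {0<..real k}"
    unfolding NP.emeasure_path_measure[OF T sets_window w lessThan_borel]
  proof (rule arg_cong[where f = "emeasure lborel"], intro set_eqI iffI)
    fix v assume "v \<in> {0<..real k}"
    then have v: "0 < v" "v \<le> real k" "v \<le> real (N T \<omega>)" using kT by auto
    then have "first_passage (\<lambda>s. real (N s \<omega>)) v < r"
      using first_passage_less_iff[OF NP.paths[OF w] T v(3,1)] exr by simp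
    then show "v \<in> {v. 0 < v \<and> v \<le> real (N T \<omega>) \<and> (first_passage (\<lambda>s. real (N s \<omega>)) v, \<omega>) \<in> window n c T
       \<and> first_passage (\<lambda>s. real (N s \<omega>)) v \<in> {..<r}}"
      using v window_le[OF r] first_passage_bounds(1)[OF NP.paths[OF w] T v(3,1)] by auto
  next
    fix v assume "v \<in> {v. 0 < v \<and> v \<le> real (N T \<omega>) \<and> (first_passage (\<lambda>s. real (N s \<omega>)) v, \<omega>) \<in> window n c T
       \<and> first_passage (\<lambda>s. real (N s \<omega>)) v \<in> {..<r}}"
    then show "v \<in> {0<..real k}"
      using first_passage_less_iff[OF NP.paths[OF w] T, of v r] exr by simp
  qed
  also have "\<dots> = of_nat k" by (simp add: ennreal_of_nat_eq_real_of_nat)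
  \<comment> \<open>Since \<open>k < n\<close>, the range \<open>{1..n}\<close> of the sum cuts
    nothing off k.\<close>
  also have "of_nat k = (\<Sum>j\<in>{1..n}. (if j \<le> k then 1 else 0) :: ennreal)"
  proof -
    have "{1..n} \<inter> {j. j \<le> k} = {1..k}" using kT by auto
    then show ?thesis by (simp add: sum.If_cases)
  qed
  also have "\<dots> = N_minus n T (r, \<omega>)"
    unfolding N_minus_def using r' w ex
    by (intro sum.cong) (auto simp: space_predictable below_def indicator_def)
  finally show ?thesis .
qed

text \<open>The second integrand. The closed ray \<open>{..r}\<close> takes in the jump of
  \<open>A\<close> at r, as required to obtain A(r) and not its left limit.\<close>

lemma path_A:
  assumes T: "0 \<le> T" and w: "\<omega> \<in> space M" and r: "(r, \<omega>) \<in> window n c T"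
  shows "emeasure (AP.path_measure T (window n c T) \<omega>) {..r} = ennreal (A r \<omega>)"
proof -
  have r': "0 < r" "r \<le> T" using r by (auto simp: window_def below_def)
  have AT: "A r \<omega> \<le> A T \<omega>" "0 \<le> A r \<omega>"
    using inc_path_mono[OF AP.paths[OF w]] inc_path_nonneg[OF AP.paths[OF w]] r' by auto
  have "emeasure (AP.path_measure T (window n c T) \<omega>) {..r} = emeasure lborel {0<..A r \<omega>}"
    unfolding AP.emeasure_path_measure[OF T sets_window w atMost_borel]
  proof (rule arg_cong[where f = "emeasure lborel"], intro set_eqI iffI)
    fix v assume "v \<in> {0<..A r \<omega>}"
    then have v: "0 < v" "v \<le> A r \<omega>" "v \<le> A T \<omega>" using AT by auto
    then have "first_passage (\<lambda>s. A s \<omega>) v \<le> r"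
      using first_passage_le_iff[OF AP.paths[OF w] T v(3), of r] r' by simp
    then show "v \<in> {v. 0 < v \<and> v \<le> A T \<omega> \<and> (first_passage (\<lambda>s. A s \<omega>) v, \<omega>) \<in> window n c T
       \<and> first_passage (\<lambda>s. A s \<omega>) v \<in> {..r}}"
      using v window_le[OF r] first_passage_bounds(1)[OF AP.paths[OF w] T v(3,1)] by auto
  next
    fix v assume "v \<in> {v. 0 < v \<and> v \<le> A T \<omega> \<and> (first_passage (\<lambda>s. A s \<omega>) v, \<omega>) \<in> window n c T
       \<and> first_passage (\<lambda>s. A s \<omega>) v \<in> {..r}}"
    then show "v \<in> {0<..A r \<omega>}"
      using first_passage_le_iff[OF AP.paths[OF w] T, of v r] r' by simp
  qed
  also have "\<dots> = ennreal (A r \<omega>)" using AT by simp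
  finally show ?thesis .
qed

text \<open>The levels passed at time r lie between the left limit of \<open>N\<close> and
  \<open>N r\<close>, so simplicity bounds the atom. This replaces the identity of \<open>N\<close>
  with its own quadratic variation.\<close>

lemma path_N_atom:
  assumes T: "0 \<le> T" and w: "\<omega> \<in> space M" and r: "0 < r"
  shows "emeasure (NP.path_measure T (window n c T) \<omega>) {r} \<le> 1"
proof -
  obtain l where l: "((\<lambda>t. N t \<omega>) \<longlongrightarrow> l) (at_left r)" "N r \<omega> = l \<or> N r \<omega> = l + 1"
    using simple_paths[OF w] r unfolding simple_path_def by blast
  have "\<forall>\<^sub>F s in at_left r. N s \<omega> = l" using l(1) by (simp add: tendsto_discrete)
  then obtain b where b: "b < r" "\<And>y. b < y \<Longrightarrow> y < r \<Longrightarrow> N y \<omega> = l"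
    using eventually_at_left[OF r] by auto
  obtain q where q: "q \<in> \<rat>" "max 0 b < q" "q < r"
    using Rats_dense_in_real[of "max 0 b" r] r b by auto
  have "emeasure (NP.path_measure T (window n c T) \<omega>) {r} \<le> emeasure lborel {real l..real (l + 1)}"
  proof (unfold NP.emeasure_path_measure[OF T sets_window w borel_singleton[OF sets.empty_sets]], rule emeasure_mono)
    show "{v. 0 < v \<and> v \<le> real (N T \<omega>) \<and> (first_passage (\<lambda>s. real (N s \<omega>)) v, \<omega>) \<in> window n c T
       \<and> first_passage (\<lambda>s. real (N s \<omega>)) v \<in> {r}} \<subseteq> {real l..real (l + 1)}"
    proof (intro subsetI)
      fix v assume "v \<in> {v. 0 < v \<and> v \<le> real (N T \<omega>) \<and> (first_passage (\<lambda>s. real (N s \<omega>)) v, \<omega>) \<in> window n c T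
       \<and> first_passage (\<lambda>s. real (N s \<omega>)) v \<in> {r}}"
      then have v: "0 < v" "v \<le> real (N T \<omega>)" "first_passage (\<lambda>s. real (N s \<omega>)) v = r" by auto
      have "\<not> v \<le> real (N q \<omega>)" "v \<le> real (N r \<omega>)"
        using first_passage_le_iff[OF NP.paths[OF w] T v(2), of q]
          first_passage_le_iff[OF NP.paths[OF w] T v(2), of r] v(3) q r by simp_all
      then show "v \<in> {real l..real (l + 1)}" using b(2)[of q] q l(2) by auto
    qed
  qed simp
  also have "\<dots> = 1" by simp
  finally show ?thesis .
qed

text \<open>A level v passed at a time r inside the window satisfies
  \<open>v \<le> A r \<omega> \<le> c\<close>.\<close>

lemma path_A_mass:
  assumes T: "0 \<le> T" and c: "0 \<le> c" and w: "\<omega> \<in> space M"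
  shows "emeasure (AP.path_measure T (window n c T) \<omega>) UNIV \<le> ennreal c"
proof -
  have U: "UNIV \<in> sets (borel :: real measure)" by simp
  have "emeasure (AP.path_measure T (window n c T) \<omega>) UNIV \<le> emeasure lborel {0..c}"
  proof (unfold AP.emeasure_path_measure[OF T sets_window w U], rule emeasure_mono)
    show "{v. 0 < v \<and> v \<le> A T \<omega> \<and> (first_passage (\<lambda>s. A s \<omega>) v, \<omega>) \<in> window n c T
       \<and> first_passage (\<lambda>s. A s \<omega>) v \<in> UNIV} \<subseteq> {0..c}"
    proof (intro subsetI)
      fix v assume "v \<in> {v. 0 < v \<and> v \<le> A T \<omega> \<and> (first_passage (\<lambda>s. A s \<omega>) v, \<omega>) \<in> window n c T
       \<and> first_passage (\<lambda>s. A s \<omega>) v \<in> UNIV}"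
      then have v: "0 < v" "v \<le> A T \<omega>" "A (first_passage (\<lambda>s. A s \<omega>) v) \<omega> \<le> c" by (auto simp: window_def)
      then show "v \<in> {0..c}" using first_passage_bounds(3)[OF AP.paths[OF w] T v(2,1)] by auto
    qed
  qed simp
  then show ?thesis using c by simp
qed

text \<open>A path that stays in the window up to T loses nothing by the restriction.\<close>

lemma path_masses:
  assumes T: "0 \<le> T" and w: "\<omega> \<in> space M" and lt: "N T \<omega> < n" "A T \<omega> \<le> c"
  shows "emeasure (NP.path_measure T (window n c T) \<omega>) UNIV = ennreal (real (N T \<omega>))"
    and "emeasure (AP.path_measure T (window n c T) \<omega>) UNIV = ennreal (A T \<omega>)"
proof -
  have U: "UNIV \<in> sets (borel :: real measure)" by simp
  have all: "(r, \<omega>) \<in> window n c T" if "0 < r" "r \<le> T" for r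
    using N_mono[OF w, of _ T] inc_path_mono[OF AP.paths[OF w], of r T] lt that w
    by (force simp: window_def below_def not_le)
  have "{v. 0 < v \<and> v \<le> real (N T \<omega>) \<and> (first_passage (\<lambda>s. real (N s \<omega>)) v, \<omega>) \<in> window n c T
       \<and> first_passage (\<lambda>s. real (N s \<omega>)) v \<in> UNIV} = {0<..real (N T \<omega>)}"
    using first_passage_bounds[OF NP.paths[OF w] T] all by auto
  then show "emeasure (NP.path_measure T (window n c T) \<omega>) UNIV = ennreal (real (N T \<omega>))"
    unfolding NP.emeasure_path_measure[OF T sets_window w U] by simp
  have "{v. 0 < v \<and> v \<le> A T \<omega> \<and> (first_passage (\<lambda>s. A s \<omega>) v, \<omega>) \<in> window n c T
       \<and> first_passage (\<lambda>s. A s \<omega>) v \<in> UNIV} = {0<..A T \<omega>}"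
    using first_passage_bounds[OF AP.paths[OF w] T] all by auto
  then show "emeasure (AP.path_measure T (window n c T) \<omega>) UNIV = ennreal (A T \<omega>)"
    unfolding AP.emeasure_path_measure[OF T sets_window w U] using inc_path_nonneg[OF AP.paths[OF w] T] by simp
qed

text \<open>With a and b the masses of the path measures of \<open>N\<close> and \<open>A\<close> on
  the window, the mean of \<open>a * a\<close> is at most \<open>2 * I1 + I0\<close>, that of
  \<open>b * b\<close> at most \<open>2 * I2\<close>, and that of \<open>a * b\<close> is
  \<open>I2 + I1\<close>; the same three integrals serve both processes because the integrands are
  predictable. The squared difference thus has mean at most \<open>I0\<close>, the mean of b, which
  is at most c. Chebyshev's inequality gives the claim.\<close>

lemma deviation_bound:
  assumes n: "0 < n" and T: "0 \<le> T" and c: "0 \<le> c" and d: "0 \<le> d"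
  shows "ennreal (d\<^sup>2) * emeasure M {\<omega> \<in> space M. N T \<omega> < n \<and> A T \<omega> \<le> c \<and> d \<le> \<bar>real (N T \<omega>) - A T \<omega>\<bar>} \<le> ennreal c"
proof -
  let ?D = "window n c T"
  define m1 where "m1 = NP.path_measure T ?D"
  define m2 where "m2 = AP.path_measure T ?D"
  define E where "E = {\<omega> \<in> space M. N T \<omega> < n \<and> A T \<omega> \<le> c \<and> d \<le> \<bar>real (N T \<omega>) - A T \<omega>\<bar>}"
  define a where "a \<omega> = emeasure (m1 \<omega>) UNIV" for \<omega>
  define b where "b \<omega> = emeasure (m2 \<omega>) UNIV" for \<omega>
  have fin: "finite_measure (m1 \<omega>)" "finite_measure (m2 \<omega>)" if "\<omega> \<in> space M" for \<omega>
    unfolding m1_def m2_def using NP.finite_path_measure AP.finite_path_measure T sets_window that by auto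
  have S: "sets (m1 \<omega>) = sets borel" "sets (m2 \<omega>) = sets borel" for \<omega> by (simp_all add: m1_def m2_def)
  have sp: "space (m1 \<omega>) = UNIV" "space (m2 \<omega>) = UNIV" for \<omega> using S[THEN sets_eq_imp_space_eq] by simp_all
  note mp = mass_products[OF fin S, folded a_def b_def]
  note mr = measurable_emeasure_rays
  note gA = measurable_compose[OF A_predictable measurable_ennreal]
  have DD: "?D \<subseteq> below n T" by (auto simp: window_def)
  have pos: "0 < first_passage x v" if "inc_path x" "0 < v" "v \<le> x T" for x v
    using first_passage_bounds(1)[OF that(1) T that(3,2)] .
  define I0 where "I0 = (\<integral>\<^sup>+z. 1 * indicator ?D z \<partial>AP.stieltjes T)"
  define I1 where "I1 = (\<integral>\<^sup>+z. N_minus n T z * indicator ?D z \<partial>AP.stieltjes T)"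
  define I2 where "I2 = (\<integral>\<^sup>+z. ennreal (A (fst z) (snd z)) * indicator ?D z \<partial>AP.stieltjes T)"
  have N0: "I0 = (\<integral>\<^sup>+\<omega>. a \<omega> \<partial>M)" "a \<in> borel_measurable M"
  proof -
    have "(\<integral>\<^sup>+z. 1 * indicator ?D z \<partial>NP.stieltjes T) = (\<integral>\<^sup>+\<omega>. \<integral>\<^sup>+r. 1 \<partial>m1 \<omega> \<partial>M)"
      "(\<lambda>\<omega>. \<integral>\<^sup>+r. 1 \<partial>m1 \<omega>) \<in> borel_measurable M"
      unfolding m1_def by (rule NP.nn_integral_stieltjes_path[OF T sets_window]; simp)+
    then show "I0 = (\<integral>\<^sup>+\<omega>. a \<omega> \<partial>M)" "a \<in> borel_measurable M"
      using nn_integral_stieltjes_eq[OF n T sets_window DD, of "\<lambda>_. 1"]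
      by (simp_all add: I0_def a_def[abs_def] sp)
  qed
  have A0: "I0 = (\<integral>\<^sup>+\<omega>. b \<omega> \<partial>M)" "b \<in> borel_measurable M"
  proof -
    have "(\<integral>\<^sup>+z. 1 * indicator ?D z \<partial>AP.stieltjes T) = (\<integral>\<^sup>+\<omega>. \<integral>\<^sup>+r. 1 \<partial>m2 \<omega> \<partial>M)"
      "(\<lambda>\<omega>. \<integral>\<^sup>+r. 1 \<partial>m2 \<omega>) \<in> borel_measurable M"
      unfolding m2_def by (rule AP.nn_integral_stieltjes_path[OF T sets_window]; simp)+
    then show "I0 = (\<integral>\<^sup>+\<omega>. b \<omega> \<partial>M)" "b \<in> borel_measurable M"
      by (simp_all add: I0_def b_def[abs_def] sp)
  qed
  have N1: "I1 = (\<integral>\<^sup>+\<omega>. \<integral>\<^sup>+r. emeasure (m1 \<omega>) {..<r} \<partial>m1 \<omega> \<partial>M)"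
    "(\<lambda>\<omega>. \<integral>\<^sup>+r. emeasure (m1 \<omega>) {..<r} \<partial>m1 \<omega>) \<in> borel_measurable M"
    unfolding I1_def nn_integral_stieltjes_eq[OF n T sets_window DD N_minus_measurable, symmetric] m1_def
    by (rule NP.nn_integral_stieltjes_path[OF T sets_window N_minus_measurable];
        use path_N_minus[OF n T] mr(2)[OF fin(1) S(1)] in \<open>simp add: m1_def\<close>)+
  have A1: "I1 = (\<integral>\<^sup>+\<omega>. \<integral>\<^sup>+r. emeasure (m1 \<omega>) {..<r} \<partial>m2 \<omega> \<partial>M)"
    "(\<lambda>\<omega>. \<integral>\<^sup>+r. emeasure (m1 \<omega>) {..<r} \<partial>m2 \<omega>) \<in> borel_measurable M"
    unfolding I1_def m2_def
    by (rule AP.nn_integral_stieltjes_path[OF T sets_window N_minus_measurable];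
        use path_N_minus[OF n T] mr(2)[OF fin(1) S(1)] in \<open>simp add: m1_def\<close>)+
  have N2: "I2 = (\<integral>\<^sup>+\<omega>. \<integral>\<^sup>+r. emeasure (m2 \<omega>) {..r} \<partial>m1 \<omega> \<partial>M)"
    "(\<lambda>\<omega>. \<integral>\<^sup>+r. emeasure (m2 \<omega>) {..r} \<partial>m1 \<omega>) \<in> borel_measurable M"
    unfolding I2_def nn_integral_stieltjes_eq[OF n T sets_window DD gA, symmetric] m1_def
    by (rule NP.nn_integral_stieltjes_path[OF T sets_window gA];
        use path_A[OF T] mr(1)[OF fin(2) S(2)] in \<open>simp add: m2_def\<close>)+
  have A2: "I2 = (\<integral>\<^sup>+\<omega>. \<integral>\<^sup>+r. emeasure (m2 \<omega>) {..r} \<partial>m2 \<omega> \<partial>M)"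
    "(\<lambda>\<omega>. \<integral>\<^sup>+r. emeasure (m2 \<omega>) {..r} \<partial>m2 \<omega>) \<in> borel_measurable M"
    unfolding I2_def m2_def
    by (rule AP.nn_integral_stieltjes_path[OF T sets_window gA];
        use path_A[OF T] mr(1)[OF fin(2) S(2)] in \<open>simp add: m2_def\<close>)+
  have I0c: "I0 \<le> ennreal c"
  proof -
    have "I0 \<le> (\<integral>\<^sup>+\<omega>. ennreal c \<partial>M)"
      unfolding A0 b_def m2_def by (intro nn_integral_mono path_A_mass T c)
    then show ?thesis by (simp add: emeasure_space_1)
  qed
  then have I0top: "I0 < top" by (rule le_less_trans) simp
  have I0M: "(\<lambda>z. indicator ?D z :: ennreal) \<in> borel_measurable (AP.stieltjes T)"
    using sets_window by simp
  \<comment> \<open>Finiteness of \<open>I1\<close> and \<open>I2\<close> permits their cancellation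
    in the extended reals at the end; on the window the integrands are bounded by n and c.\<close>
  have I1fin: "I1 < \<infinity>"
  proof -
    have "N_minus n T z \<le> of_nat n" for z
    proof -
      have "N_minus n T z \<le> (\<Sum>k\<in>{1..n}. 1)"
        unfolding N_minus_def by (intro sum_mono) (simp add: indicator_def)
      then show ?thesis by simp
    qed
    then have "I1 \<le> (\<integral>\<^sup>+z. of_nat n * indicator ?D z \<partial>AP.stieltjes T)"
      unfolding I1_def by (intro nn_integral_mono mult_right_mono) auto
    also have "\<dots> = of_nat n * I0" unfolding I0_def using I0M by (simp add: nn_integral_cmult)
    also have "\<dots> < \<infinity>" using I0top by (simp add: ennreal_mult_less_top ennreal_of_nat_eq_real_of_nat)
    finally show ?thesis .
  qed
  have I2fin: "I2 < \<infinity>"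
  proof -
    have "I2 \<le> (\<integral>\<^sup>+z. ennreal c * indicator ?D z \<partial>AP.stieltjes T)"
      unfolding I2_def by (intro nn_integral_mono) (auto simp: window_def indicator_def intro!: ennreal_leI)
    also have "\<dots> = ennreal c * I0" unfolding I0_def using I0M by (simp add: nn_integral_cmult)
    also have "\<dots> < \<infinity>" using I0top by (simp add: ennreal_mult_less_top ennreal_of_nat_eq_real_of_nat)
    finally show ?thesis .
  qed
  have ET[measurable]: "E \<in> sets M"
  proof -
    have [measurable]: "(\<lambda>\<omega>. real (N T \<omega>)) \<in> borel_measurable M" using NP.meas_M[OF T] .
    have [measurable]: "A T \<in> borel_measurable M" using AP.meas_M[OF T] .
    have "{\<omega> \<in> space M. real (N T \<omega>) < real n \<and> A T \<omega> \<le> c \<and> d \<le> \<bar>real (N T \<omega>) - A T \<omega>\<bar>} \<in> sets M"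
      by measurable
    then show ?thesis by (simp add: E_def)
  qed
  \<comment> \<open>The square of \<open>a - b\<close> with the mixed term moved to the left, as
    subtraction of extended nonnegative reals is truncated.\<close>
  have point: "ennreal (d\<^sup>2) * indicator E \<omega> + 2 * (a \<omega> * b \<omega>) \<le> a \<omega> * a \<omega> + b \<omega> * b \<omega>" if w: "\<omega> \<in> space M" for \<omega>
  proof -
    obtain x y where xy: "a \<omega> = ennreal x" "b \<omega> = ennreal y" "0 \<le> x" "0 \<le> y"
      using finite_measure.emeasure_finite[OF fin(1)[OF w], of UNIV] finite_measure.emeasure_finite[OF fin(2)[OF w], of UNIV]
      unfolding a_def b_def by (metis ennreal_cases infinity_ennreal_def)
    have key: "(if \<omega> \<in> E then d\<^sup>2 else 0) \<le> (x - y)\<^sup>2"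
    proof (cases "\<omega> \<in> E")
      case True
      then have e: "N T \<omega> < n" "A T \<omega> \<le> c" "d \<le> \<bar>real (N T \<omega>) - A T \<omega>\<bar>" by (auto simp: E_def)
      have "x = real (N T \<omega>)" "y = A T \<omega>"
        using path_masses[OF T w e(1,2)] xy inc_path_nonneg[OF AP.paths[OF w] T]
        by (auto simp: a_def b_def m1_def m2_def)
      then have "d\<^sup>2 \<le> \<bar>x - y\<bar>\<^sup>2" using e(3) d by (intro power_mono) auto
      then show ?thesis using True by simp
    qed simp
    have "ennreal (d\<^sup>2) * indicator E \<omega> = ennreal (if \<omega> \<in> E then d\<^sup>2 else 0)"
      by (simp add: indicator_def)
    then have "ennreal (d\<^sup>2) * indicator E \<omega> + 2 * (a \<omega> * b \<omega>) = ennreal ((if \<omega> \<in> E then d\<^sup>2 else 0) + 2 * (x * y))"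
      using xy by (simp add: ennreal_mult ennreal_plus)
    also have "\<dots> \<le> ennreal (x * x + y * y)"
      using key by (intro ennreal_leI) (simp add: power2_eq_square algebra_simps)
    finally show ?thesis using xy by (simp add: ennreal_mult ennreal_plus)
  qed
  have [measurable]: "a \<in> borel_measurable M" "b \<in> borel_measurable M" by fact+
  have ab: "(\<integral>\<^sup>+\<omega>. a \<omega> * b \<omega> \<partial>M) = I2 + I1"
    unfolding N2 A1 by (subst nn_integral_add[symmetric]) (use N2(2) A1(2) in \<open>auto intro!: nn_integral_cong mp(1)\<close>)
  have aa: "(\<integral>\<^sup>+\<omega>. a \<omega> * a \<omega> \<partial>M) \<le> 2 * I1 + I0"
  proof -
    have atoms: "(\<integral>\<^sup>+r. emeasure (m1 \<omega>) {r} \<partial>m1 \<omega>) \<le> a \<omega>" if w: "\<omega> \<in> space M" for \<omega>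
    proof -
      have "emeasure (m1 \<omega>) {r} \<le> 1" for r
      proof (cases "0 < r")
        case True
        then show ?thesis unfolding m1_def by (rule path_N_atom[OF T w])
      next
        case False
        have "emeasure (m1 \<omega>) {r} = 0"
          unfolding m1_def NP.emeasure_path_measure[OF T sets_window w borel_singleton[OF sets.empty_sets]]
          using False pos[OF NP.paths[OF w]] by (auto intro!: emeasure_empty arg_cong[where f = "emeasure lborel" and y = "{}", THEN trans])
        then show ?thesis by simp
      qed
      then have "(\<integral>\<^sup>+r. emeasure (m1 \<omega>) {r} \<partial>m1 \<omega>) \<le> (\<integral>\<^sup>+r. 1 \<partial>m1 \<omega>)"
        by (intro nn_integral_mono)
      then show ?thesis by (simp add: a_def sp)
    qed
    have "(\<integral>\<^sup>+\<omega>. a \<omega> * a \<omega> \<partial>M) \<le> (\<integral>\<^sup>+\<omega>. 2 * (\<integral>\<^sup>+r. emeasure (m1 \<omega>) {..<r} \<partial>m1 \<omega>) + a \<omega> \<partial>M)"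
      by (intro nn_integral_mono) (simp add: mp(2) atoms add_left_mono)
    also have "\<dots> = 2 * I1 + I0"
      unfolding N1(1) N0(1) using N1(2) by (simp add: nn_integral_add nn_integral_cmult)
    finally show ?thesis .
  qed
  have bb: "(\<integral>\<^sup>+\<omega>. b \<omega> * b \<omega> \<partial>M) \<le> 2 * I2"
  proof -
    have "(\<integral>\<^sup>+\<omega>. b \<omega> * b \<omega> \<partial>M) \<le> (\<integral>\<^sup>+\<omega>. 2 * (\<integral>\<^sup>+r. emeasure (m2 \<omega>) {..r} \<partial>m2 \<omega>) \<partial>M)"
      by (intro nn_integral_mono mp(3))
    also have "\<dots> = 2 * I2" unfolding A2(1) using A2(2) by (simp add: nn_integral_cmult)
    finally show ?thesis .
  qed
  have "ennreal (d\<^sup>2) * emeasure M E + 2 * (I2 + I1) = (\<integral>\<^sup>+\<omega>. ennreal (d\<^sup>2) * indicator E \<omega> + 2 * (a \<omega> * b \<omega>) \<partial>M)"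
    by (simp add: nn_integral_add nn_integral_cmult ab)
  also have "\<dots> \<le> (\<integral>\<^sup>+\<omega>. a \<omega> * a \<omega> + b \<omega> * b \<omega> \<partial>M)" by (intro nn_integral_mono point)
  also have "\<dots> = (\<integral>\<^sup>+\<omega>. a \<omega> * a \<omega> \<partial>M) + (\<integral>\<^sup>+\<omega>. b \<omega> * b \<omega> \<partial>M)" by (simp add: nn_integral_add)
  also have "\<dots> \<le> (2 * I1 + I0) + 2 * I2" by (intro add_mono aa bb)
  also have "\<dots> = I0 + 2 * (I2 + I1)" by (simp add: distrib_left ac_simps)
  finally have "2 * (I2 + I1) + ennreal (d\<^sup>2) * emeasure M E \<le> 2 * (I2 + I1) + I0" by (simp add: add.commute)
  moreover have "2 * (I2 + I1) \<noteq> top" using I1fin I2fin by (simp add: ennreal_mult_eq_top_iff less_top[symmetric])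
  ultimately have "ennreal (d\<^sup>2) * emeasure M E \<le> I0" by (auto simp: ennreal_add_left_cancel_le)
  then show ?thesis using I0c unfolding E_def by (rule order_trans)
qed

text \<open>The previous bound is free of n and \<open>N T\<close> is finite on every path, so n
  drops out by continuity from below. \<open>Suc n\<close> meets the premise
  \<open>0 < n\<close>.\<close>

lemma deviation_prob:
  assumes T: "0 \<le> T" and c: "0 \<le> c" and d: "0 < d"
  shows "measure M {\<omega> \<in> space M. A T \<omega> \<le> c \<and> d \<le> \<bar>real (N T \<omega>) - A T \<omega>\<bar>} \<le> c / d\<^sup>2"
proof -
  define E where "E n = {\<omega> \<in> space M. N T \<omega> < Suc n \<and> A T \<omega> \<le> c \<and> d \<le> \<bar>real (N T \<omega>) - A T \<omega>\<bar>}" for n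
  have [measurable]: "(\<lambda>\<omega>. real (N T \<omega>)) \<in> borel_measurable M" "A T \<in> borel_measurable M"
    using NP.meas_M[OF T] AP.meas_M[OF T] by auto
  have E: "E n \<in> sets M" for n
  proof -
    have "{\<omega> \<in> space M. real (N T \<omega>) < real (Suc n) \<and> A T \<omega> \<le> c \<and> d \<le> \<bar>real (N T \<omega>) - A T \<omega>\<bar>} \<in> sets M"
      by measurable
    then show ?thesis unfolding E_def of_nat_less_iff .
  qed
  have "(\<lambda>n. measure M (E n)) \<longlonglongrightarrow> measure M (\<Union>n. E n)"
    by (rule finite_Lim_measure_incseq) (auto simp: incseq_def E image_subset_iff, auto simp: E_def)
  moreover have "measure M (E n) \<le> c / d\<^sup>2" for n
  proof -
    have "ennreal (d\<^sup>2 * measure M (E n)) \<le> ennreal c"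
      using deviation_bound[OF zero_less_Suc T c less_imp_le[OF d], of n] unfolding E_def[symmetric]
      by (simp add: ennreal_mult emeasure_eq_measure)
    then have "d\<^sup>2 * measure M (E n) \<le> c" using c by simp
    then show ?thesis using d by (simp add: field_simps)
  qed
  ultimately have "measure M (\<Union>n. E n) \<le> c / d\<^sup>2" by (intro LIMSEQ_le_const2) auto
  also have "(\<Union>n. E n) = {\<omega> \<in> space M. A T \<omega> \<le> c \<and> d \<le> \<bar>real (N T \<omega>) - A T \<omega>\<bar>}"
    by (auto simp: E_def)
  finally show ?thesis .
qed

text \<open>Weak convergence to a constant, tested with the bounded continuous function
  \<open>min d \<bar>x - lam\<bar>\<close> that vanishes at the limit, followed by Markov's
  inequality.\<close>

lemma compensator_in_prob:
  assumes law: "converges_in_law euclideanreal M (\<lambda>t \<omega>. A t \<omega> / t) M (\<lambda>_. lam) at_top" and d: "0 < d"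
  shows "((\<lambda>t. measure M {\<omega> \<in> space M. d \<le> \<bar>A t \<omega> / t - lam\<bar>}) \<longlongrightarrow> 0) at_top"
proof -
  define f where "f x = min d \<bar>x - lam\<bar>" for x
  have "continuous_map euclideanreal euclideanreal f"
    unfolding f_def by (auto intro!: continuous_intros)
  moreover have "bounded (f ` topspace euclideanreal)"
    unfolding bounded_iff f_def using d by (intro exI[of _ d]) auto
  ultimately have "((\<lambda>t. \<integral>\<omega>. f (A t \<omega> / t) \<partial>M) \<longlongrightarrow> (\<integral>\<omega>. f lam \<partial>M)) at_top"
    using law unfolding converges_in_law_def by blast
  then have lim: "((\<lambda>t. (\<integral>\<omega>. f (A t \<omega> / t) \<partial>M) / d) \<longlongrightarrow> 0) at_top"
    using d by (intro tendsto_divide_zero) (simp add: f_def)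
  show ?thesis
  proof (rule tendsto_sandwich[OF _ _ tendsto_const lim])
    show "\<forall>\<^sub>F t in at_top. measure M {\<omega> \<in> space M. d \<le> \<bar>A t \<omega> / t - lam\<bar>} \<le> (\<integral>\<omega>. f (A t \<omega> / t) \<partial>M) / d"
    proof (rule eventually_mono[OF eventually_ge_at_top[of 0]])
      fix t :: real assume t: "0 \<le> t"
      have [measurable]: "A t \<in> borel_measurable M" using AP.meas_M[OF t] .
      have E: "{\<omega> \<in> space M. d \<le> \<bar>A t \<omega> / t - lam\<bar>} \<in> sets M" by measurable
      have "d * measure M {\<omega> \<in> space M. d \<le> \<bar>A t \<omega> / t - lam\<bar>}
         = (\<integral>\<omega>. d * indicator {\<omega> \<in> space M. d \<le> \<bar>A t \<omega> / t - lam\<bar>} \<omega> \<partial>M)"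
        using E by simp
      also have "\<dots> \<le> (\<integral>\<omega>. f (A t \<omega> / t) \<partial>M)"
      proof (rule integral_mono)
        show "integrable M (\<lambda>\<omega>. d * indicator {\<omega> \<in> space M. d \<le> \<bar>A t \<omega> / t - lam\<bar>} \<omega>)"
          using integrable_real_indicator[OF E] by (simp add: emeasure_eq_measure)
        show "integrable M (\<lambda>\<omega>. f (A t \<omega> / t))"
          using d by (intro integrable_const_bound[of _ d]) (auto simp: f_def)
      qed (use d in \<open>auto simp: f_def indicator_def\<close>)
      finally show "measure M {\<omega> \<in> space M. d \<le> \<bar>A t \<omega> / t - lam\<bar>} \<le> (\<integral>\<omega>. f (A t \<omega> / t) \<partial>M) / d"
        using d by (simp add: field_simps)
    qed
  qed simp
qed

lemma counting_in_prob:
  assumes law: "converges_in_law euclideanreal M (\<lambda>t \<omega>. A t \<omega> / t) M (\<lambda>_. lam) at_top"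
    and lam: "0 < lam" and d: "0 < d"
  shows "((\<lambda>t. measure M {\<omega> \<in> space M. d \<le> \<bar>real (N t \<omega>) / t - lam\<bar>}) \<longlongrightarrow> 0) at_top"
proof -
  \<comment> \<open>For \<open>c = (lam + d / 2) * t\<close> and deviation \<open>d / 2 * t\<close>,
    the bound of \<open>deviation_prob\<close> is \<open>K / t\<close>: c grows linearly in t and
    the squared deviation quadratically.\<close>
  define K where "K = (lam + d / 2) * 4 / d\<^sup>2"
  have "((\<lambda>t. measure M {\<omega> \<in> space M. d / 2 \<le> \<bar>A t \<omega> / t - lam\<bar>} + K * inverse t) \<longlongrightarrow> 0 + K * 0) at_top"
    using d by (intro tendsto_intros compensator_in_prob[OF law] tendsto_inverse_0_at_top filterlim_ident) auto
  then have lim: "((\<lambda>t. measure M {\<omega> \<in> space M. d / 2 \<le> \<bar>A t \<omega> / t - lam\<bar>} + K * inverse t) \<longlongrightarrow> 0) at_top"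
    by simp
  show ?thesis
  proof (rule tendsto_sandwich[OF _ _ tendsto_const lim])
    show "\<forall>\<^sub>F t in at_top. measure M {\<omega> \<in> space M. d \<le> \<bar>real (N t \<omega>) / t - lam\<bar>}
      \<le> measure M {\<omega> \<in> space M. d / 2 \<le> \<bar>A t \<omega> / t - lam\<bar>} + K * inverse t"
    proof (rule eventually_mono[OF eventually_gt_at_top[of 0]])
      fix t :: real assume t: "0 < t"
      have [measurable]: "A t \<in> borel_measurable M" "(\<lambda>\<omega>. real (N t \<omega>)) \<in> borel_measurable M"
        using AP.meas_M NP.meas_M t by auto
      let ?E = "{\<omega> \<in> space M. d / 2 \<le> \<bar>A t \<omega> / t - lam\<bar>}"
      let ?G = "{\<omega> \<in> space M. A t \<omega> \<le> (lam + d / 2) * t \<and> d / 2 * t \<le> \<bar>real (N t \<omega>) - A t \<omega>\<bar>}"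
      have EG: "?E \<in> sets M" "?G \<in> sets M" by measurable
      have "{\<omega> \<in> space M. d \<le> \<bar>real (N t \<omega>) / t - lam\<bar>} \<subseteq> ?E \<union> ?G"
      proof (intro subsetI)
        fix \<omega> assume w: "\<omega> \<in> {\<omega> \<in> space M. d \<le> \<bar>real (N t \<omega>) / t - lam\<bar>}"
        show "\<omega> \<in> ?E \<union> ?G"
        proof (cases "d / 2 \<le> \<bar>A t \<omega> / t - lam\<bar>")
          case False
          moreover have "d \<le> \<bar>real (N t \<omega>) / t - lam\<bar>" using w by simp
          ultimately have "A t \<omega> / t \<le> lam + d / 2" "d / 2 \<le> \<bar>real (N t \<omega>) / t - A t \<omega> / t\<bar>"
            by linarith+
          moreover have "\<bar>real (N t \<omega>) / t - A t \<omega> / t\<bar> = \<bar>real (N t \<omega>) - A t \<omega>\<bar> / t"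
            using t by (simp add: diff_divide_distrib[symmetric])
          ultimately show ?thesis using w t by (auto simp: field_simps)
        qed (use w in auto)
      qed
      then have "measure M {\<omega> \<in> space M. d \<le> \<bar>real (N t \<omega>) / t - lam\<bar>} \<le> measure M (?E \<union> ?G)"
        using EG by (intro finite_measure_mono) auto
      also have "\<dots> \<le> measure M ?E + measure M ?G" by (rule measure_Un_le[OF EG])
      also have "measure M ?G \<le> (lam + d / 2) * t / (d / 2 * t)\<^sup>2"
        using t d lam by (intro deviation_prob) auto
      also have "\<dots> = K * inverse t" using t d by (simp add: K_def power2_eq_square field_simps)
      finally show "measure M {\<omega> \<in> space M. d \<le> \<bar>real (N t \<omega>) / t - lam\<bar>} \<le> measure M ?E + K * inverse t"
        by simp
    qed
  qed simp
qed

end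

subsection \<open>Counting paths in the Skorohod space\<close>

definition real_path :: "(real \<Rightarrow> nat) \<Rightarrow> real \<Rightarrow> real" where
  "real_path x = (\<lambda>t\<in>{0..}. real (x t))"

lemma counting_path_mono: "counting_path x \<Longrightarrow> 0 \<le> s \<Longrightarrow> s \<le> t \<Longrightarrow> x s \<le> x t"
  by (auto simp: counting_path_def mono_on_def)

lemma counting_path_right:
  assumes "counting_path x" "0 \<le> t"
  obtains b where "t < b" "\<And>s. t \<le> s \<Longrightarrow> s < b \<Longrightarrow> x s = x t"
proof -
  have "\<forall>\<^sub>F s in at_right t. x s = x t"
    using assms by (auto simp: counting_path_def tendsto_discrete)
  then obtain b where b: "t < b" "\<And>s. t < s \<Longrightarrow> s < b \<Longrightarrow> x s = x t"
    by (auto simp: eventually_at_right_field)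
  have "x s = x t" if "t \<le> s" "s < b" for s
    using b(2)[of s] that by (cases "s = t") auto
  with b(1) show thesis by (rule that)
qed

lemma real_path_cadlag:
  assumes x: "counting_path x"
  shows "real_path x \<in> cadlag"
  unfolding cadlag_def
proof (intro CollectI conjI allI impI)
  show "real_path x \<in> extensional {0..}" by (simp add: real_path_def)
  show "(real_path x \<longlongrightarrow> real_path x t) (at_right t)" if t: "0 \<le> t" for t
  proof (rule tendsto_eventually)
    obtain b where b: "t < b" "\<And>s. t \<le> s \<Longrightarrow> s < b \<Longrightarrow> x s = x t"
      using counting_path_right[OF x t] by blast
    show "\<forall>\<^sub>F s in at_right t. real_path x s = real_path x t"
      unfolding eventually_at_right_field
    proof (intro exI[of _ b] conjI allI impI b(1))
      fix s assume "t < s" "s < b"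
      then have "x s = x t" by (intro b(2)) simp_all
      then show "real_path x s = real_path x t" using t \<open>t < s\<close> by (simp add: real_path_def)
    qed
  qed
  show "\<exists>l. (real_path x \<longlongrightarrow> l) (at_left t)" if t: "0 < t" for t
  proof -
    \<comment> \<open>A monotone path in the naturals takes finitely many values before t; once the
      largest is attained it stays constant, and that value is the left limit.\<close>
    have fin: "finite (x ` {0..<t})"
      by (rule finite_subset[of _ "{..x t}"]) (auto intro: counting_path_mono[OF x])
    have "Max (x ` {0..<t}) \<in> x ` {0..<t}" using fin t by (intro Max_in) auto
    then obtain s0 where s0: "0 \<le> s0" "s0 < t" "x s0 = Max (x ` {0..<t})" by auto
    have "x s = x s0" if "s0 < s" "s < t" for s
    proof (rule antisym)
      show "x s \<le> x s0" unfolding s0(3) using fin that s0 by (intro Max_ge) auto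
      show "x s0 \<le> x s" by (rule counting_path_mono[OF x s0(1)]) (use that in simp)
    qed
    then have "\<forall>\<^sub>F s in at_left t. real_path x s = real (x s0)"
      unfolding eventually_at_left_field using s0 by (intro exI[of _ s0]) (auto simp: real_path_def)
    then show ?thesis using tendsto_eventually by blast
  qed
qed

text \<open>The piecewise linear map through the knots \<open>(\<sigma> v, \<rho> v)\<close>, with
  slope 1 after the last. Its distance to the identity is at most \<open>\<delta>\<close> at the
  knots, hence also between them, where the difference is a convex combination of the differences at
  the two ends.\<close>

lemma time_change_interpolation:
  fixes \<sigma> \<rho> :: "nat \<Rightarrow> real"
  assumes "finite V" "0 \<le> \<delta>"
    and "strict_mono_on V \<sigma>" "strict_mono_on V \<rho>"
    and "\<And>v. v \<in> V \<Longrightarrow> 0 < \<sigma> v \<and> 0 < \<rho> v \<and> \<bar>\<rho> v - \<sigma> v\<bar> \<le> \<delta>"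
  shows "\<exists>\<mu>\<in>time_changes. (\<forall>v\<in>V. \<mu> (\<sigma> v) = \<rho> v) \<and> (\<forall>s\<ge>0. \<bar>\<mu> s - s\<bar> \<le> \<delta>)"
proof -
  \<comment> \<open>Besides the map, the induction carries its last knot \<open>(a, b)\<close>, the
    origin at the start, from which the next segment departs.\<close>
  have "\<exists>\<mu> a b. \<mu> 0 = 0 \<and> strict_mono_on {0..} \<mu> \<and> continuous_on {0..} \<mu>
      \<and> (\<forall>v\<in>V. \<mu> (\<sigma> v) = \<rho> v) \<and> (\<forall>s\<ge>0. \<bar>\<mu> s - s\<bar> \<le> \<delta>)
      \<and> 0 \<le> a \<and> \<mu> a = b \<and> (\<forall>v\<in>V. \<sigma> v \<le> a) \<and> (a = 0 \<and> b = 0 \<or> (\<exists>v\<in>V. a = \<sigma> v \<and> b = \<rho> v))"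
    using assms
  proof (induction V rule: finite_linorder_max_induct)
    case empty
    show ?case
      using empty by (intro exI[of _ "\<lambda>s. s"] exI[of _ 0]) (auto simp: strict_mono_on_def)
  next
    case (insert w V)
    have "strict_mono_on V \<sigma>" "strict_mono_on V \<rho>" using insert.prems(2,3) by (auto simp: strict_mono_on_def)
    moreover have "\<And>v. v \<in> V \<Longrightarrow> 0 < \<sigma> v \<and> 0 < \<rho> v \<and> \<bar>\<rho> v - \<sigma> v\<bar> \<le> \<delta>"
      using insert.prems(4) by blast
    ultimately have IHraw: "\<exists>\<mu> a b. \<mu> 0 = 0 \<and> strict_mono_on {0..} \<mu> \<and> continuous_on {0..} \<mu>
      \<and> (\<forall>v\<in>V. \<mu> (\<sigma> v) = \<rho> v) \<and> (\<forall>s\<ge>0. \<bar>\<mu> s - s\<bar> \<le> \<delta>)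
      \<and> 0 \<le> a \<and> \<mu> a = b \<and> (\<forall>v\<in>V. \<sigma> v \<le> a) \<and> (a = 0 \<and> b = 0 \<or> (\<exists>v\<in>V. a = \<sigma> v \<and> b = \<rho> v))"
      by (intro insert.IH insert.prems(1))
    from IHraw
    obtain \<mu> a b where IH0: "\<mu> 0 = 0 \<and> strict_mono_on {0..} \<mu> \<and> continuous_on {0..} \<mu>
      \<and> (\<forall>v\<in>V. \<mu> (\<sigma> v) = \<rho> v) \<and> (\<forall>s\<ge>0. \<bar>\<mu> s - s\<bar> \<le> \<delta>)
      \<and> 0 \<le> a \<and> \<mu> a = b \<and> (\<forall>v\<in>V. \<sigma> v \<le> a) \<and> (a = 0 \<and> b = 0 \<or> (\<exists>v\<in>V. a = \<sigma> v \<and> b = \<rho> v))"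
      by (elim exE) blast
    then have IH: "\<mu> 0 = 0" "strict_mono_on {0..} \<mu>" "continuous_on {0..} \<mu>"
      "\<And>v. v \<in> V \<Longrightarrow> \<mu> (\<sigma> v) = \<rho> v" "\<And>s. 0 \<le> s \<Longrightarrow> \<bar>\<mu> s - s\<bar> \<le> \<delta>"
      "0 \<le> a" "\<mu> a = b" "\<And>v. v \<in> V \<Longrightarrow> \<sigma> v \<le> a" "a = 0 \<and> b = 0 \<or> (\<exists>v\<in>V. a = \<sigma> v \<and> b = \<rho> v)"
      by blast+
    have w: "0 < \<sigma> w" "0 < \<rho> w" "\<bar>\<rho> w - \<sigma> w\<bar> \<le> \<delta>" using insert.prems(4)[of w] by auto
    have aw: "a < \<sigma> w" "b < \<rho> w"
      using IH(9) w insert.hyps(2) insert.prems(2,3) by (auto simp: strict_mono_on_def)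
    define c where "c = (\<rho> w - b) / (\<sigma> w - a)"
    have c: "0 < c" "c * (\<sigma> w - a) = \<rho> w - b" using aw by (auto simp: c_def)
    \<comment> \<open>The old map up to a, then slope c, then slope 1, written as a sum of clamped
      terms: strict monotonicity and continuity are checked term by term, without gluing.\<close>
    define \<mu>' where "\<mu>' s = \<mu> (min s a) + c * (min (max s a) (\<sigma> w) - a) + (max s (\<sigma> w) - \<sigma> w)" for s
    have small: "\<mu>' s = \<mu> s" if "s \<le> a" for s
      using that aw by (simp add: \<mu>'_def min_def max_def)
    have mid: "\<mu>' s = b + c * (s - a)" if "a \<le> s" "s \<le> \<sigma> w" for s
      using that aw IH(7) by (auto simp: \<mu>'_def min_def max_def)
    have big: "\<mu>' s = \<rho> w + (s - \<sigma> w)" if "\<sigma> w \<le> s" for s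
      using that aw IH(7) c(2) by (auto simp: \<mu>'_def min_def max_def)
    have "strict_mono_on {0..} \<mu>'"
    proof (rule strict_mono_onI)
      fix s t :: real assume st: "s \<in> {0..}" "t \<in> {0..}" "s < t"
      have 1: "\<mu> (min s a) \<le> \<mu> (min t a)" "s < a \<Longrightarrow> \<mu> (min s a) < \<mu> (min t a)"
        using IH(2) st IH(6) strict_mono_on_leD[OF IH(2), of "min s a" "min t a"]
          strict_mono_onD[OF IH(2), of "min s a" "min t a"] by auto
      have 2: "c * (min (max s a) (\<sigma> w) - a) \<le> c * (min (max t a) (\<sigma> w) - a)"
        "a \<le> s \<Longrightarrow> s < \<sigma> w \<Longrightarrow> c * (min (max s a) (\<sigma> w) - a) < c * (min (max t a) (\<sigma> w) - a)"
        using c(1) st aw by (auto intro!: mult_left_mono mult_strict_left_mono)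
      have 3: "max s (\<sigma> w) - \<sigma> w \<le> max t (\<sigma> w) - \<sigma> w" "\<sigma> w \<le> s \<Longrightarrow> max s (\<sigma> w) - \<sigma> w < max t (\<sigma> w) - \<sigma> w"
        using st by auto
      show "\<mu>' s < \<mu>' t"
        using 1 2 3 unfolding \<mu>'_def by (cases "s < a"; cases "s < \<sigma> w") (auto simp: not_less)
    qed
    moreover have "continuous_on {0..} \<mu>'"
      unfolding \<mu>'_def
      by (intro continuous_intros continuous_on_compose2[OF IH(3)]) (use IH(6) in auto)
    moreover have "\<mu>' (\<sigma> v) = \<rho> v" if "v \<in> insert w V" for v
      using that big[of "\<sigma> w"] small[OF IH(8)] IH(4) by auto
    moreover have "\<bar>\<mu>' s - s\<bar> \<le> \<delta>" if s: "0 \<le> s" for s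
    proof -
      consider "s \<le> a" | "a \<le> s" "s \<le> \<sigma> w" | "\<sigma> w \<le> s" by linarith
      then show ?thesis
      proof cases
        case 2
        have ba: "\<bar>b - a\<bar> \<le> \<delta>" using IH(5)[OF IH(6)] IH(7) by simp
        define \<theta> where "\<theta> = (s - a) / (\<sigma> w - a)"
        have th: "0 \<le> \<theta>" "\<theta> \<le> 1" "\<theta> * (\<sigma> w - a) = s - a" using 2 aw by (auto simp: \<theta>_def)
        have "c * (s - a) = \<theta> * (\<rho> w - b)" unfolding th(3)[symmetric] c(2)[symmetric] by simp
        then have "\<mu>' s - s = (1 - \<theta>) * (b - a) + \<theta> * (\<rho> w - \<sigma> w)"
          using mid[OF 2] th(3) by (simp add: algebra_simps)
        also have "\<bar>\<dots>\<bar> \<le> (1 - \<theta>) * \<delta> + \<theta> * \<delta>"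
          using th ba w(3) by (intro order_trans[OF abs_triangle_ineq] add_mono) (auto simp: abs_mult intro!: mult_left_mono)
        finally show ?thesis by (simp add: algebra_simps)
      qed (use small big IH(5) w s in auto)
    qed
    moreover have "\<mu>' 0 = 0" using small[of 0] IH(1,6) by simp
    moreover have "\<mu>' (\<sigma> w) = \<rho> w" using big[of "\<sigma> w"] by simp
    moreover have "\<forall>v\<in>insert w V. \<sigma> v \<le> \<sigma> w" using IH(8) aw by force
    ultimately show ?case
      using w by (intro exI[of _ \<mu>'] exI[of _ "\<sigma> w"] exI[of _ "\<rho> w"]) auto
  qed
  then obtain \<mu> where \<mu>: "\<mu> 0 = 0" "strict_mono_on {0..} \<mu>" "continuous_on {0..} \<mu>"
    "\<And>v. v \<in> V \<Longrightarrow> \<mu> (\<sigma> v) = \<rho> v" "\<And>s. 0 \<le> s \<Longrightarrow> \<bar>\<mu> s - s\<bar> \<le> \<delta>" by blast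
  have "filterlim \<mu> at_top at_top"
  proof (rule filterlim_at_top_mono)
    show "filterlim (\<lambda>s. - \<delta> + s) at_top at_top"
      by (rule filterlim_tendsto_add_at_top[OF tendsto_const filterlim_ident])
    show "\<forall>\<^sub>F s in at_top. - \<delta> + s \<le> \<mu> s"
      using eventually_ge_at_top[of 0] by eventually_elim (use \<mu>(5) in \<open>force simp: abs_le_iff\<close>)
  qed
  then show ?thesis using \<mu> by (intro bexI[of _ \<mu>]) (auto simp: time_changes_def)
qed

text \<open>The second component, a code of the range of \<open>x\<close>, tells apart the ways in which a jump larger than
  1 may split into several jumps within one grid cell.\<close>

definition pattern :: "nat \<Rightarrow> (real \<Rightarrow> nat) \<Rightarrow> nat list \<times> nat" where
  "pattern n x = (map (\<lambda>j. x (real j / 2 ^ n)) [0..<Suc (n * 2 ^ n)], set_encode (x ` {0..real n}))"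

lemma finite_range_counting_path:
  assumes "counting_path x" shows "finite (x ` {0..t})"
  by (rule finite_subset[of _ "{..x t}"]) (auto intro: counting_path_mono[OF assms])

lemma pattern_eqD:
  assumes "counting_path x" "counting_path y" and eq: "pattern n y = pattern n x"
  shows "y ` {0..real n} = x ` {0..real n}" and "j \<le> n * 2 ^ n \<Longrightarrow> y (real j / 2 ^ n) = x (real j / 2 ^ n)"
proof -
  show "y ` {0..real n} = x ` {0..real n}"
    using eq finite_range_counting_path[OF assms(1)] finite_range_counting_path[OF assms(2)]
    unfolding pattern_def prod.inject by (metis set_encode_inverse)
  show "y (real j / 2 ^ n) = x (real j / 2 ^ n)" if "j \<le> n * 2 ^ n"
    using eq that by (auto simp: pattern_def simp del: upt_Suc)
qed

text \<open>Round the passage time of x up to the next grid point; there y agrees with x and so has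
  reached v. The other inequality is the same lemma with x and y exchanged.\<close>

lemma passage_close:
  assumes x: "counting_path x" and y: "counting_path y" and eq: "pattern n y = pattern n x"
    and v: "0 < v" "v \<le> x (real n)"
  shows "first_passage (\<lambda>t. real (y t)) (real v) \<le> first_passage (\<lambda>t. real (x t)) (real v) + 1 / 2 ^ n"
proof -
  let ?\<sigma> = "first_passage (\<lambda>t. real (x t)) (real v)"
  note fx = first_passage_le_iff[OF inc_path_of_counting_path[OF x], of "real n" "real v", simplified, OF v(2)]
  have yn: "y (real n) = x (real n)" using pattern_eqD(2)[OF x y eq, of "n * 2 ^ n"] by simp
  note fy = first_passage_le_iff[OF inc_path_of_counting_path[OF y], of "real n" "real v", simplified, unfolded yn, OF v(2)]
  have s: "0 < ?\<sigma>" "?\<sigma> \<le> real n"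
    using first_passage_bounds[OF inc_path_of_counting_path[OF x], of "real n" "real v"] v by auto
  define j where "j = nat \<lceil>?\<sigma> * 2 ^ n\<rceil>"
  have pos: "0 \<le> ?\<sigma> * 2 ^ n" using s by simp
  have j: "?\<sigma> * 2 ^ n \<le> real j" "real j \<le> ?\<sigma> * 2 ^ n + 1"
    unfolding j_def using pos by linarith+
  have "\<lceil>?\<sigma> * 2 ^ n\<rceil> \<le> int (n * 2 ^ n)" unfolding ceiling_le_iff using s by simp
  then have jn: "j \<le> n * 2 ^ n" using s unfolding j_def by simp
  have "?\<sigma> \<le> real j / 2 ^ n" using j(1) by (simp add: field_simps)
  then have "v \<le> y (real j / 2 ^ n)" using fx[of "real j / 2 ^ n"] pattern_eqD(2)[OF x y eq jn] by simp
  then have "first_passage (\<lambda>t. real (y t)) (real v) \<le> real j / 2 ^ n" using fy[of "real j / 2 ^ n"] by simp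
  also have "\<dots> \<le> ?\<sigma> + 1 / 2 ^ n" using j(2) by (simp add: field_simps)
  finally show ?thesis .
qed

text \<open>The time change carries the passage times of x to those of y. Only attained values serve
  as levels, because levels skipped in one jump share a passage time; equality of the ranges
  provides the same levels for both paths. The last unit of time is given up since the time change
  may move s to the right by as much as \<open>1 / 2 ^ n\<close>.\<close>

lemma pattern_time_change:
  assumes x: "counting_path x" and y: "counting_path y" and eq: "pattern n y = pattern n x"
  shows "\<exists>\<mu>\<in>time_changes. (\<forall>s\<ge>0. \<bar>\<mu> s - s\<bar> \<le> 1 / 2 ^ n) \<and> (\<forall>s\<in>{0..real n - 1}. y (\<mu> s) = x s)"
proof -
  define V where "V = x ` {0..real n} - {0}"
  define \<sigma> where "\<sigma> v = first_passage (\<lambda>t. real (x t)) (real v)" for v :: nat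
  define \<rho> where "\<rho> v = first_passage (\<lambda>t. real (y t)) (real v)" for v :: nat
  note img = pattern_eqD(1)[OF x y eq]
  have yn: "y (real n) = x (real n)" using pattern_eqD(2)[OF x y eq, of "n * 2 ^ n"] by simp
  have V: "0 < v" "v \<le> x (real n)" if "v \<in> V" for v
    using that counting_path_mono[OF x] by (auto simp: V_def)
  have fs: "\<sigma> v \<le> r \<longleftrightarrow> v \<le> x r" and fr: "\<rho> v \<le> r \<longleftrightarrow> v \<le> y r" if "v \<in> V" "0 \<le> r" for v r
    using first_passage_le_iff[OF inc_path_of_counting_path[OF x], of "real n" "real v" r]
      first_passage_le_iff[OF inc_path_of_counting_path[OF y], of "real n" "real v" r] V[OF that(1)] that(2)
    by (auto simp: \<sigma>_def \<rho>_def yn)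
  have pos: "0 < \<sigma> v" "0 < \<rho> v" if "v \<in> V" for v
    using first_passage_bounds(1)[OF inc_path_of_counting_path[OF x], of "real n" "real v"]
      first_passage_bounds(1)[OF inc_path_of_counting_path[OF y], of "real n" "real v"] V[OF that]
    by (auto simp: \<sigma>_def \<rho>_def yn)
  have sm: "strict_mono_on V \<sigma>"
  proof (rule strict_mono_onI)
    fix v w assume vw: "v \<in> V" "w \<in> V" "v < w"
    then obtain s where "0 \<le> s" "x s = v" by (auto simp: V_def)
    then show "\<sigma> v < \<sigma> w" using fs[OF vw(1), of s] fs[OF vw(2), of s] vw(3) by auto
  qed
  have rm: "strict_mono_on V \<rho>"
  proof (rule strict_mono_onI)
    fix v w assume vw: "v \<in> V" "w \<in> V" "v < w"
    then have "v \<in> y ` {0..real n}" unfolding img by (auto simp: V_def)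
    then obtain s where "0 \<le> s" "y s = v" by auto
    then show "\<rho> v < \<rho> w" using fr[OF vw(1), of s] fr[OF vw(2), of s] vw(3) by auto
  qed
  have close: "\<bar>\<rho> v - \<sigma> v\<bar> \<le> 1 / 2 ^ n" if "v \<in> V" for v
    using passage_close[OF x y eq V[OF that]] passage_close[OF y x eq[symmetric] V(1)[OF that]] V(2)[OF that]
    by (auto simp: \<sigma>_def \<rho>_def yn abs_le_iff)
  have finV: "finite V" using finite_range_counting_path[OF x] by (simp add: V_def)
  obtain \<mu> where \<mu>: "\<mu> \<in> time_changes" "\<And>v. v \<in> V \<Longrightarrow> \<mu> (\<sigma> v) = \<rho> v" "\<And>s. 0 \<le> s \<Longrightarrow> \<bar>\<mu> s - s\<bar> \<le> 1 / 2 ^ n"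
    using time_change_interpolation[OF finV _ sm rm, of "1 / 2 ^ n"] pos close by auto
  have mm: "strict_mono_on {0..} \<mu>" "\<mu> 0 = 0" using \<mu>(1) by (auto simp: time_changes_def)
  have "y (\<mu> s) = x s" if s: "s \<in> {0..real n - 1}" for s
  proof -
    have m0: "0 \<le> \<mu> s" using strict_mono_on_leD[OF mm(1), of 0 s] mm(2) s by auto
    have "(1::real) / 2 ^ n \<le> 1" by simp
    moreover have "\<mu> s - s \<le> 1 / 2 ^ n" using \<mu>(3)[of s] s by (simp add: abs_le_iff)
    moreover have "s \<le> real n - 1" using s by simp
    ultimately have mn: "\<mu> s \<le> real n" by linarith
    have le: "\<rho> v \<le> \<mu> s \<longleftrightarrow> \<sigma> v \<le> s" if "v \<in> V" for v
      using strict_mono_on_leD[OF mm(1), of "\<sigma> v" s] strict_mono_onD[OF mm(1), of s "\<sigma> v"] \<mu>(2)[OF that] pos[OF that] s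
      by (auto simp: not_less[symmetric])
    show ?thesis
    proof (rule antisym)
      have "x s = 0 \<or> x s \<in> V" using s by (auto simp: V_def)
      then show "x s \<le> y (\<mu> s)" using fs[of "x s" s] fr[of "x s" "\<mu> s"] le s m0 by auto
      have "y (\<mu> s) \<in> y ` {0..real n}" using m0 mn by auto
      then have "y (\<mu> s) = 0 \<or> y (\<mu> s) \<in> V" unfolding img by (auto simp: V_def)
      then show "y (\<mu> s) \<le> x s" using fs[of "y (\<mu> s)" s] fr[of "y (\<mu> s)" "\<mu> s"] le s m0 by auto
    qed
  qed
  then show ?thesis using \<mu> by (intro bexI[of _ \<mu>]) auto
qed

text \<open>One sequence of time changes serves all horizons T, because the horizon
  \<open>n - 1\<close> of the n-th one grows with n.\<close>

lemma pattern_J1_converges: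
  assumes x: "counting_path x" and y: "\<And>n. counting_path (y n)" and eq: "\<And>n. pattern n (y n) = pattern n x"
  shows "J1_converges (\<lambda>n. real_path (y n)) (real_path x)"
proof -
  have "\<forall>n. \<exists>\<mu>. \<mu> \<in> time_changes \<and> (\<forall>s\<ge>0. \<bar>\<mu> s - s\<bar> \<le> 1 / 2 ^ n) \<and> (\<forall>s\<in>{0..real n - 1}. y n (\<mu> s) = x s)"
    using pattern_time_change[OF x y eq] by blast
  then obtain \<mu> where \<mu>: "\<And>n. \<mu> n \<in> time_changes" "\<And>n s. 0 \<le> s \<Longrightarrow> \<bar>\<mu> n s - s\<bar> \<le> 1 / 2 ^ n"
    "\<And>n s. s \<in> {0..real n - 1} \<Longrightarrow> y n (\<mu> n s) = x s" by metis
  have pos: "0 \<le> \<mu> n s" if "0 \<le> s" for n s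
    using strict_mono_on_leD[of "{0..}" "\<mu> n" 0 s] \<mu>(1)[of n] that by (auto simp: time_changes_def)
  show ?thesis
    unfolding J1_converges_def
  proof (intro exI[of _ \<mu>] conjI allI \<mu>(1))
    show "uniform_limit {0..} \<mu> (\<lambda>s. s) sequentially"
    proof (rule uniform_limitI)
      fix e :: real assume "0 < e"
      have "(\<lambda>n. (1 / 2) ^ n :: real) \<longlonglongrightarrow> 0" by (rule LIMSEQ_realpow_zero) auto
      from order_tendstoD(2)[OF this \<open>0 < e\<close>]
      show "\<forall>\<^sub>F n in sequentially. \<forall>s\<in>{0..}. dist (\<mu> n s) s < e"
      proof (rule eventually_mono)
        fix n assume "(1 / 2 :: real) ^ n < e"
        show "\<forall>s\<in>{0..}. dist (\<mu> n s) s < e"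
        proof
          fix s :: real assume "s \<in> {0..}"
          then have "\<bar>\<mu> n s - s\<bar> \<le> 1 / 2 ^ n" by (intro \<mu>(2)) simp
          also have "\<dots> = (1 / 2) ^ n" by (simp add: power_divide)
          also have "\<dots> < e" by fact
          finally show "dist (\<mu> n s) s < e" by (simp add: dist_real_def)
        qed
      qed
    qed
    show "uniform_limit {0..T} (\<lambda>n s. real_path (y n) (\<mu> n s)) (real_path x) sequentially" for T
    proof (rule uniform_limitI)
      fix e :: real assume "0 < e"
      have "\<forall>\<^sub>F n in sequentially. T + 1 \<le> real n" by (rule eventually_sequentiallyI[of "nat \<lceil>T + 1\<rceil>"]) linarith
      then show "\<forall>\<^sub>F n in sequentially. \<forall>s\<in>{0..T}. dist (real_path (y n) (\<mu> n s)) (real_path x s) < e"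
        by (rule eventually_mono) (use \<mu>(3) pos \<open>0 < e\<close> in \<open>auto simp: real_path_def\<close>)
    qed
  qed
qed

text \<open>Open sets are known only through sequences, so uniformity in y is drawn from a single
  sequence: at each n an offending path if there is one, and x itself otherwise. It converges to x,
  hence from some n on there are no offenders.\<close>

lemma eventually_pattern_in_open:
  assumes U: "J1_open U" and x: "counting_path x" "real_path x \<in> U"
  shows "\<forall>\<^sub>F n in sequentially. \<forall>y. counting_path y \<longrightarrow> pattern n y = pattern n x \<longrightarrow> real_path y \<in> U"
proof -
  define bad where "bad n y \<longleftrightarrow> counting_path y \<and> pattern n y = pattern n x \<and> real_path y \<notin> U" for n y
  define z where "z n = (if \<exists>y. bad n y then SOME y. bad n y else x)" for n
  have bad: "bad n (z n)" if "\<exists>y. bad n y" for n using someI_ex[OF that] that by (simp add: z_def)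
  have z: "counting_path (z n)" "pattern n (z n) = pattern n x" for n
    using bad[of n] x by (cases "\<exists>y. bad n y"; auto simp: bad_def z_def)+
  have "\<forall>xs. (\<forall>n. xs n \<in> cadlag) \<longrightarrow> J1_converges xs (real_path x) \<longrightarrow> (\<forall>\<^sub>F n in sequentially. xs n \<in> U)"
    using U x(2) by (auto simp: J1_open_def)
  from this[rule_format, of "\<lambda>n. real_path (z n)"]
  have "\<forall>\<^sub>F n in sequentially. real_path (z n) \<in> U"
    using real_path_cadlag[OF z(1)] pattern_J1_converges[OF x(1) z] by simp
  then show ?thesis
    by (rule eventually_mono) (use bad in \<open>auto simp: bad_def\<close>)
qed

section \<open>Measurability of patterns and paths\<close>

lemma counting_path_range_rat:
  assumes x: "counting_path x"
  shows "x ` {0..real n} = {k. \<exists>q\<in>\<rat> \<inter> {0..real n}. x q = k}"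
proof (intro set_eqI iffI)
  fix k assume "k \<in> x ` {0..real n}"
  then obtain t where t: "0 \<le> t" "t \<le> real n" "x t = k" by auto
  show "k \<in> {k. \<exists>q\<in>\<rat> \<inter> {0..real n}. x q = k}"
  \<comment> \<open>By right continuity a value persists up to some rational to the right. Only at
    the right end would that rational leave the interval, and \<open>real n\<close> is rational
    itself.\<close>
  proof (cases "t = real n")
    case True
    then show ?thesis using t by (intro CollectI bexI[of _ "real n"]) auto
  next
    case False
    obtain b where b: "t < b" "\<And>s. t \<le> s \<Longrightarrow> s < b \<Longrightarrow> x s = x t"
      using counting_path_right[OF x t(1)] by blast
    obtain q where q: "q \<in> \<rat>" "t < q" "q < min b (real n)"
      using Rats_dense_in_real[of t "min b (real n)"] b False t by auto
    then show ?thesis using t b(2)[of q] by (intro CollectI bexI[of _ q]) auto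
  qed
next
  fix k assume "k \<in> {k. \<exists>q\<in>\<rat> \<inter> {0..real n}. x q = k}"
  then show "k \<in> x ` {0..real n}" by blast
qed

text \<open>Patterns form a countable type, so single patterns suffice. The range is observed at
  rational times, and \<open>set_decode\<close> turns equality of codes into a countable conjunction
  of membership conditions.\<close>

lemma measurable_pattern:
  assumes cp: "\<And>\<omega>. \<omega> \<in> space M \<Longrightarrow> counting_path (X \<omega>)"
    and meas: "\<And>t. 0 \<le> t \<Longrightarrow> (\<lambda>\<omega>. X \<omega> t) \<in> M \<rightarrow>\<^sub>M count_space UNIV"
  shows "(\<lambda>\<omega>. pattern n (X \<omega>)) \<in> M \<rightarrow>\<^sub>M count_space UNIV"
proof (subst measurable_count_space_eq2_countable, intro conjI ballI)
  fix p :: "nat list \<times> nat"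
  have ev: "{\<omega> \<in> space M. X \<omega> t = k} \<in> sets M" if "0 \<le> t" for t k
    using measurable_sets[OF meas[OF that], of "{k}"] by (simp add: vimage_def Int_def conj_commute)
  have a: "{\<omega> \<in> space M. \<exists>q\<in>\<rat> \<inter> {0..real n}. X \<omega> q = k} \<in> sets M" for k
  proof -
    have "(\<Union>q\<in>\<rat> \<inter> {0..real n}. {\<omega> \<in> space M. X \<omega> q = k}) \<in> sets M"
      by (intro sets.countable_UN') (auto intro: ev countable_Int1 countable_rat)
    also have "(\<Union>q\<in>\<rat> \<inter> {0..real n}. {\<omega> \<in> space M. X \<omega> q = k}) = {\<omega> \<in> space M. \<exists>q\<in>\<rat> \<inter> {0..real n}. X \<omega> q = k}"
      by auto
    finally show ?thesis .
  qed
  have a2: "{\<omega> \<in> space M. (\<exists>q\<in>\<rat> \<inter> {0..real n}. X \<omega> q = k) = c} \<in> sets M" for k c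
    using a[of k] sets.sets_Collect_neg[OF a[of k]] by (cases c) simp_all
  have "{\<omega> \<in> space M. length (fst p) = Suc (n * 2 ^ n) \<and> (\<forall>j\<in>{..<Suc (n * 2 ^ n)}. X \<omega> (real j / 2 ^ n) = fst p ! j)
     \<and> (\<forall>k. (\<exists>q\<in>\<rat> \<inter> {0..real n}. X \<omega> q = k) \<longleftrightarrow> k \<in> set_decode (snd p))} \<in> sets M"
    by (intro sets.sets_Collect_conj sets.sets_Collect_const sets.sets_Collect_finite_All' sets.sets_Collect_countable_All
        a2 ev) auto
  also have "{\<omega> \<in> space M. length (fst p) = Suc (n * 2 ^ n) \<and> (\<forall>j\<in>{..<Suc (n * 2 ^ n)}. X \<omega> (real j / 2 ^ n) = fst p ! j)
     \<and> (\<forall>k. (\<exists>q\<in>\<rat> \<inter> {0..real n}. X \<omega> q = k) \<longleftrightarrow> k \<in> set_decode (snd p))}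
    = (\<lambda>\<omega>. pattern n (X \<omega>)) -` {p} \<inter> space M"
  proof (intro set_eqI)
    fix \<omega>
    have "set_encode (X \<omega> ` {0..real n}) = e \<longleftrightarrow> (\<forall>k. (\<exists>q\<in>\<rat> \<inter> {0..real n}. X \<omega> q = k) \<longleftrightarrow> k \<in> set_decode e)"
      if w: "\<omega> \<in> space M" for e
    proof -
      have "set_encode (X \<omega> ` {0..real n}) = e \<longleftrightarrow> X \<omega> ` {0..real n} = set_decode e"
        using finite_range_counting_path[OF cp[OF w]] set_encode_inverse set_decode_inverse by metis
      then show ?thesis unfolding counting_path_range_rat[OF cp[OF w]] by (auto simp: set_eq_iff)
    qed
    then show "\<omega> \<in> {\<omega> \<in> space M. length (fst p) = Suc (n * 2 ^ n) \<and> (\<forall>j\<in>{..<Suc (n * 2 ^ n)}. X \<omega> (real j / 2 ^ n) = fst p ! j)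
     \<and> (\<forall>k. (\<exists>q\<in>\<rat> \<inter> {0..real n}. X \<omega> q = k) \<longleftrightarrow> k \<in> set_decode (snd p))} \<longleftrightarrow> \<omega> \<in> (\<lambda>\<omega>. pattern n (X \<omega>)) -` {p} \<inter> space M"
      by (cases p) (auto simp: pattern_def list_eq_iff_nth_eq simp del: upt_Suc)
  qed
  finally show "(\<lambda>\<omega>. pattern n (X \<omega>)) -` {p} \<inter> space M \<in> sets M" .
qed simp_all

text \<open>By \<open>eventually_pattern_in_open\<close>, an open set meets the counting paths in a
  countable union of pattern classes. Borel measurability for \<open>J1\<close> follows directly,
  with no description of the Borel sets by coordinate projections.\<close>

lemma measurable_real_path:
  assumes cp: "\<And>\<omega>. \<omega> \<in> space M \<Longrightarrow> counting_path (X \<omega>)"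
    and meas: "\<And>t. 0 \<le> t \<Longrightarrow> (\<lambda>\<omega>. X \<omega> t) \<in> M \<rightarrow>\<^sub>M count_space UNIV"
  shows "(\<lambda>\<omega>. real_path (X \<omega>)) \<in> M \<rightarrow>\<^sub>M borel_of skorohod_J1"
  unfolding borel_of_def
proof (rule measurable_measure_of)
  show "{U. openin skorohod_J1 U} \<subseteq> Pow (topspace skorohod_J1)" using openin_subset by auto
  show "(\<lambda>\<omega>. real_path (X \<omega>)) \<in> space M \<rightarrow> topspace skorohod_J1"
    using real_path_cadlag cp by (auto simp: topspace_skorohod_J1)
  fix U assume "U \<in> {U. openin skorohod_J1 U}"
  then have U: "J1_open U" by (simp add: openin_skorohod_J1)
  define P where "P n = {p. \<forall>y. counting_path y \<longrightarrow> pattern n y = p \<longrightarrow> real_path y \<in> U}" for n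
  have "(\<lambda>\<omega>. real_path (X \<omega>)) -` U \<inter> space M = (\<Union>n. (\<lambda>\<omega>. pattern n (X \<omega>)) -` P n \<inter> space M)"
  proof (intro set_eqI iffI)
    fix \<omega> assume w: "\<omega> \<in> (\<lambda>\<omega>. real_path (X \<omega>)) -` U \<inter> space M"
    have "\<forall>\<^sub>F n in sequentially. \<forall>y. counting_path y \<longrightarrow> pattern n y = pattern n (X \<omega>) \<longrightarrow> real_path y \<in> U"
      using eventually_pattern_in_open[OF U cp] w by auto
    from eventually_happens'[OF sequentially_bot this]
    show "\<omega> \<in> (\<Union>n. (\<lambda>\<omega>. pattern n (X \<omega>)) -` P n \<inter> space M)" using w by (auto simp: P_def)
  qed (use cp in \<open>auto simp: P_def\<close>)
  also have "\<dots> \<in> sets M"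
    by (intro sets.countable_UN) (use measurable_sets[OF measurable_pattern[OF cp meas]] in auto)
  finally show "(\<lambda>\<omega>. real_path (X \<omega>)) -` U \<inter> space M \<in> sets M" .
qed

subsection \<open>Finite-dimensional distributions of the thinned process\<close>

lemma measurable_sum_count_space:
  fixes f :: "'i \<Rightarrow> 'a \<Rightarrow> nat"
  assumes "finite I" "\<And>i. i \<in> I \<Longrightarrow> f i \<in> M \<rightarrow>\<^sub>M count_space UNIV"
  shows "(\<lambda>x. \<Sum>i\<in>I. f i x) \<in> M \<rightarrow>\<^sub>M count_space UNIV"
  using assms
proof (induction I rule: finite_induct)
  case (insert i I)
  have "(\<lambda>x. f i x + (\<Sum>i\<in>I. f i x)) \<in> M \<rightarrow>\<^sub>M count_space UNIV"
    by (rule measurable_compose_countable[where f = "\<lambda>k x. k + (\<Sum>i\<in>I. f i x)"])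
       (use insert in \<open>auto intro!: measurable_compose[where g = "\<lambda>m. _ + m"]\<close>)
  then show ?case using insert.hyps by simp
qed simp

lemma (in prob_space) indep_vars_block_sums:
  fixes b :: "'i \<Rightarrow> 'a \<Rightarrow> nat"
  assumes "indep_vars (\<lambda>_. count_space UNIV) b I" "\<And>j. j \<in> L \<Longrightarrow> K j \<subseteq> I" "\<And>j. j \<in> L \<Longrightarrow> finite (K j)"
    and "disjoint_family_on K L"
  shows "indep_vars (\<lambda>_. count_space UNIV) (\<lambda>j \<omega>. \<Sum>i\<in>K j. b i \<omega>) L"
proof -
  have "indep_vars (\<lambda>_. count_space UNIV) (\<lambda>j \<omega>. (\<lambda>f. \<Sum>i\<in>K j. f i) (restrict (\<lambda>i. b i \<omega>) (K j))) L"
    by (rule indep_vars_compose2[OF indep_vars_restrict[OF assms(1,2,4)]])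
       (auto intro!: measurable_sum_count_space assms(3) measurable_component_singleton)
  then show ?thesis by simp
qed

lemma (in prob_space) iid_bernoulli_probs:
  assumes iid: "iid_bernoulli M p b" and p: "0 \<le> p" "p \<le> 1" and i: "1 \<le> i"
  shows "b i \<in> M \<rightarrow>\<^sub>M count_space UNIV"
    and "prob {\<omega> \<in> space M. b i \<omega> = 0} = 1 - p" "prob {\<omega> \<in> space M. b i \<omega> = 1} = p"
    and "AE \<omega> in M. b i \<omega> = 0 \<or> b i \<omega> = 1"
proof -
  show m: "b i \<in> M \<rightarrow>\<^sub>M count_space UNIV"
    using iid i by (auto simp: iid_bernoulli_def indep_vars_def)
  have d: "distr M (count_space UNIV) (b i) = measure_pmf (map_pmf of_bool (bernoulli_pmf p))"
    using iid i by (auto simp: iid_bernoulli_def)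
  have pr: "prob {\<omega> \<in> space M. b i \<omega> \<in> S} = measure (measure_pmf (map_pmf of_bool (bernoulli_pmf p))) S" for S
    unfolding d[symmetric] using m by (subst measure_distr) (auto simp: vimage_def Int_def conj_commute)
  have inj: "inj (of_bool :: bool \<Rightarrow> nat)" by (auto simp: inj_def)
  have v: "pmf (map_pmf of_bool (bernoulli_pmf p)) (of_bool c :: nat) = pmf (bernoulli_pmf p) c" for c
    by (rule pmf_map_inj'[OF inj])
  show "prob {\<omega> \<in> space M. b i \<omega> = 0} = 1 - p" "prob {\<omega> \<in> space M. b i \<omega> = 1} = p"
    using pr[of "{0}"] pr[of "{1}"] v[of False] v[of True] p by (simp_all add: measure_pmf_single)
  have "AE x in distr M (count_space UNIV) (b i). x = 0 \<or> x = 1"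
    unfolding d by (auto simp: AE_measure_pmf_iff)
  then show "AE \<omega> in M. b i \<omega> = 0 \<or> b i \<omega> = 1"
    using m by (subst (asm) AE_distr_iff) auto
qed

lemma (in prob_space) iid_bernoulli_sum:
  assumes iid: "iid_bernoulli M p b" and p: "0 \<le> p" "p \<le> 1" and I: "finite I" "I \<subseteq> {1..}"
  shows "prob {\<omega> \<in> space M. (\<Sum>i\<in>I. b i \<omega>) = k} = pmf (binomial_pmf (card I) p) k"
  using I
proof (induction I arbitrary: k rule: finite_induct)
  case empty
  show ?case using p by (cases k) (auto simp: prob_space)
next
  case (insert i I)
  let ?S = "\<lambda>\<omega>. \<Sum>i\<in>I. b i \<omega>"
  let ?n = "card I"
  have i: "1 \<le> i" and IH: "\<And>k. prob {\<omega> \<in> space M. ?S \<omega> = k} = pmf (binomial_pmf ?n p) k"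
    using insert by auto
  note bi = iid_bernoulli_probs[OF iid p i]
  have ind: "indep_vars (\<lambda>_. count_space UNIV) b {1..}" using iid by (simp add: iid_bernoulli_def)
  \<comment> \<open>Two blocks indexed by a Boolean, the new index and the old ones, so that block
    sums give independence of the new summand from the partial sum.\<close>
  have "indep_vars (\<lambda>_. count_space UNIV) (\<lambda>j \<omega>. \<Sum>i\<in>(if j then {i} else I). b i \<omega>) (UNIV :: bool set)"
    using insert by (intro indep_vars_block_sums[OF ind]) (auto simp: disjoint_family_on_def)
  from indep_varsD_finite[OF this, of "\<lambda>j. if j then {_} else {_}"]
  have joint: "prob {\<omega> \<in> space M. b i \<omega> = x \<and> ?S \<omega> = y} = prob {\<omega> \<in> space M. b i \<omega> = x} * prob {\<omega> \<in> space M. ?S \<omega> = y}" for x y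
    by (simp add: UNIV_bool vimage_def Int_def conj_ac)
  have mS: "?S \<in> M \<rightarrow>\<^sub>M count_space UNIV"
    using insert iid_bernoulli_probs(1)[OF iid p] by (intro measurable_sum_count_space) auto
  have ev: "{\<omega> \<in> space M. b i \<omega> = x \<and> ?S \<omega> = y} \<in> events" for x y
  proof -
    have "b i -` {x} \<inter> space M \<inter> (?S -` {y} \<inter> space M) \<in> events"
      by (intro sets.Int measurable_sets[OF bi(1)] measurable_sets[OF mS]) auto
    also have "b i -` {x} \<inter> space M \<inter> (?S -` {y} \<inter> space M) = {\<omega> \<in> space M. b i \<omega> = x \<and> ?S \<omega> = y}" by auto
    finally show ?thesis .
  qed
  have evk: "{\<omega> \<in> space M. (\<Sum>i\<in>insert i I. b i \<omega>) = k} \<in> events"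
  proof -
    have "(\<lambda>\<omega>. \<Sum>i\<in>insert i I. b i \<omega>) \<in> M \<rightarrow>\<^sub>M count_space UNIV"
      using insert iid_bernoulli_probs(1)[OF iid p] by (intro measurable_sum_count_space) auto
    from measurable_sets[OF this, of "{k}"] show ?thesis by (simp add: vimage_def Int_def conj_commute)
  qed
  show ?case
  proof (cases k)
    case 0
    have "prob {\<omega> \<in> space M. (\<Sum>i\<in>insert i I. b i \<omega>) = k} = prob {\<omega> \<in> space M. b i \<omega> = 0 \<and> ?S \<omega> = 0}"
      using insert by (simp add: 0)
    also have "\<dots> = (1 - p) * pmf (binomial_pmf ?n p) 0" by (simp only: joint bi IH)
    finally show ?thesis using insert p by (simp add: 0)
  next
    case (Suc l)
    have "prob {\<omega> \<in> space M. (\<Sum>i\<in>insert i I. b i \<omega>) = k}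
      = prob ({\<omega> \<in> space M. b i \<omega> = 0 \<and> ?S \<omega> = Suc l} \<union> {\<omega> \<in> space M. b i \<omega> = 1 \<and> ?S \<omega> = l})"
    proof (rule finite_measure_eq_AE)
      show "AE \<omega> in M. (\<omega> \<in> {\<omega> \<in> space M. (\<Sum>i\<in>insert i I. b i \<omega>) = k}) =
        (\<omega> \<in> {\<omega> \<in> space M. b i \<omega> = 0 \<and> ?S \<omega> = Suc l} \<union> {\<omega> \<in> space M. b i \<omega> = 1 \<and> ?S \<omega> = l})"
        using bi(4) by eventually_elim (use insert in \<open>auto simp: Suc\<close>)
    qed (use ev evk in auto)
    also have "\<dots> = prob {\<omega> \<in> space M. b i \<omega> = 0 \<and> ?S \<omega> = Suc l} + prob {\<omega> \<in> space M. b i \<omega> = 1 \<and> ?S \<omega> = l}"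
      by (rule finite_measure_Union) (use ev in auto)
    also have "\<dots> = (1 - p) * pmf (binomial_pmf ?n p) (Suc l) + p * pmf (binomial_pmf ?n p) l"
      by (simp add: joint bi[simplified] IH)
    also have "\<dots> = pmf (binomial_pmf (Suc ?n) p) (Suc l)"
    \<comment> \<open>The exponents \<open>?n - l\<close> and \<open>?n - Suc l\<close> differ by 1
      only when the subtraction is not truncated; otherwise \<open>?n choose Suc l\<close>
      vanishes.\<close>
    proof (cases "Suc l \<le> ?n")
      case True
      then have "?n - l = Suc (?n - Suc l)" by simp
      then show ?thesis using p by (simp add: algebra_simps)
    next
      case False
      then show ?thesis using p by (auto simp: binomial_eq_0 not_le less_Suc_eq)
    qed
    finally show ?thesis using insert Suc by simp
  qed
qed

text \<open>Conditioning on a discrete variable without conditional probabilities: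
  \<open>g y\<close> plays the probability of \<open>Q y\<close> given \<open>Y = y\<close>, and the
  product form of the hypothesis leaves it free, within its bounds, at values of probability
  0.\<close>

lemma (in prob_space) prob_mixture:
  fixes Y :: "'a \<Rightarrow> 'c :: countable" and g :: "'c \<Rightarrow> real"
  assumes Y: "Y \<in> M \<rightarrow>\<^sub>M count_space UNIV"
    and Q: "\<And>y. Q y \<in> events" "\<And>y. prob ({\<omega> \<in> space M. Y \<omega> = y} \<inter> Q y) = prob {\<omega> \<in> space M. Y \<omega> = y} * g y"
    and g: "\<And>y. 0 \<le> g y" "\<And>y. g y \<le> B"
  shows "prob {\<omega> \<in> space M. \<omega> \<in> Q (Y \<omega>)} = expectation (\<lambda>\<omega>. g (Y \<omega>))"
    and "{\<omega> \<in> space M. \<omega> \<in> Q (Y \<omega>)} \<in> events"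
proof -
  have Ye: "{\<omega> \<in> space M. Y \<omega> = y} \<in> events" for y
    using measurable_sets[OF Y, of "{y}"] by (simp add: vimage_def Int_def conj_commute)
  have U: "{\<omega> \<in> space M. \<omega> \<in> Q (Y \<omega>)} = (\<Union>y. {\<omega> \<in> space M. Y \<omega> = y} \<inter> Q y)" by auto
  show "{\<omega> \<in> space M. \<omega> \<in> Q (Y \<omega>)} \<in> events"
    unfolding U using Ye Q(1) by (intro sets.countable_UN') auto
  have gm: "(\<lambda>\<omega>. g (Y \<omega>)) \<in> borel_measurable M" using Y by measurable
  have "emeasure M {\<omega> \<in> space M. \<omega> \<in> Q (Y \<omega>)} = (\<integral>\<^sup>+y. emeasure M ({\<omega> \<in> space M. Y \<omega> = y} \<inter> Q y) \<partial>count_space UNIV)"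
    unfolding U using Ye Q(1) by (intro emeasure_UN_countable) (auto simp: disjoint_family_on_def)
  also have "\<dots> = (\<integral>\<^sup>+y. \<integral>\<^sup>+\<omega>. ennreal (g y) * indicator {\<omega> \<in> space M. Y \<omega> = y} \<omega> \<partial>M \<partial>count_space UNIV)"
    using Ye g(1) by (intro nn_integral_cong) (simp add: emeasure_eq_measure Q(2) ennreal_mult nn_integral_cmult mult.commute)
  also have "\<dots> = (\<integral>\<^sup>+\<omega>. \<integral>\<^sup>+y. ennreal (g y) * indicator {\<omega> \<in> space M. Y \<omega> = y} \<omega> \<partial>count_space UNIV \<partial>M)"
    using Ye by (intro nn_integral_count_space_nn_integral[symmetric]) auto
  also have "\<dots> = (\<integral>\<^sup>+\<omega>. ennreal (g (Y \<omega>)) \<partial>M)"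
  proof (rule nn_integral_cong)
    fix \<omega> assume w: "\<omega> \<in> space M"
    have "(\<integral>\<^sup>+y. ennreal (g y) * indicator {\<omega> \<in> space M. Y \<omega> = y} \<omega> \<partial>count_space UNIV)
      = (\<integral>\<^sup>+y. ennreal (g (Y \<omega>)) * indicator {Y \<omega>} y \<partial>count_space UNIV)"
      using w by (intro nn_integral_cong) (auto simp: indicator_def)
    then show "(\<integral>\<^sup>+y. ennreal (g y) * indicator {\<omega> \<in> space M. Y \<omega> = y} \<omega> \<partial>count_space UNIV) = ennreal (g (Y \<omega>))"
      by simp
  qed
  also have "\<dots> = ennreal (expectation (\<lambda>\<omega>. g (Y \<omega>)))"
    using g gm by (intro nn_integral_eq_integral integrable_const_bound[of _ B]) auto
  finally show "prob {\<omega> \<in> space M. \<omega> \<in> Q (Y \<omega>)} = expectation (\<lambda>\<omega>. g (Y \<omega>))"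
    using g(1) by (simp add: emeasure_eq_measure)
qed

text \<open>Given the values of \<open>N\<close> at the times \<open>s j\<close>, the sums run over
  disjoint blocks of fixed indices and are independent binomials. \<open>prob_mixture\<close> then
  averages over these values.\<close>

lemma (in prob_space) thinned_increments_prob:
  fixes d s :: "nat \<Rightarrow> nat" and N :: "real \<Rightarrow> 'a \<Rightarrow> nat"
  assumes iid: "iid_bernoulli M p b" and p: "0 \<le> p" "p \<le> 1" and ind: "independent_of_process M b N"
    and mono: "\<And>\<omega> j. \<omega> \<in> space M \<Longrightarrow> j < J \<Longrightarrow> N (s j) \<omega> \<le> N (s (Suc j)) \<omega>"
    and meas: "\<And>t. 0 \<le> t \<Longrightarrow> N t \<in> M \<rightarrow>\<^sub>M count_space UNIV"
  defines "E \<equiv> {\<omega> \<in> space M. \<forall>j<J. (\<Sum>i\<in>{N (s j) \<omega><..N (s (Suc j)) \<omega>}. b i \<omega>) = d j}"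
  shows "prob E = expectation (\<lambda>\<omega>. \<Prod>j<J. pmf (binomial_pmf (N (s (Suc j)) \<omega> - N (s j) \<omega>) p) (d j))"
    and "E \<in> events"
proof -
  define Y where "Y \<omega> = map (\<lambda>j. N (s j) \<omega>) [0..<Suc J]" for \<omega>
  define R where "R y f \<longleftrightarrow> (\<forall>j\<in>{..<J}. (\<Sum>i\<in>{y ! j<..y ! Suc j}. f i) = d j)" for y and f :: "nat \<Rightarrow> nat"
  define Q where "Q y = {\<omega> \<in> space M. R y (\<lambda>i. b i \<omega>)}" for y
  define g where "g y = (\<Prod>j<J. pmf (binomial_pmf (y ! Suc j - y ! j) p) (d j))" for y
  have iidv: "indep_vars (\<lambda>_. count_space UNIV) b {1..}" using iid by (simp add: iid_bernoulli_def)
  have Ynth: "Y \<omega> ! j = N (s j) \<omega>" if "j \<le> J" for j \<omega> using that by (auto simp: Y_def simp del: upt_Suc)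
  have Yeq: "Y \<omega> = y \<longleftrightarrow> length y = Suc J \<and> (\<forall>j\<in>{..J}. N (s j) \<omega> = y ! j)" for \<omega> y
    by (auto simp: Y_def list_eq_iff_nth_eq simp del: upt_Suc)
  have Rmeas: "R y \<in> PiM {1..} (\<lambda>_. count_space UNIV) \<rightarrow>\<^sub>M count_space UNIV" for y
  proof -
    have "(\<lambda>f :: nat \<Rightarrow> nat. \<Sum>i\<in>{y ! j<..y ! Suc j}. f i) \<in> PiM {1..} (\<lambda>_. count_space UNIV) \<rightarrow>\<^sub>M count_space UNIV" for j
      by (rule measurable_sum_count_space[where f = "\<lambda>i f. f i"]) (auto intro!: measurable_component_singleton)
    from measurable_sets[OF this, of "{d _}"]
    have "{f :: nat \<Rightarrow> nat. f \<in> space (PiM {1..} (\<lambda>_. count_space UNIV)) \<and> (\<Sum>i\<in>{y ! j<..y ! Suc j}. f i) = d j}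
       \<in> sets (PiM {1..} (\<lambda>_. count_space UNIV))" for j
      by (simp add: vimage_def Int_def conj_commute)
    then have "{f \<in> space (PiM {1..} (\<lambda>_. count_space UNIV)). R y f} \<in> sets (PiM {1..} (\<lambda>_. count_space UNIV))"
      unfolding R_def by (intro sets.sets_Collect_finite_All) auto
    then show ?thesis by (simp add: pred_def)
  qed
  define Z where "Z y n \<longleftrightarrow> length y = Suc J \<and> (\<forall>j\<in>{..J}. n (s j) = y ! j)" for y and n :: "nat \<Rightarrow> nat"
  have Zmeas: "Z y \<in> PiM {0..} (\<lambda>_. count_space UNIV) \<rightarrow>\<^sub>M count_space UNIV" for y
  proof -
    have "{n \<in> space (PiM {0..} (\<lambda>_. count_space UNIV)). n (s j) = y ! j} \<in> sets (PiM {0..} (\<lambda>_. count_space UNIV))" for j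
      using measurable_sets[OF measurable_component_singleton[of "s j" "{0..}" "\<lambda>_. count_space UNIV"], of "{y ! j}"]
      by (simp add: vimage_def Int_def conj_commute)
    then have "{n \<in> space (PiM {0..} (\<lambda>_. count_space UNIV)). Z y n} \<in> sets (PiM {0..} (\<lambda>_. count_space UNIV))"
      unfolding Z_def by (intro sets.sets_Collect_conj sets.sets_Collect_finite_All sets.sets_Collect_const) auto
    then show ?thesis by (simp add: pred_def)
  qed
  have bm: "(\<lambda>\<omega>. \<lambda>i\<in>{1..}. b i \<omega>) \<in> M \<rightarrow>\<^sub>M PiM {1..} (\<lambda>_. count_space UNIV)"
    using iid_bernoulli_probs(1)[OF iid p] by (intro measurable_restrict) auto
  have Rb: "R y (\<lambda>i\<in>{1..}. b i \<omega>) = R y (\<lambda>i. b i \<omega>)" for y \<omega>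
    unfolding R_def by (intro ball_cong refl arg_cong2[where f = "(=)"] sum.cong) auto
  have Qev: "Q y \<in> events" for y
    using measurable_sets[OF measurable_compose[OF bm Rmeas[of y]], of "{True}"]
    unfolding Rb by (simp add: Q_def vimage_def Int_def conj_commute)
  have Ym: "Y \<in> M \<rightarrow>\<^sub>M count_space UNIV"
  proof (subst measurable_count_space_eq2_countable, intro conjI ballI)
    fix y
    have "{\<omega> \<in> space M. N (s j) \<omega> = y ! j} \<in> events" for j
      using measurable_sets[OF meas[OF of_nat_0_le_iff], of "{y ! j}" "s j"] by (simp add: vimage_def Int_def conj_commute)
    then have "{\<omega> \<in> space M. Y \<omega> = y} \<in> events"
      unfolding Yeq by (intro sets.sets_Collect_conj sets.sets_Collect_finite_All sets.sets_Collect_const) auto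
    then show "Y -` {y} \<inter> space M \<in> events" by (simp add: vimage_def Int_def conj_commute)
  qed simp_all
  \<comment> \<open>The process enters as a function on the naturals, which is why the times
    \<open>s j\<close> are natural numbers.\<close>
  have "indep_var (count_space UNIV) (R y \<circ> (\<lambda>\<omega>. \<lambda>i\<in>{1..}. b i \<omega>)) (count_space UNIV) (Z y \<circ> (\<lambda>\<omega> k. (\<lambda>t\<in>{0..}. N t \<omega>) (real k)))" for y
    using ind unfolding independent_of_process_def by (rule indep_var_compose[OF _ Rmeas Zmeas])
  from indep_varD[OF this, of "{True}" "{True}"]
  have indep: "prob {\<omega> \<in> space M. R y (\<lambda>i. b i \<omega>) \<and> Y \<omega> = y} = prob (Q y) * prob {\<omega> \<in> space M. Y \<omega> = y}" for y
    unfolding comp_def Rb by (simp add: vimage_def Int_def conj_ac Yeq Z_def Q_def)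
  have PQ: "prob (Q y) = g y" if y: "\<And>j. j < J \<Longrightarrow> y ! j \<le> y ! Suc j" for y
  \<comment> \<open>An empty intersection would be \<open>UNIV\<close> rather than the sample
    space.\<close>
  proof (cases "J = 0")
    case True
    then show ?thesis by (simp add: Q_def R_def g_def prob_space)
  next
    case False
    have le: "y ! i \<le> y ! j" if "i \<le> j" "j \<le> J" for i j
      using that by (induction j rule: dec_induct) (auto intro: order_trans[OF _ y] simp: Suc_le_eq)
    have disj: "disjoint_family_on (\<lambda>j. {y ! j<..y ! Suc j}) {..<J}"
    proof (unfold disjoint_family_on_def, intro ballI impI)
      fix i j assume ij: "i \<in> {..<J}" "j \<in> {..<J}" "i \<noteq> j"
      show "{y ! i<..y ! Suc i} \<inter> {y ! j<..y ! Suc j} = {}"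
        using le[of "Suc i" j] le[of "Suc j" i] ij by (cases "i < j") auto
    qed
    have iv: "indep_vars (\<lambda>_. count_space UNIV) (\<lambda>j \<omega>. \<Sum>i\<in>{y ! j<..y ! Suc j}. b i \<omega>) {..<J}"
      by (rule indep_vars_block_sums[OF iidv]) (use disj in auto)
    have "Q y = (\<Inter>j\<in>{..<J}. (\<lambda>\<omega>. \<Sum>i\<in>{y ! j<..y ! Suc j}. b i \<omega>) -` {d j} \<inter> space M)"
      using False by (auto simp: Q_def R_def)
    then have "prob (Q y) = (\<Prod>j<J. prob ((\<lambda>\<omega>. \<Sum>i\<in>{y ! j<..y ! Suc j}. b i \<omega>) -` {d j} \<inter> space M))"
      using indep_varsD_finite[OF iv, of "\<lambda>j. {d j}"] False by auto
    also have "\<dots> = g y"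
      unfolding g_def
    proof (rule prod.cong[OF refl])
      fix j
      have "prob {\<omega> \<in> space M. (\<Sum>i\<in>{y ! j<..y ! Suc j}. b i \<omega>) = d j} = pmf (binomial_pmf (y ! Suc j - y ! j) p) (d j)"
      proof -
        have "{y ! j<..y ! Suc j} \<subseteq> {1..}" by auto
        from iid_bernoulli_sum[OF iid p _ this, of "d j"] show ?thesis by simp
      qed
      then show "prob ((\<lambda>\<omega>. \<Sum>i\<in>{y ! j<..y ! Suc j}. b i \<omega>) -` {d j} \<inter> space M) = pmf (binomial_pmf (y ! Suc j - y ! j) p) (d j)"
        by (simp add: vimage_def Int_def conj_commute)
    qed
    finally show ?thesis .
  qed
  have split: "prob ({\<omega> \<in> space M. Y \<omega> = y} \<inter> Q y) = prob {\<omega> \<in> space M. Y \<omega> = y} * g y" for y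
  proof (cases "\<forall>j<J. y ! j \<le> y ! Suc j")
    case True
    have "{\<omega> \<in> space M. Y \<omega> = y} \<inter> Q y = {\<omega> \<in> space M. R y (\<lambda>i. b i \<omega>) \<and> Y \<omega> = y}" by (auto simp: Q_def)
    then show ?thesis using indep[of y] PQ[of y] True by simp
  next
    case False
    \<comment> \<open>A list that decreases somewhere is never a value of \<open>Y\<close>, so both
      sides vanish.\<close>
    then have empty: "{\<omega> \<in> space M. Y \<omega> = y} = {}" using mono Ynth by (force simp: Suc_le_eq)
    show ?thesis unfolding empty by simp
  qed
  have g: "0 \<le> g y" "g y \<le> 1" for y
    unfolding g_def by (auto intro!: prod_nonneg prod_le_1 simp: pmf_le_1)
  have "E = {\<omega> \<in> space M. \<omega> \<in> Q (Y \<omega>)}" using Ynth by (auto simp: E_def Q_def R_def)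
  moreover have "g (Y \<omega>) = (\<Prod>j<J. pmf (binomial_pmf (N (s (Suc j)) \<omega> - N (s j) \<omega>) p) (d j))" for \<omega>
    unfolding g_def by (intro prod.cong) (auto simp: Ynth)
  ultimately show "prob E = expectation (\<lambda>\<omega>. \<Prod>j<J. pmf (binomial_pmf (N (s (Suc j)) \<omega> - N (s j) \<omega>) p) (d j))"
    "E \<in> events"
    using prob_mixture[OF Ym Qev split g] by auto
qed

section \<open>The Poisson limit theorem in uniform form\<close>

lemma binomial_poisson_limit:
  fixes e :: "'i \<Rightarrow> real" and n :: "'i \<Rightarrow> nat"
  assumes e: "(e \<longlongrightarrow> 0) F" "\<forall>\<^sub>F i in F. 0 < e i" and ne: "((\<lambda>i. real (n i) * e i) \<longlongrightarrow> u) F"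
  shows "((\<lambda>i. real (n i choose k) * e i ^ k * (1 - e i) ^ (n i - k)) \<longlongrightarrow> u ^ k / fact k * exp (- u)) F"
proof -
  \<comment> \<open>\<open>(1 - e) ^ n\<close> is written as
    \<open>exp (n * e * (ln (1 - e) / e))\<close>, whose last quotient tends to the derivative of
    \<open>ln (1 - x)\<close> at 0. The binomial coefficient times \<open>e ^ k\<close> is the
    product of the factors \<open>n * e - j * e\<close> over \<open>fact k\<close>. So only
    \<open>n * e\<close> and \<open>e\<close> have to converge.\<close>
  have dl: "((\<lambda>x. ln (1 - x) / x) \<longlongrightarrow> - 1) (at_right (0::real))"
  proof -
    have "((\<lambda>x. ln (1 - x)) has_real_derivative - 1) (at 0)"
      by (auto intro!: derivative_eq_intros)
    then show ?thesis
      unfolding has_field_derivative_iff by (auto intro: tendsto_mono[OF at_le])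
  qed
  have "filterlim e (at_right 0) F" using e by (auto simp: filterlim_at elim: eventually_mono)
  then have ln: "((\<lambda>i. ln (1 - e i) / e i) \<longlongrightarrow> - 1) F" by (rule filterlim_compose[OF dl])
  have pk: "((\<lambda>i. (1 - e i) ^ k) \<longlongrightarrow> 1) F"
    using tendsto_power[OF tendsto_diff[OF tendsto_const e(1)], of 1 k] by simp
  have fac: "((\<lambda>i. \<Prod>j<k. real (n i) * e i - real j * e i) \<longlongrightarrow> (\<Prod>j<k. u - real j * 0)) F"
    by (intro tendsto_intros ne e(1))
  have "((\<lambda>i. (\<Prod>j<k. real (n i) * e i - real j * e i) / fact k * (exp ((real (n i) * e i) * (ln (1 - e i) / e i)) / (1 - e i) ^ k))
     \<longlongrightarrow> (\<Prod>j<k. u - real j * 0) / fact k * (exp (u * - 1) / 1)) F"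
    by (intro tendsto_mult tendsto_divide fac tendsto_exp ne ln pk tendsto_const) auto
  then have lim: "((\<lambda>i. (\<Prod>j<k. real (n i) * e i - real j * e i) / fact k * (exp ((real (n i) * e i) * (ln (1 - e i) / e i)) / (1 - e i) ^ k))
     \<longlongrightarrow> u ^ k / fact k * exp (- u)) F" by simp
  have "\<forall>\<^sub>F i in F. e i < 1" by (rule order_tendstoD(2)[OF e(1)]) simp
  with e(2) have "\<forall>\<^sub>F i in F. (\<Prod>j<k. real (n i) * e i - real j * e i) / fact k * (exp ((real (n i) * e i) * (ln (1 - e i) / e i)) / (1 - e i) ^ k)
     = real (n i choose k) * e i ^ k * (1 - e i) ^ (n i - k)"
  proof eventually_elim
    case (elim i)
    have "(\<Prod>j<k. real (n i) * e i - real j * e i) = (\<Prod>j<k. (real (n i) - real j)) * e i ^ k"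
      by (simp add: left_diff_distrib[symmetric] prod.distrib)
    also have "(\<Prod>j<k. (real (n i) - real j)) = fact k * real (n i choose k)"
      by (simp add: binomial_gbinomial gbinomial_prod_rev lessThan_atLeast0)
    finally have 1: "(\<Prod>j<k. real (n i) * e i - real j * e i) / fact k = real (n i choose k) * e i ^ k" by simp
    have "exp ((real (n i) * e i) * (ln (1 - e i) / e i)) = (1 - e i) ^ n i"
      using elim by (simp add: exp_of_nat_mult)
    then show ?case
    proof (cases "k \<le> n i")
      case True
      then have "(1 - e i) ^ n i / (1 - e i) ^ k = (1 - e i) ^ (n i - k)"
        using elim by (simp add: power_diff)
      then show ?thesis unfolding 1 \<open>exp _ = _\<close> by simp
    qed (simp add: 1 binomial_eq_0)
  qed
  from tendsto_cong[OF this] lim show ?thesis by blast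
qed

text \<open>\<open>F\<close> imposes on pairs exactly that \<open>e\<close> tends to 0 from the
  right and \<open>n * e\<close> to u. The limit theorem along \<open>F\<close>, unfolded, is the
  statement uniform in e and n; the uniformity is required because n will be random.\<close>

lemma binomial_poisson_uniform:
  fixes u :: real
  assumes "0 < \<delta>"
  obtains \<eta> where "0 < \<eta>" "\<eta> \<le> 1" "\<And>e n. 0 < e \<Longrightarrow> e < \<eta> \<Longrightarrow> \<bar>real n * e - u\<bar> < \<eta> \<Longrightarrow>
    \<bar>pmf (binomial_pmf n e) k - u ^ k / fact k * exp (- u)\<bar> < \<delta>"
proof -
  define F where "F = inf (filtercomap fst (at_right (0::real))) (filtercomap (\<lambda>(e, n :: nat). real n * e) (nhds u))"
  have F1: "filterlim fst (at_right 0) F"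
    unfolding F_def by (rule filterlim_mono[OF filterlim_filtercomap order_refl inf.cobounded1])
  have F2: "((\<lambda>p. real (snd p) * fst p) \<longlongrightarrow> u) F"
    using filterlim_mono[OF filterlim_filtercomap[of "\<lambda>(e, n :: nat). real n * e" "nhds u"] order_refl inf.cobounded2]
    unfolding F_def by (simp add: case_prod_unfold)
  have pos: "\<forall>\<^sub>F p in F. 0 < fst p" using F1 by (auto simp: filterlim_at elim: eventually_mono)
  have "((\<lambda>p. real (snd p choose k) * fst p ^ k * (1 - fst p) ^ (snd p - k)) \<longlongrightarrow> u ^ k / fact k * exp (- u)) F"
    by (rule binomial_poisson_limit[OF _ pos F2]) (use F1 in \<open>simp add: filterlim_at\<close>)
  from tendstoD[OF this assms] obtain P Q where PQ: "eventually P (filtercomap fst (at_right (0::real)))"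
    "eventually Q (filtercomap (\<lambda>(e, n :: nat). real n * e) (nhds u))"
    "\<And>p. P p \<Longrightarrow> Q p \<Longrightarrow> dist (real (snd p choose k) * fst p ^ k * (1 - fst p) ^ (snd p - k)) (u ^ k / fact k * exp (- u)) < \<delta>"
    unfolding F_def eventually_inf by blast
  obtain P' where P': "eventually P' (at_right (0::real))" "\<And>p. P' (fst p) \<Longrightarrow> P p"
    using PQ(1) by (auto simp: eventually_filtercomap)
  obtain Q' where Q': "eventually Q' (nhds u)" "\<And>e n. Q' (real n * e) \<Longrightarrow> Q (e, n)"
    using PQ(2) by (auto simp: eventually_filtercomap)
  obtain b where b: "0 < b" "\<And>e. 0 < e \<Longrightarrow> e < b \<Longrightarrow> P' e"
    using P'(1) by (auto simp: eventually_at_right_field)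
  obtain c where c: "0 < c" "\<And>x. dist x u < c \<Longrightarrow> Q' x"
    using Q'(1) by (auto simp: eventually_nhds_metric)
  show thesis
  proof (rule that[of "min 1 (min b c)"])
    fix e :: real and n :: nat assume h: "0 < e" "e < min 1 (min b c)" "\<bar>real n * e - u\<bar> < min 1 (min b c)"
    have "dist (real (n choose k) * e ^ k * (1 - e) ^ (n - k)) (u ^ k / fact k * exp (- u)) < \<delta>"
      using PQ(3)[of "(e, n)"] P'(2)[of "(e, n)"] Q'(2)[of n e] b(2)[of e] c(2)[of "real n * e"] h
      by (simp add: dist_real_def)
    then show "\<bar>pmf (binomial_pmf n e) k - u ^ k / fact k * exp (- u)\<bar> < \<delta>"
      using h by (simp add: dist_real_def)
  qed (use b c in auto)
qed

text \<open>Telescoping: one factor is exchanged at a time, and the others, lying in the unit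
  interval, only shrink the error.\<close>

lemma abs_prod_diff_le:
  fixes a b :: "'i \<Rightarrow> real"
  assumes "\<And>i. i \<in> I \<Longrightarrow> 0 \<le> a i \<and> a i \<le> 1" "\<And>i. i \<in> I \<Longrightarrow> 0 \<le> b i \<and> b i \<le> 1"
  shows "\<bar>(\<Prod>i\<in>I. a i) - (\<Prod>i\<in>I. b i)\<bar> \<le> (\<Sum>i\<in>I. \<bar>a i - b i\<bar>)"
  using assms
proof (induction I rule: infinite_finite_induct)
  case (insert i I)
  let ?A = "\<Prod>i\<in>I. a i" and ?B = "\<Prod>i\<in>I. b i"
  have B: "\<bar>?B\<bar> \<le> 1" using insert.prems by (auto intro!: prod_le_1 simp: abs_prod)
  have "a i * ?A - b i * ?B = a i * (?A - ?B) + (a i - b i) * ?B" by (simp add: algebra_simps)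
  also have "\<bar>\<dots>\<bar> \<le> \<bar>a i\<bar> * \<bar>?A - ?B\<bar> + \<bar>a i - b i\<bar> * \<bar>?B\<bar>"
    by (rule order_trans[OF abs_triangle_ineq]) (simp add: abs_mult)
  also have "\<dots> \<le> 1 * \<bar>?A - ?B\<bar> + \<bar>a i - b i\<bar> * 1"
    using B insert.prems(1)[of i] by (intro add_mono mult_mono) auto
  also have "\<dots> \<le> (\<Sum>i\<in>I. \<bar>a i - b i\<bar>) + \<bar>a i - b i\<bar>" using insert by simp
  finally show ?case using insert by (simp add: add.commute)
qed auto

text \<open>The rate of \<open>poisson_pmf\<close> must be positive, but the degenerate rate \<open>u = 0\<close> is allowed here.\<close>

definition pois :: "real \<Rightarrow> nat \<Rightarrow> real" where
  "pois u k = u ^ k / fact k * exp (- u)"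

lemma pois_bounds:
  assumes "0 \<le> u" shows "0 \<le> pois u k" "pois u k \<le> 1"
proof -
  show "0 \<le> pois u k" using assms by (simp add: pois_def)
  show "pois u k \<le> 1"
  proof (cases "u = 0")
    case True
    then show ?thesis by (cases k) (auto simp: pois_def)
  next
    case False
    then have "pois u k = pmf (poisson_pmf u) k" using assms by (simp add: pois_def)
    then show ?thesis by (simp add: pmf_le_1)
  qed
qed

section \<open>Binomial laws with random parameters under the law of large numbers\<close>

locale thinning = prob_space M for M :: "'a measure" +
  fixes N :: "real \<Rightarrow> 'a \<Rightarrow> nat" and lam :: real
  assumes cpath: "\<And>\<omega>. \<omega> \<in> space M \<Longrightarrow> counting_path (\<lambda>t. N t \<omega>)"
    and Nmeas: "\<And>t. 0 \<le> t \<Longrightarrow> N t \<in> M \<rightarrow>\<^sub>M count_space UNIV"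
    and lam: "0 < lam"
    and lln: "\<And>d. 0 < d \<Longrightarrow> ((\<lambda>t. measure M {\<omega> \<in> space M. d \<le> \<bar>real (N t \<omega>) / t - lam\<bar>}) \<longlongrightarrow> 0) at_top"
begin

lemma Nreal[measurable]: "0 \<le> t \<Longrightarrow> (\<lambda>\<omega>. real (N t \<omega>)) \<in> borel_measurable M"
  by (rule measurable_compose[OF Nmeas]) (simp_all add: measurable_count_space_eq1)

text \<open>\<open>k\<close> is a time of order \<open>a / \<epsilon>\<close>. The case
  \<open>a = 0\<close> is included, for the sake of the first grid time; there \<open>k\<close> may
  stay bounded.\<close>

lemma scaled_in_prob:
  fixes k :: "real \<Rightarrow> nat"
  assumes k: "((\<lambda>\<epsilon>. \<epsilon> * real (k \<epsilon>)) \<longlongrightarrow> a) (at_right 0)" and d: "0 < d"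
  shows "((\<lambda>\<epsilon>. prob {\<omega> \<in> space M. d \<le> \<bar>\<epsilon> * real (N (real (k \<epsilon>)) \<omega>) - lam * a\<bar>}) \<longlongrightarrow> 0) (at_right 0)"
proof -
  have a0: "0 \<le> a"
    by (rule tendsto_lowerbound[OF k]) (auto simp: eventually_at_right_field intro!: exI[of _ 1])
  \<comment> \<open>\<open>a + 1\<close> bounds \<open>\<epsilon> * k\<close> for small
    \<open>\<epsilon>\<close>, so an error \<open>\<eta>\<close> in the law of large numbers costs
    at most \<open>d / 2\<close>.\<close>
  define \<eta> where "\<eta> = d / (2 * (a + 1))"
  have \<eta>: "0 < \<eta>" "\<eta> * (a + 1) = d / 2"
  proof -
    have "a + 1 > 0" using a0 by simp
    then show "0 < \<eta>" "\<eta> * (a + 1) = d / 2" using d unfolding \<eta>_def by (simp_all only: zero_less_divide_iff) (auto simp: nonzero_eq_divide_eq field_split_simps)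
  qed
  show ?thesis
  proof (rule tendstoI)
    fix \<delta> :: real assume \<delta>: "0 < \<delta>"
    from tendstoD[OF lln[OF \<eta>(1)] \<delta>] obtain T0 where T0: "\<And>t. T0 \<le> t \<Longrightarrow> prob {\<omega> \<in> space M. \<eta> \<le> \<bar>real (N t \<omega>) / t - lam\<bar>} < \<delta>"
      by (auto simp: eventually_at_top_linorder dist_real_def)
    define T where "T = max T0 1"
    have T: "1 \<le> T" "\<And>t. T \<le> t \<Longrightarrow> prob {\<omega> \<in> space M. \<eta> \<le> \<bar>real (N t \<omega>) / t - lam\<bar>} < \<delta>"
      using T0 by (auto simp: T_def)
    text \<open>Below the threshold \<open>T\<close> the law of large numbers says nothing, but then \<open>\<epsilon> N\<close> is dominated by
      \<open>\<epsilon> N(T)\<close>, which tends to zero.\<close>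
    have small: "\<forall>\<^sub>F \<epsilon> in at_right 0. prob {\<omega> \<in> space M. d / 2 \<le> \<epsilon> * real (N T \<omega>)} < \<delta>"
    proof -
      have "(\<lambda>n. prob {\<omega> \<in> space M. real n \<le> real (N T \<omega>)}) \<longlonglongrightarrow> prob (\<Inter>n. {\<omega> \<in> space M. real n \<le> real (N T \<omega>)})"
      proof (intro finite_Lim_measure_decseq)
        have [measurable]: "(\<lambda>\<omega>. real (N T \<omega>)) \<in> borel_measurable M" using T(1) by (intro Nreal) simp
        have "{\<omega> \<in> space M. real n \<le> real (N T \<omega>)} \<in> events" for n by measurable
        then show "range (\<lambda>n. {\<omega> \<in> space M. real n \<le> real (N T \<omega>)}) \<subseteq> events" by blast
      qed (auto simp: decseq_def)
      moreover have "(\<Inter>n. {\<omega> \<in> space M. real n \<le> real (N T \<omega>)}) = {}"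
      proof (intro equals0I)
        fix \<omega> assume "\<omega> \<in> (\<Inter>n. {\<omega> \<in> space M. real n \<le> real (N T \<omega>)})"
        then have "real (Suc (N T \<omega>)) \<le> real (N T \<omega>)" by blast
        then show False by simp
      qed
      ultimately have "(\<lambda>n. prob {\<omega> \<in> space M. real n \<le> real (N T \<omega>)}) \<longlonglongrightarrow> 0" by simp
      from order_tendstoD(2)[OF this \<delta>] obtain n where n: "prob {\<omega> \<in> space M. real n \<le> real (N T \<omega>)} < \<delta>"
        by (auto simp: eventually_sequentially)
      show ?thesis
        unfolding eventually_at_right_field
      proof (intro exI[of _ "d / (2 * (real n + 1))"] conjI allI impI)
        show "0 < d / (2 * (real n + 1))" using d by simp
        fix \<epsilon> :: real assume e: "0 < \<epsilon>" "\<epsilon> < d / (2 * (real n + 1))"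
        have "prob {\<omega> \<in> space M. d / 2 \<le> \<epsilon> * real (N T \<omega>)} \<le> prob {\<omega> \<in> space M. real n \<le> real (N T \<omega>)}"
        proof (rule finite_measure_mono)
          show "{\<omega> \<in> space M. d / 2 \<le> \<epsilon> * real (N T \<omega>)} \<subseteq> {\<omega> \<in> space M. real n \<le> real (N T \<omega>)}"
          proof (intro subsetI)
            fix \<omega> assume w: "\<omega> \<in> {\<omega> \<in> space M. d / 2 \<le> \<epsilon> * real (N T \<omega>)}"
            have "\<epsilon> * real n \<le> \<epsilon> * (real n + 1)" using e by simp
            also have "\<dots> < d / 2" using e by (simp add: field_simps)
            also have "\<dots> \<le> \<epsilon> * real (N T \<omega>)" using w by simp
            finally have "real n < real (N T \<omega>)" using e by simp
            then show "\<omega> \<in> {\<omega> \<in> space M. real n \<le> real (N T \<omega>)}" using w by simp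
          qed
          have [measurable]: "(\<lambda>\<omega>. real (N T \<omega>)) \<in> borel_measurable M" using T(1) by (intro Nreal) simp
          show "{\<omega> \<in> space M. real n \<le> real (N T \<omega>)} \<in> events" by measurable
        qed
        then show "prob {\<omega> \<in> space M. d / 2 \<le> \<epsilon> * real (N T \<omega>)} < \<delta>" using n by linarith
      qed
    qed
    \<comment> \<open>The distance allowed between \<open>\<epsilon> * k\<close> and a. The factor 4
      serves both cases below: for \<open>k \<ge> T\<close> the error in the time costs at most
      \<open>d / 4\<close>, and for \<open>k < T\<close> one gets \<open>a < 2 * \<kappa>\<close>,
      so that \<open>lam * a\<close> is at most \<open>d / 2\<close>.\<close>
    define \<kappa> where "\<kappa> = min 1 (d / (4 * lam))"
    have \<kappa>: "0 < \<kappa>" "\<kappa> \<le> 1" "lam * \<kappa> \<le> d / 4" using d lam by (auto simp: \<kappa>_def field_simps min_def)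
    have e1: "\<forall>\<^sub>F \<epsilon> in at_right 0. \<bar>\<epsilon> * real (k \<epsilon>) - a\<bar> < \<kappa>"
      using tendstoD[OF k \<kappa>(1)] by (simp add: dist_real_def)
    have e2: "\<forall>\<^sub>F \<epsilon> in at_right 0. \<epsilon> * T < \<kappa>"
      unfolding eventually_at_right_field using T(1) \<kappa>
      by (intro exI[of _ "\<kappa> / T"]) (auto simp: field_simps)
    have e3: "\<forall>\<^sub>F \<epsilon> in at_right (0::real). 0 < \<epsilon>" by (auto simp: eventually_at_right_field intro!: exI[of _ 1])
    show "\<forall>\<^sub>F \<epsilon> in at_right 0. dist (prob {\<omega> \<in> space M. d \<le> \<bar>\<epsilon> * real (N (real (k \<epsilon>)) \<omega>) - lam * a\<bar>}) 0 < \<delta>"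
      using small e1 e2 e3
    proof eventually_elim
      case (elim \<epsilon>)
      let ?k = "real (k \<epsilon>)"
      let ?E = "{\<omega> \<in> space M. d \<le> \<bar>\<epsilon> * real (N ?k \<omega>) - lam * a\<bar>}"
      have "prob ?E < \<delta>"
      proof (cases "T \<le> ?k")
        case True
        have k0: "0 < ?k" using True T by simp
        have "prob ?E \<le> prob {\<omega> \<in> space M. \<eta> \<le> \<bar>real (N ?k \<omega>) / ?k - lam\<bar>}"
        proof (rule finite_measure_mono)
          show "{\<omega> \<in> space M. \<eta> \<le> \<bar>real (N ?k \<omega>) / ?k - lam\<bar>} \<in> events"
          proof -
            have [measurable]: "(\<lambda>\<omega>. real (N ?k \<omega>)) \<in> borel_measurable M" using k0 by (intro Nreal) simp
            show ?thesis by measurable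
          qed
          show "?E \<subseteq> {\<omega> \<in> space M. \<eta> \<le> \<bar>real (N ?k \<omega>) / ?k - lam\<bar>}"
          proof (intro subsetI)
            fix \<omega> assume w: "\<omega> \<in> ?E"
            have "\<eta> \<le> \<bar>real (N ?k \<omega>) / ?k - lam\<bar>"
            proof (rule ccontr)
              assume "\<not> ?thesis"
              then have lt: "\<bar>real (N ?k \<omega>) / ?k - lam\<bar> < \<eta>" by simp
              have "\<epsilon> * real (N ?k \<omega>) - lam * a = (\<epsilon> * ?k) * (real (N ?k \<omega>) / ?k - lam) + lam * (\<epsilon> * ?k - a)"
                using k0 by (simp add: field_simps)
              then have "\<bar>\<epsilon> * real (N ?k \<omega>) - lam * a\<bar> \<le> (\<epsilon> * ?k) * \<bar>real (N ?k \<omega>) / ?k - lam\<bar> + lam * \<bar>\<epsilon> * ?k - a\<bar>"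
                using abs_triangle_ineq[of "(\<epsilon> * ?k) * (real (N ?k \<omega>) / ?k - lam)" "lam * (\<epsilon> * ?k - a)"] elim lam
                by (simp add: abs_mult)
              also have "\<dots> \<le> (a + 1) * \<eta> + lam * \<kappa>"
                using lt elim lam \<kappa> a0 \<eta> by (intro add_mono mult_mono) auto
              also have "\<dots> \<le> d / 2 + d / 4" using \<eta>(2) \<kappa>(3) by (simp add: mult.commute)
              also have "\<dots> < d" using d by simp
              finally show False using w by simp
            qed
            then show "\<omega> \<in> {\<omega> \<in> space M. \<eta> \<le> \<bar>real (N ?k \<omega>) / ?k - lam\<bar>}" using w by simp
          qed
        qed
        also have "\<dots> < \<delta>" by (rule T(2)[OF True])
        finally show ?thesis .
      next
        case False
        have "\<epsilon> * ?k \<le> \<epsilon> * T" using False elim by (intro mult_left_mono) auto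
        then have "a < 2 * \<kappa>" using elim by linarith
        then have "lam * a \<le> lam * (2 * \<kappa>)" using lam by (intro mult_left_mono) auto
        moreover have "lam * (2 * \<kappa>) = 2 * (lam * \<kappa>)" by simp
        ultimately have la: "lam * a \<le> d / 2" using \<kappa>(3) by linarith
        have la0: "0 \<le> lam * a" using lam a0 by simp
        have "prob ?E \<le> prob {\<omega> \<in> space M. d / 2 \<le> \<epsilon> * real (N T \<omega>)}"
        proof (rule finite_measure_mono)
          have [measurable]: "(\<lambda>\<omega>. real (N T \<omega>)) \<in> borel_measurable M" using T(1) by (intro Nreal) simp
          show "{\<omega> \<in> space M. d / 2 \<le> \<epsilon> * real (N T \<omega>)} \<in> events" by measurable
          show "?E \<subseteq> {\<omega> \<in> space M. d / 2 \<le> \<epsilon> * real (N T \<omega>)}"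
          proof (intro subsetI)
            fix \<omega> assume w: "\<omega> \<in> ?E"
            have "N ?k \<omega> \<le> N T \<omega>" using w False by (intro counting_path_mono[OF cpath]) auto
            then have "\<epsilon> * real (N ?k \<omega>) \<le> \<epsilon> * real (N T \<omega>)" using elim by (intro mult_left_mono) auto
            moreover have "0 \<le> \<epsilon> * real (N ?k \<omega>)" using elim by simp
            moreover have "d \<le> \<bar>\<epsilon> * real (N ?k \<omega>) - lam * a\<bar>" using w by simp
            ultimately have "d / 2 \<le> \<epsilon> * real (N T \<omega>)" using la la0 d by linarith
            then show "\<omega> \<in> {\<omega> \<in> space M. d / 2 \<le> \<epsilon> * real (N T \<omega>)}" using w by simp
          qed
        qed
        then show ?thesis using elim by linarith
      qed
      then show ?case by (simp add: dist_real_def)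
    qed
  qed
qed

end

lemma measurable_diff_count_space:
  fixes f g :: "'a \<Rightarrow> nat"
  assumes f: "f \<in> M \<rightarrow>\<^sub>M count_space UNIV" and g: "g \<in> M \<rightarrow>\<^sub>M count_space UNIV"
  shows "(\<lambda>x. f x - g x) \<in> M \<rightarrow>\<^sub>M count_space UNIV"
proof -
  have "(\<lambda>x. f x - k) \<in> M \<rightarrow>\<^sub>M count_space UNIV" for k
    using measurable_compose[OF f, of "\<lambda>m. m - k" "count_space UNIV"] by simp
  from measurable_compose_countable[of "\<lambda>k x. f x - k", OF this g] show ?thesis .
qed

context thinning
begin

text \<open>Convergence in the mean, so that the errors of several increments can be added whatever
  their dependence. Outside two events of probability below \<open>\<delta> / 4\<close> the pmf is
  within \<open>\<delta> / 2\<close> of its limit; on them the difference is at most 1.\<close>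

lemma binomial_pmf_L1:
  fixes k l :: "real \<Rightarrow> nat"
  assumes k: "((\<lambda>\<epsilon>. \<epsilon> * real (k \<epsilon>)) \<longlongrightarrow> a) (at_right 0)" and l: "((\<lambda>\<epsilon>. \<epsilon> * real (l \<epsilon>)) \<longlongrightarrow> b) (at_right 0)"
    and kl: "\<And>\<epsilon>. 0 < \<epsilon> \<Longrightarrow> k \<epsilon> \<le> l \<epsilon>" and ab: "a \<le> b"
  shows "((\<lambda>\<epsilon>. expectation (\<lambda>\<omega>. \<bar>pmf (binomial_pmf (N (l \<epsilon>) \<omega> - N (k \<epsilon>) \<omega>) \<epsilon>) d - pois (lam * (b - a)) d\<bar>)) \<longlongrightarrow> 0) (at_right 0)"
proof (rule tendstoI)
  fix \<delta> :: real assume \<delta>: "0 < \<delta>"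
  let ?u = "lam * (b - a)"
  have u: "0 \<le> ?u" using ab lam by simp
  obtain \<eta> where \<eta>: "0 < \<eta>" "\<eta> \<le> 1" "\<And>e n. 0 < e \<Longrightarrow> e < \<eta> \<Longrightarrow> \<bar>real n * e - ?u\<bar> < \<eta> \<Longrightarrow>
      \<bar>pmf (binomial_pmf n e) d - pois ?u d\<bar> < \<delta> / 2"
    using binomial_poisson_uniform[of "\<delta> / 2" ?u d] \<delta> unfolding pois_def by auto
  have e1: "\<forall>\<^sub>F \<epsilon> in at_right 0. prob {\<omega> \<in> space M. \<eta> / 2 \<le> \<bar>\<epsilon> * real (N (real (k \<epsilon>)) \<omega>) - lam * a\<bar>} < \<delta> / 4"
    by (rule order_tendstoD(2)[OF scaled_in_prob[OF k]]) (use \<eta> \<delta> in auto)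
  have e2: "\<forall>\<^sub>F \<epsilon> in at_right 0. prob {\<omega> \<in> space M. \<eta> / 2 \<le> \<bar>\<epsilon> * real (N (real (l \<epsilon>)) \<omega>) - lam * b\<bar>} < \<delta> / 4"
    by (rule order_tendstoD(2)[OF scaled_in_prob[OF l]]) (use \<eta> \<delta> in auto)
  have e3: "\<forall>\<^sub>F \<epsilon> in at_right 0. 0 < \<epsilon> \<and> \<epsilon> < \<eta>"
    unfolding eventually_at_right_field using \<eta>(1) by (intro exI[of _ \<eta>]) auto
  show "\<forall>\<^sub>F \<epsilon> in at_right 0. dist (expectation (\<lambda>\<omega>. \<bar>pmf (binomial_pmf (N (l \<epsilon>) \<omega> - N (k \<epsilon>) \<omega>) \<epsilon>) d - pois ?u d\<bar>)) 0 < \<delta>"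
    using e1 e2 e3
  proof eventually_elim
    case (elim \<epsilon>)
    let ?A = "{\<omega> \<in> space M. \<eta> / 2 \<le> \<bar>\<epsilon> * real (N (real (k \<epsilon>)) \<omega>) - lam * a\<bar>}"
    let ?B = "{\<omega> \<in> space M. \<eta> / 2 \<le> \<bar>\<epsilon> * real (N (real (l \<epsilon>)) \<omega>) - lam * b\<bar>}"
    let ?f = "\<lambda>\<omega>. \<bar>pmf (binomial_pmf (N (l \<epsilon>) \<omega> - N (k \<epsilon>) \<omega>) \<epsilon>) d - pois ?u d\<bar>"
    have [measurable]: "(\<lambda>\<omega>. real (N (real (k \<epsilon>)) \<omega>)) \<in> borel_measurable M" "(\<lambda>\<omega>. real (N (real (l \<epsilon>)) \<omega>)) \<in> borel_measurable M"
      by (rule Nreal; simp)+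
    have [measurable]: "N (real (k \<epsilon>)) \<in> M \<rightarrow>\<^sub>M count_space UNIV" "N (real (l \<epsilon>)) \<in> M \<rightarrow>\<^sub>M count_space UNIV"
      by (rule Nmeas; simp)+
    have AB: "?A \<in> events" "?B \<in> events" by measurable
    have f1: "?f \<omega> \<le> 1" for \<omega>
      using pmf_nonneg[of "binomial_pmf (N (l \<epsilon>) \<omega> - N (k \<epsilon>) \<omega>) \<epsilon>" d] pmf_le_1[of "binomial_pmf (N (l \<epsilon>) \<omega> - N (k \<epsilon>) \<omega>) \<epsilon>" d]
        pois_bounds[OF u, of d] by linarith
    have fm: "?f \<in> borel_measurable M"
    proof -
      have "(\<lambda>\<omega>. (\<lambda>m. \<bar>pmf (binomial_pmf (N (l \<epsilon>) \<omega> - m) \<epsilon>) d - pois ?u d\<bar>) (N (k \<epsilon>) \<omega>)) \<in> borel_measurable M"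
        by (rule measurable_compose_countable[OF _ Nmeas]) (auto intro!: measurable_compose[OF Nmeas] simp: measurable_count_space_eq1)
      then show ?thesis by simp
    qed
    have "expectation ?f \<le> expectation (\<lambda>\<omega>. \<delta> / 2 + indicator ?A \<omega> + indicator ?B \<omega>)"
    proof (rule integral_mono)
      show "integrable M ?f" by (rule integrable_const_bound[of _ 1]) (use f1 fm in auto)
      show "integrable M (\<lambda>\<omega>. \<delta> / 2 + indicator ?A \<omega> + indicator ?B \<omega> :: real)"
        by (intro Bochner_Integration.integrable_add integrable_real_indicator integrable_const AB)
           (auto simp: emeasure_eq_measure)
      fix \<omega> assume w: "\<omega> \<in> space M"
      show "?f \<omega> \<le> \<delta> / 2 + indicator ?A \<omega> + indicator ?B \<omega>"
      proof (cases "\<omega> \<in> ?A \<or> \<omega> \<in> ?B")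
        case True
        then show ?thesis using f1[of \<omega>] \<delta> by (auto simp: indicator_def split: if_splits)
      next
        case False
        have "N (k \<epsilon>) \<omega> \<le> N (l \<epsilon>) \<omega>" using kl[of \<epsilon>] elim w by (intro counting_path_mono[OF cpath]) auto
        then have "real (N (l \<epsilon>) \<omega> - N (k \<epsilon>) \<omega>) * \<epsilon> - ?u
          = (\<epsilon> * real (N (real (l \<epsilon>)) \<omega>) - lam * b) - (\<epsilon> * real (N (real (k \<epsilon>)) \<omega>) - lam * a)"
          by (simp add: algebra_simps of_nat_diff)
        moreover have "\<bar>\<epsilon> * real (N (real (l \<epsilon>)) \<omega>) - lam * b\<bar> < \<eta> / 2" "\<bar>\<epsilon> * real (N (real (k \<epsilon>)) \<omega>) - lam * a\<bar> < \<eta> / 2"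
          using False w by auto
        ultimately have "\<bar>real (N (l \<epsilon>) \<omega> - N (k \<epsilon>) \<omega>) * \<epsilon> - ?u\<bar> < \<eta>" by linarith
        then show ?thesis using \<eta>(3)[of \<epsilon> "N (l \<epsilon>) \<omega> - N (k \<epsilon>) \<omega>"] elim False by (auto simp: indicator_def)
      qed
    qed
    also have "\<dots> = \<delta> / 2 + prob ?A + prob ?B"
      using AB by (simp add: prob_space emeasure_eq_measure integrable_real_indicator)
    also have "\<dots> < \<delta>" using elim by simp
    finally show ?case by (simp add: dist_real_def)
  qed
qed

end

section \<open>Limits of the increments of the thinned process\<close>

locale thinning_family = thinning M N lam for M :: "'a measure" and N lam +
  fixes \<beta> :: "real \<Rightarrow> nat \<Rightarrow> 'a \<Rightarrow> nat"
  assumes iid: "\<And>\<epsilon>. 0 < \<epsilon> \<Longrightarrow> \<epsilon> \<le> 1 \<Longrightarrow> iid_bernoulli M \<epsilon> (\<beta> \<epsilon>)"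
    and ind: "\<And>\<epsilon>. 0 < \<epsilon> \<Longrightarrow> \<epsilon> \<le> 1 \<Longrightarrow> independent_of_process M (\<beta> \<epsilon>) N"
begin

definition block_event :: "real \<Rightarrow> (nat \<Rightarrow> nat) \<Rightarrow> (nat \<Rightarrow> nat) \<Rightarrow> nat \<Rightarrow> 'a set" where
  "block_event \<epsilon> s d J = {\<omega> \<in> space M. \<forall>j<J. (\<Sum>i\<in>{N (real (s j)) \<omega><..N (real (s (Suc j))) \<omega>}. \<beta> \<epsilon> i \<omega>) = d j}"

text \<open>\<open>independent_of_process\<close> makes \<open>\<beta>\<close> independent of \<open>N\<close> at integer times only: its restricted path of \<open>N\<close>
  is coerced to a function of type \<open>nat \<Rightarrow> nat\<close>. Hence the increments are first taken over integer times.\<close>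

lemma block_event_tendsto:
  fixes s :: "real \<Rightarrow> nat \<Rightarrow> nat"
  assumes lim: "\<And>j. ((\<lambda>\<epsilon>. \<epsilon> * real (s \<epsilon> j)) \<longlongrightarrow> a j) (at_right 0)"
    and mono: "\<And>\<epsilon> j. 0 < \<epsilon> \<Longrightarrow> s \<epsilon> j \<le> s \<epsilon> (Suc j)" and a: "\<And>j. a j \<le> a (Suc j)"
  shows "((\<lambda>\<epsilon>. prob (block_event \<epsilon> (s \<epsilon>) d J)) \<longlongrightarrow> (\<Prod>j<J. pois (lam * (a (Suc j) - a j)) (d j))) (at_right 0)"
    and "0 < \<epsilon> \<Longrightarrow> \<epsilon> \<le> 1 \<Longrightarrow> block_event \<epsilon> (s \<epsilon>) d J \<in> events"
proof -
  define p where "p \<epsilon> j \<omega> = pmf (binomial_pmf (N (s \<epsilon> (Suc j)) \<omega> - N (s \<epsilon> j) \<omega>) \<epsilon>) (d j)" for \<epsilon> j \<omega>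
  define q where "q j = pois (lam * (a (Suc j) - a j)) (d j)" for j
  have Nm: "N (real (s \<epsilon> j)) \<omega> \<le> N (real (s \<epsilon> (Suc j))) \<omega>" if "\<omega> \<in> space M" "0 < \<epsilon>" for \<epsilon> j \<omega>
    using that mono by (intro counting_path_mono[OF cpath]) auto
  show "block_event \<epsilon> (s \<epsilon>) d J \<in> events" if "0 < \<epsilon>" "\<epsilon> \<le> 1" for \<epsilon>
    unfolding block_event_def
    by (rule thinned_increments_prob(2)[OF iid[OF that] _ _ ind[OF that] _ Nmeas]) (use that Nm in auto)
  have pr: "prob (block_event \<epsilon> (s \<epsilon>) d J) = expectation (\<lambda>\<omega>. \<Prod>j<J. p \<epsilon> j \<omega>)" if "0 < \<epsilon>" "\<epsilon> \<le> 1" for \<epsilon>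
    unfolding block_event_def p_def
    by (rule thinned_increments_prob(1)[OF iid[OF that] _ _ ind[OF that] _ Nmeas]) (use that Nm in auto)
  have pm: "p \<epsilon> j \<in> borel_measurable M" for \<epsilon> j
  proof -
    have "(\<lambda>\<omega>. (\<lambda>m. pmf (binomial_pmf (N (s \<epsilon> (Suc j)) \<omega> - m) \<epsilon>) (d j)) (N (s \<epsilon> j) \<omega>)) \<in> borel_measurable M"
      by (rule measurable_compose_countable[OF _ Nmeas]) (auto intro!: measurable_compose[OF Nmeas] simp: measurable_count_space_eq1)
    then show ?thesis by (simp add: p_def[abs_def])
  qed
  have p01: "0 \<le> p \<epsilon> j \<omega>" "p \<epsilon> j \<omega> \<le> 1" for \<epsilon> j \<omega> by (auto simp: p_def pmf_le_1)
  have q01: "0 \<le> q j" "q j \<le> 1" for j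
    unfolding q_def by (rule pois_bounds; use lam a[of j] in simp)+
  have ip: "integrable M (\<lambda>\<omega>. \<Prod>j<J. p \<epsilon> j \<omega>)" for \<epsilon>
    by (rule integrable_const_bound[of _ 1]) (use p01 pm in \<open>auto intro!: prod_le_1 simp: abs_prod\<close>)
  have ip1: "integrable M (p \<epsilon> j)" for \<epsilon> j
    by (rule integrable_const_bound[of _ 1]) (use p01 pm in auto)
  have ipq: "integrable M (\<lambda>\<omega>. \<bar>p \<epsilon> j \<omega> - q j\<bar>)" for \<epsilon> j
  proof (rule integrable_const_bound[of _ 1])
    have "\<bar>p \<epsilon> j \<omega> - q j\<bar> \<le> 1" for \<omega> using p01[of \<epsilon> j \<omega>] q01[of j] by linarith
    then show "AE \<omega> in M. norm \<bar>p \<epsilon> j \<omega> - q j\<bar> \<le> 1" by simp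
  qed (use pm in auto)
  \<comment> \<open>The block counts are independent only given \<open>N\<close>. The product of
    their conditional probabilities is therefore compared with the constant product inside the
    expectation.\<close>
  have bound: "\<bar>expectation (\<lambda>\<omega>. \<Prod>j<J. p \<epsilon> j \<omega>) - (\<Prod>j<J. q j)\<bar> \<le> (\<Sum>j<J. expectation (\<lambda>\<omega>. \<bar>p \<epsilon> j \<omega> - q j\<bar>))" for \<epsilon>
  proof -
    have "expectation (\<lambda>\<omega>. \<Prod>j<J. p \<epsilon> j \<omega>) - (\<Prod>j<J. q j) = expectation (\<lambda>\<omega>. (\<Prod>j<J. p \<epsilon> j \<omega>) - (\<Prod>j<J. q j))"
      using ip by (simp add: prob_space)
    also have "\<bar>\<dots>\<bar> \<le> expectation (\<lambda>\<omega>. \<bar>(\<Prod>j<J. p \<epsilon> j \<omega>) - (\<Prod>j<J. q j)\<bar>)"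
      by (rule integral_abs_bound)
    also have "\<dots> \<le> expectation (\<lambda>\<omega>. \<Sum>j<J. \<bar>p \<epsilon> j \<omega> - q j\<bar>)"
      using ip ip1 ipq p01 q01 by (intro integral_mono integrable_abs Bochner_Integration.integrable_diff
          Bochner_Integration.integrable_sum abs_prod_diff_le) auto
    also have "\<dots> = (\<Sum>j<J. expectation (\<lambda>\<omega>. \<bar>p \<epsilon> j \<omega> - q j\<bar>))"
      using ipq by (intro Bochner_Integration.integral_sum) auto
    finally show ?thesis .
  qed
  have "((\<lambda>\<epsilon>. \<Sum>j<J. expectation (\<lambda>\<omega>. \<bar>p \<epsilon> j \<omega> - q j\<bar>)) \<longlongrightarrow> (\<Sum>j<J. 0)) (at_right 0)"
    unfolding p_def q_def by (intro tendsto_sum binomial_pmf_L1 lim mono a)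
  then have z: "((\<lambda>\<epsilon>. \<Sum>j<J. expectation (\<lambda>\<omega>. \<bar>p \<epsilon> j \<omega> - q j\<bar>)) \<longlongrightarrow> 0) (at_right 0)" by simp
  have e: "\<forall>\<^sub>F \<epsilon> in at_right (0::real). 0 < \<epsilon> \<and> \<epsilon> \<le> 1"
    unfolding eventually_at_right_field by (intro exI[of _ 1]) auto
  have "((\<lambda>\<epsilon>. prob (block_event \<epsilon> (s \<epsilon>) d J) - (\<Prod>j<J. q j)) \<longlongrightarrow> 0) (at_right 0)"
  proof (rule Lim_null_comparison[OF _ z])
    show "\<forall>\<^sub>F \<epsilon> in at_right 0. norm (prob (block_event \<epsilon> (s \<epsilon>) d J) - (\<Prod>j<J. q j)) \<le> (\<Sum>j<J. expectation (\<lambda>\<omega>. \<bar>p \<epsilon> j \<omega> - q j\<bar>))"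
      using e by eventually_elim (use bound pr in auto)
  qed
  then show "((\<lambda>\<epsilon>. prob (block_event \<epsilon> (s \<epsilon>) d J)) \<longlongrightarrow> (\<Prod>j<J. pois (lam * (a (Suc j) - a j)) (d j))) (at_right 0)"
    unfolding q_def by (subst Lim_null)
qed

lemma measurable_thinned:
  assumes e: "0 < \<epsilon>" "\<epsilon> \<le> 1" and t: "0 \<le> t"
  shows "thinned N \<beta> \<epsilon> t \<in> M \<rightarrow>\<^sub>M count_space UNIV"
proof -
  have "(\<lambda>\<omega>. (\<lambda>n. \<Sum>i = 1..n. \<beta> \<epsilon> i \<omega>) (N (t / \<epsilon>) \<omega>)) \<in> M \<rightarrow>\<^sub>M count_space UNIV"
  proof (rule measurable_compose_countable[where f = "\<lambda>n \<omega>. \<Sum>i = 1..n. \<beta> \<epsilon> i \<omega>" and g = "N (t / \<epsilon>)"])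
    show "(\<lambda>\<omega>. \<Sum>i = 1..n. \<beta> \<epsilon> i \<omega>) \<in> M \<rightarrow>\<^sub>M count_space UNIV" for n
      using iid_bernoulli_probs(1)[OF iid[OF e]] e by (intro measurable_sum_count_space) auto
    show "N (t / \<epsilon>) \<in> M \<rightarrow>\<^sub>M count_space UNIV" using e t by (intro Nmeas) simp
  qed
  then show ?thesis by (simp add: thinned_def[abs_def])
qed

lemma sum_split_interval: "m \<le> n \<Longrightarrow> (\<Sum>i = 1..n. f i) = (\<Sum>i = 1..m. f i) + (\<Sum>i\<in>{m<..n}. f i :: nat)" for m n :: nat
proof -
  assume mn: "m \<le> n"
  have "{1..n} = {1..m} \<union> {m<..n}" using mn by auto
  then show ?thesis by (simp only:) (rule sum.union_disjoint; auto)
qed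

text \<open>The times \<open>a j / \<epsilon>\<close> are not natural. Rounding them down alters the
  count only if a marked arrival falls in the unit interval that follows, and this has vanishing
  probability since in scaled time the interval shrinks to a point.\<close>

lemma thinned_fdd:
  assumes a: "0 \<le> a 0" "\<And>j. a j < a (Suc j)"
  shows "((\<lambda>\<epsilon>. prob {\<omega> \<in> space M. \<forall>j<J. thinned N \<beta> \<epsilon> (a (Suc j)) \<omega> - thinned N \<beta> \<epsilon> (a j) \<omega> = d j})
    \<longlongrightarrow> (\<Prod>j<J. pois (lam * (a (Suc j) - a j)) (d j))) (at_right 0)"
proof -
  have a0: "0 \<le> a j" for j using a by (induction j) (auto intro: less_imp_le order_trans)
  define s where "s \<epsilon> j = nat \<lfloor>a j / \<epsilon>\<rfloor>" for \<epsilon> j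
  \<comment> \<open>No marked arrival between \<open>s\<close> and \<open>s + 1\<close>: a single
    block whose two end times both scale to \<open>a j\<close>, so that its probability tends to
    \<open>pois 0 0\<close>, that is, to 1.\<close>
  define G where "G \<epsilon> j = block_event \<epsilon> (\<lambda>i. s \<epsilon> j + (if i = 0 then 0 else 1)) (\<lambda>_. 0) 1" for \<epsilon> j
  define bad where "bad \<epsilon> j = space M - G \<epsilon> j" for \<epsilon> j
  define E where "E \<epsilon> = {\<omega> \<in> space M. \<forall>j<J. thinned N \<beta> \<epsilon> (a (Suc j)) \<omega> - thinned N \<beta> \<epsilon> (a j) \<omega> = d j}" for \<epsilon>
  have s: "real (s \<epsilon> j) \<le> a j / \<epsilon>" "a j / \<epsilon> \<le> real (s \<epsilon> j) + 1" if "0 < \<epsilon>" for \<epsilon> j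
  proof -
    have "0 \<le> a j / \<epsilon>" using a0 that by simp
    then show "real (s \<epsilon> j) \<le> a j / \<epsilon>" "a j / \<epsilon> \<le> real (s \<epsilon> j) + 1" unfolding s_def by linarith+
  qed
  have id0: "((\<lambda>\<epsilon>::real. \<epsilon>) \<longlongrightarrow> 0) (at_right 0)" by (rule tendsto_ident_at)
  have pos: "\<forall>\<^sub>F \<epsilon> in at_right (0::real). 0 < \<epsilon> \<and> \<epsilon> \<le> 1"
    unfolding eventually_at_right_field by (intro exI[of _ 1]) auto
  have lim: "((\<lambda>\<epsilon>. \<epsilon> * real (s \<epsilon> j)) \<longlongrightarrow> a j) (at_right 0)" for j
  proof (rule tendsto_sandwich)
    show "((\<lambda>\<epsilon>. a j - \<epsilon>) \<longlongrightarrow> a j) (at_right 0)" using tendsto_diff[OF tendsto_const id0, of "a j"] by simp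
    show "((\<lambda>\<epsilon>. a j) \<longlongrightarrow> a j) (at_right 0)" by simp
    show "\<forall>\<^sub>F \<epsilon> in at_right 0. a j - \<epsilon> \<le> \<epsilon> * real (s \<epsilon> j)"
      using pos by eventually_elim (use s(2)[of _ j] in \<open>simp add: field_simps\<close>)
    show "\<forall>\<^sub>F \<epsilon> in at_right 0. \<epsilon> * real (s \<epsilon> j) \<le> a j"
      using pos by eventually_elim (use s(1)[of _ j] in \<open>simp add: field_simps\<close>)
  qed
  have mono: "s \<epsilon> j \<le> s \<epsilon> (Suc j)" if "0 < \<epsilon>" for \<epsilon> j
    unfolding s_def using a(2)[of j] that by (intro nat_mono floor_mono divide_right_mono) auto
  have lim1: "((\<lambda>\<epsilon>. \<epsilon> * real (s \<epsilon> j + (if i = 0 then 0 else 1))) \<longlongrightarrow> a j) (at_right 0)" for i j :: nat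
    using tendsto_add[OF lim[of j] id0] lim[of j] by (cases "i = 0") (auto simp: algebra_simps)
  have good: "((\<lambda>\<epsilon>. prob (G \<epsilon> j)) \<longlongrightarrow> 1) (at_right 0)"
    "0 < \<epsilon> \<Longrightarrow> \<epsilon> \<le> 1 \<Longrightarrow> G \<epsilon> j \<in> events" for j \<epsilon>
    using block_event_tendsto[where s = "\<lambda>\<epsilon> i. s \<epsilon> j + (if i = 0 then 0 else 1)" and a = "\<lambda>_. a j"
        and d = "\<lambda>_. 0" and J = 1, OF lim1]
    by (simp_all add: pois_def G_def)
  have badlim: "((\<lambda>\<epsilon>. prob (bad \<epsilon> j)) \<longlongrightarrow> 0) (at_right 0)" for j
  proof -
    have "((\<lambda>\<epsilon>. 1 - prob (G \<epsilon> j)) \<longlongrightarrow> 1 - 1) (at_right 0)"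
      by (intro tendsto_diff tendsto_const good(1))
    moreover have "\<forall>\<^sub>F \<epsilon> in at_right 0. 1 - prob (G \<epsilon> j) = prob (bad \<epsilon> j)"
      using pos by eventually_elim (simp add: bad_def good(2) prob_compl)
    ultimately show ?thesis by (simp add: tendsto_cong)
  qed
  have badlim: "((\<lambda>\<epsilon>. \<Sum>j\<le>J. prob (bad \<epsilon> j)) \<longlongrightarrow> 0) (at_right 0)"
  proof -
    have "((\<lambda>\<epsilon>. \<Sum>j\<le>J. prob (bad \<epsilon> j)) \<longlongrightarrow> (\<Sum>j\<le>J. 0)) (at_right 0)"
      by (intro tendsto_sum badlim)
    then show ?thesis by simp
  qed
  \<comment> \<open>Off the bad events the counts at \<open>a j / \<epsilon>\<close> and at its
    rounding coincide. The index J is included since J blocks have \<open>J + 1\<close> end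
    points.\<close>
  have same: "\<omega> \<in> E \<epsilon> \<longleftrightarrow> \<omega> \<in> block_event \<epsilon> (s \<epsilon>) d J"
    if w: "\<omega> \<in> space M" "\<And>j. j \<le> J \<Longrightarrow> \<omega> \<notin> bad \<epsilon> j" and e: "0 < \<epsilon>" for \<omega> \<epsilon>
  proof -
    have Nle: "N (real x) \<omega> \<le> N (real y) \<omega>" if "x \<le> y" for x y
      using that w by (intro counting_path_mono[OF cpath]) auto
    have th: "thinned N \<beta> \<epsilon> (a j) \<omega> = (\<Sum>i = 1..N (real (s \<epsilon> j)) \<omega>. \<beta> \<epsilon> i \<omega>)" if j: "j \<le> J" for j
    proof -
      have z: "(\<Sum>i\<in>{N (real (s \<epsilon> j)) \<omega><..N (real (s \<epsilon> j + 1)) \<omega>}. \<beta> \<epsilon> i \<omega>) = 0"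
        using w(2)[OF j] w(1) by (simp add: bad_def G_def block_event_def)
      have n1: "N (real (s \<epsilon> j)) \<omega> \<le> N (a j / \<epsilon>) \<omega>" using s(1)[OF e] w by (intro counting_path_mono[OF cpath]) auto
      have n2: "N (a j / \<epsilon>) \<omega> \<le> N (real (s \<epsilon> j + 1)) \<omega>"
        using s(2)[OF e, of j] w a0[of j] e by (intro counting_path_mono[OF cpath]) auto
      have "(\<Sum>i\<in>{N (real (s \<epsilon> j)) \<omega><..N (a j / \<epsilon>) \<omega>}. \<beta> \<epsilon> i \<omega>) \<le> (\<Sum>i\<in>{N (real (s \<epsilon> j)) \<omega><..N (real (s \<epsilon> j + 1)) \<omega>}. \<beta> \<epsilon> i \<omega>)"
        using n2 by (intro sum_mono2) auto
      then show ?thesis unfolding thinned_def using sum_split_interval[OF n1, of "\<lambda>i. \<beta> \<epsilon> i \<omega>"] z by simp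
    qed
    have "thinned N \<beta> \<epsilon> (a (Suc j)) \<omega> - thinned N \<beta> \<epsilon> (a j) \<omega> = (\<Sum>i\<in>{N (real (s \<epsilon> j)) \<omega><..N (real (s \<epsilon> (Suc j))) \<omega>}. \<beta> \<epsilon> i \<omega>)"
      if "j < J" for j
      using th[of j] th[of "Suc j"] that sum_split_interval[OF Nle[OF mono[OF e]], of "\<lambda>i. \<beta> \<epsilon> i \<omega>" j] by simp
    then show ?thesis using w by (auto simp: E_def block_event_def)
  qed
  have bl: "((\<lambda>\<epsilon>. prob (block_event \<epsilon> (s \<epsilon>) d J)) \<longlongrightarrow> (\<Prod>j<J. pois (lam * (a (Suc j) - a j)) (d j))) (at_right 0)"
    by (intro block_event_tendsto lim mono less_imp_le a(2))
  have Eev: "E \<epsilon> \<in> events" if e: "0 < \<epsilon>" "\<epsilon> \<le> 1" for \<epsilon>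
  proof -
    have "(\<lambda>\<omega>. thinned N \<beta> \<epsilon> (a (Suc j)) \<omega> - thinned N \<beta> \<epsilon> (a j) \<omega>) \<in> M \<rightarrow>\<^sub>M count_space UNIV" for j
      by (intro measurable_diff_count_space measurable_thinned e a0)
    from measurable_sets[OF this, of "{d _}"]
    have "{\<omega> \<in> space M. thinned N \<beta> \<epsilon> (a (Suc j)) \<omega> - thinned N \<beta> \<epsilon> (a j) \<omega> = d j} \<in> events" for j
      by (simp add: vimage_def Int_def conj_commute)
    then have "{\<omega> \<in> space M. \<forall>j\<in>{..<J}. thinned N \<beta> \<epsilon> (a (Suc j)) \<omega> - thinned N \<beta> \<epsilon> (a j) \<omega> = d j} \<in> events"
      by (intro sets.sets_Collect_finite_All) auto
    also have "{\<omega> \<in> space M. \<forall>j\<in>{..<J}. thinned N \<beta> \<epsilon> (a (Suc j)) \<omega> - thinned N \<beta> \<epsilon> (a j) \<omega> = d j} = E \<epsilon>"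
      unfolding E_def by blast
    finally show ?thesis .
  qed
  have diff: "\<bar>prob (E \<epsilon>) - prob (block_event \<epsilon> (s \<epsilon>) d J)\<bar> \<le> (\<Sum>j\<le>J. prob (bad \<epsilon> j))"
    if e: "0 < \<epsilon>" "\<epsilon> \<le> 1" for \<epsilon>
  proof -
    let ?B = "block_event \<epsilon> (s \<epsilon>) d J" and ?U = "\<Union>j\<le>J. bad \<epsilon> j"
    have ev: "?B \<in> events" "\<And>j. bad \<epsilon> j \<in> events"
    proof -
      show "?B \<in> events"
        by (rule block_event_tendsto(2)[where s = s and a = a, OF lim mono less_imp_le[OF a(2)] e])
      show "bad \<epsilon> j \<in> events" for j
        unfolding bad_def by (rule sets.compl_sets[OF good(2)[OF e]])
    qed
    have U: "?U \<in> events" "prob ?U \<le> (\<Sum>j\<le>J. prob (bad \<epsilon> j))"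
      using ev(2) by (auto intro!: finite_measure_subadditive_finite)
    have "E \<epsilon> \<subseteq> ?B \<union> ?U" "?B \<subseteq> E \<epsilon> \<union> ?U"
      using same[OF _ _ e(1)] by (auto simp: E_def block_event_def)
    then have "prob (E \<epsilon>) \<le> prob (?B \<union> ?U)" "prob ?B \<le> prob (E \<epsilon> \<union> ?U)"
      using ev U Eev[OF e] by (auto intro!: finite_measure_mono)
    moreover have "prob (?B \<union> ?U) \<le> prob ?B + prob ?U" "prob (E \<epsilon> \<union> ?U) \<le> prob (E \<epsilon>) + prob ?U"
      using ev U Eev[OF e] by (auto intro!: measure_Un_le)
    ultimately show ?thesis using U(2) by linarith
  qed
  have "((\<lambda>\<epsilon>. prob (E \<epsilon>) - prob (block_event \<epsilon> (s \<epsilon>) d J)) \<longlongrightarrow> 0) (at_right 0)"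
  proof (rule Lim_null_comparison[OF _ badlim])
    show "\<forall>\<^sub>F \<epsilon> in at_right 0. norm (prob (E \<epsilon>) - prob (block_event \<epsilon> (s \<epsilon>) d J)) \<le> (\<Sum>j\<le>J. prob (bad \<epsilon> j))"
      using pos by eventually_elim (use diff in auto)
  qed
  from tendsto_add[OF this bl] show ?thesis by (simp add: E_def)
qed

end

subsection \<open>Weak convergence from finite-dimensional distributions\<close>

text \<open>Convergence of all point masses to those of a probability measure on a countable set
  lets no mass escape. The bound is one-sided like Fatou's lemma; applying it to a functional and to
  its negative will give both sides.\<close>

lemma (in prob_space) eventually_expectation_le:
  fixes Y :: "'i \<Rightarrow> 'b \<Rightarrow> 'c :: countable" and Y0 :: "'a \<Rightarrow> 'c" and g :: "'c \<Rightarrow> real"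
  assumes M': "prob_space M'" and Y0: "Y0 \<in> M \<rightarrow>\<^sub>M count_space UNIV"
    and Y: "\<forall>\<^sub>F i in Fi. Y i \<in> M' \<rightarrow>\<^sub>M count_space UNIV"
    and lim: "\<And>p. ((\<lambda>i. measure M' {\<omega> \<in> space M'. Y i \<omega> = p}) \<longlongrightarrow> prob {\<omega> \<in> space M. Y0 \<omega> = p}) Fi"
    and g: "\<And>p. \<bar>g p\<bar> \<le> B" and \<delta>: "0 < \<delta>"
  shows "\<forall>\<^sub>F i in Fi. (\<integral>\<omega>. g (Y i \<omega>) \<partial>M') \<le> expectation (\<lambda>\<omega>. g (Y0 \<omega>)) + \<delta>"
proof -
  interpret M': prob_space M' by fact
  \<comment> \<open>\<open>B - g\<close> is nonnegative, so discarding all but finitely many values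
    only lowers its mean: a lower bound for \<open>h\<close> becomes the upper bound for
    \<open>g\<close>.\<close>
  define h where "h p = B - g p" for p
  have h: "0 \<le> h p" "h p \<le> 2 * B" for p using g[of p] by (auto simp: h_def abs_le_iff)
  define S where "S m = {p :: 'c. to_nat p < m}" for m
  have finS: "finite (S m)" for m
    unfolding S_def by (rule finite_imageD[OF finite_subset[of _ "{..<m}"]]) (auto simp: inj_on_def)
  have ev: "{\<omega> \<in> space M. Y0 \<omega> = p} \<in> events" for p
    using measurable_sets[OF Y0, of "{p}"] by (simp add: vimage_def Int_def conj_commute)
  have part: "(\<Sum>p\<in>S m. h p * indicator {\<omega> \<in> space N. Z \<omega> = p} \<omega>) = h (Z \<omega>) * indicator (S m) (Z \<omega>)"
    if "\<omega> \<in> space N" for m N and Z :: "'d \<Rightarrow> 'c" and \<omega>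
  proof -
    have "(\<Sum>p\<in>S m. h p * indicator {\<omega> \<in> space N. Z \<omega> = p} \<omega>) = (\<Sum>p\<in>S m. if p = Z \<omega> then h p else 0)"
      using that by (intro sum.cong) (auto simp: indicator_def)
    then show ?thesis using finS by (simp add: indicator_def)
  qed
  have part0: "(\<Sum>p\<in>S m. h p * prob {\<omega> \<in> space M. Y0 \<omega> = p}) = expectation (\<lambda>\<omega>. h (Y0 \<omega>) * indicator (S m) (Y0 \<omega>))" for m
  proof -
    have "expectation (\<lambda>\<omega>. h (Y0 \<omega>) * indicator (S m) (Y0 \<omega>)) = expectation (\<lambda>\<omega>. \<Sum>p\<in>S m. h p * indicator {\<omega> \<in> space M. Y0 \<omega> = p} \<omega>)"
      by (intro Bochner_Integration.integral_cong refl part[symmetric])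
    also have "\<dots> = (\<Sum>p\<in>S m. h p * prob {\<omega> \<in> space M. Y0 \<omega> = p})"
      using ev by (subst Bochner_Integration.integral_sum) (auto simp: emeasure_eq_measure)
    finally show ?thesis by simp
  qed
  have "(\<lambda>m. expectation (\<lambda>\<omega>. h (Y0 \<omega>) * indicator (S m) (Y0 \<omega>))) \<longlonglongrightarrow> expectation (\<lambda>\<omega>. h (Y0 \<omega>))"
  proof (rule integral_dominated_convergence[where w = "\<lambda>_. 2 * B"])
    show "AE \<omega> in M. (\<lambda>m. h (Y0 \<omega>) * indicator (S m) (Y0 \<omega>)) \<longlonglongrightarrow> h (Y0 \<omega>)"
    proof (intro AE_I2 tendsto_eventually eventually_sequentiallyI)
      fix \<omega> m assume "Suc (to_nat (Y0 \<omega>)) \<le> m"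
      then show "h (Y0 \<omega>) * indicator (S m) (Y0 \<omega>) = h (Y0 \<omega>)" by (simp add: S_def)
    qed
    show "AE \<omega> in M. norm (h (Y0 \<omega>) * indicator (S m) (Y0 \<omega>)) \<le> 2 * B" for m
      using h order_trans[OF h] by (intro AE_I2) (auto simp: indicator_def)
    show "(\<lambda>\<omega>. h (Y0 \<omega>)) \<in> borel_measurable M" "(\<lambda>\<omega>. h (Y0 \<omega>) * indicator (S m) (Y0 \<omega>)) \<in> borel_measurable M" for m
      by (rule measurable_compose[OF Y0]; simp)+
  qed simp
  from order_tendstoD(1)[OF this, of "expectation (\<lambda>\<omega>. h (Y0 \<omega>)) - \<delta>"] \<delta>
  obtain m where m: "expectation (\<lambda>\<omega>. h (Y0 \<omega>)) - \<delta> < (\<Sum>p\<in>S m. h p * prob {\<omega> \<in> space M. Y0 \<omega> = p})"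
    unfolding part0[symmetric] by (auto simp: eventually_sequentially)
  have "((\<lambda>i. \<Sum>p\<in>S m. h p * measure M' {\<omega> \<in> space M'. Y i \<omega> = p}) \<longlongrightarrow> (\<Sum>p\<in>S m. h p * prob {\<omega> \<in> space M. Y0 \<omega> = p})) Fi"
    by (intro tendsto_sum tendsto_mult tendsto_const lim)
  from order_tendstoD(1)[OF this m] Y show ?thesis
  proof eventually_elim
    case (elim i)
    have evi: "{\<omega> \<in> space M'. Y i \<omega> = p} \<in> M'.events" for p
      using measurable_sets[OF elim(2), of "{p}"] by (simp add: vimage_def Int_def conj_commute)
    have ih: "integrable M' (\<lambda>\<omega>. h (Y i \<omega>))" "integrable M' (\<lambda>\<omega>. g (Y i \<omega>))"
    proof -
      have "(\<lambda>\<omega>. h (Y i \<omega>)) \<in> borel_measurable M'" "(\<lambda>\<omega>. g (Y i \<omega>)) \<in> borel_measurable M'"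
        by (rule measurable_compose[OF elim(2)]; simp)+
      moreover have "AE \<omega> in M'. norm (h (Y i \<omega>)) \<le> 2 * B" "AE \<omega> in M'. norm (g (Y i \<omega>)) \<le> B"
        using h g by (auto intro!: AE_I2)
      ultimately show "integrable M' (\<lambda>\<omega>. h (Y i \<omega>))" "integrable M' (\<lambda>\<omega>. g (Y i \<omega>))"
        by (blast intro: M'.integrable_const_bound)+
    qed
    have "(\<Sum>p\<in>S m. h p * measure M' {\<omega> \<in> space M'. Y i \<omega> = p}) = (\<integral>\<omega>. (\<Sum>p\<in>S m. h p * indicator {\<omega> \<in> space M'. Y i \<omega> = p} \<omega>) \<partial>M')"
      using evi by (subst Bochner_Integration.integral_sum) (auto simp: M'.emeasure_eq_measure)
    also have "\<dots> \<le> (\<integral>\<omega>. h (Y i \<omega>) \<partial>M')"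
    proof (rule integral_mono)
      show "integrable M' (\<lambda>\<omega>. \<Sum>p\<in>S m. h p * indicator {\<omega> \<in> space M'. Y i \<omega> = p} \<omega>)"
        using evi by (intro Bochner_Integration.integrable_sum) (auto simp: M'.emeasure_eq_measure)
      show "(\<Sum>p\<in>S m. h p * indicator {\<omega> \<in> space M'. Y i \<omega> = p} \<omega>) \<le> h (Y i \<omega>)" if "\<omega> \<in> space M'" for \<omega>
        unfolding part[OF that] using h by (auto simp: indicator_def)
    qed (rule ih)
    finally have "expectation (\<lambda>\<omega>. h (Y0 \<omega>)) - \<delta> < (\<integral>\<omega>. h (Y i \<omega>) \<partial>M')" using elim(1) by linarith
    moreover have "(\<integral>\<omega>. h (Y i \<omega>) \<partial>M') = B - (\<integral>\<omega>. g (Y i \<omega>) \<partial>M')"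
      unfolding h_def using ih(2) by (simp add: M'.prob_space)
    moreover have "expectation (\<lambda>\<omega>. h (Y0 \<omega>)) = B - expectation (\<lambda>\<omega>. g (Y0 \<omega>))"
    proof -
      have "integrable M (\<lambda>\<omega>. g (Y0 \<omega>))"
      proof (rule integrable_const_bound[of _ B])
        show "(\<lambda>\<omega>. g (Y0 \<omega>)) \<in> borel_measurable M" by (rule measurable_compose[OF Y0]) simp
      qed (use g in auto)
      then show ?thesis unfolding h_def by (simp add: prob_space)
    qed
    ultimately show ?case by linarith
  qed
qed

section \<open>Continuous functionals approximated by functions of the pattern\<close>

lemma borel_measurable_continuous_map:
  assumes f: "continuous_map T euclideanreal f"
  shows "f \<in> borel_measurable (borel_of T)"
proof (rule borel_measurableI)
  fix S :: "real set" assume "open S"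
  then have "openin T {x \<in> topspace T. f x \<in> S}"
    using f by (auto simp: continuous_map_def)
  moreover have P: "{U. openin T U} \<subseteq> Pow (topspace T)" using openin_subset by auto
  ultimately have "{x \<in> topspace T. f x \<in> S} \<in> sets (borel_of T)"
    unfolding borel_of_def sets_measure_of[OF P] by (intro sigma_sets.Basic) simp
  moreover have "{x \<in> topspace T. f x \<in> S} = f -` S \<inter> space (borel_of T)"
    by (auto simp: borel_of_def space_measure_of[OF P])
  ultimately show "f -` S \<inter> space (borel_of T) \<in> sets (borel_of T)" by simp
qed

text \<open>The least function of the pattern that lies above f on counting paths. The value 0 at
  patterns of no path preserves the bound of f.\<close>

definition pattern_sup :: "((real \<Rightarrow> real) \<Rightarrow> real) \<Rightarrow> nat \<Rightarrow> nat list \<times> nat \<Rightarrow> real" where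
  "pattern_sup f n p = (if \<exists>y. counting_path y \<and> pattern n y = p
     then Sup {f (real_path y) |y. counting_path y \<and> pattern n y = p} else 0)"

lemma pattern_sup:
  assumes f: "\<And>x. x \<in> cadlag \<Longrightarrow> \<bar>f x\<bar> \<le> B"
  shows "\<bar>pattern_sup f n p\<bar> \<le> B"
    and "counting_path x \<Longrightarrow> f (real_path x) \<le> pattern_sup f n (pattern n x)"
    and "counting_path x \<Longrightarrow> (\<And>y. counting_path y \<Longrightarrow> pattern n y = pattern n x \<Longrightarrow> f (real_path y) \<le> c)
      \<Longrightarrow> pattern_sup f n (pattern n x) \<le> c"
proof -
  have fB: "f (real_path y) \<le> B" "- B \<le> f (real_path y)" if "counting_path y" for y
    using f[OF real_path_cadlag[OF that]] by auto
  have bdd: "bdd_above {f (real_path y) |y. counting_path y \<and> pattern n y = p}" for p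
    by (rule bdd_aboveI[of _ B]) (use fB in auto)
  have upper: "f (real_path x) \<le> pattern_sup f n (pattern n x)" if "counting_path x" for x
    unfolding pattern_sup_def using that by (auto intro!: cSup_upper bdd)
  have least: "pattern_sup f n (pattern n x) \<le> c"
    if "counting_path x" "\<And>y. counting_path y \<Longrightarrow> pattern n y = pattern n x \<Longrightarrow> f (real_path y) \<le> c" for x c
    unfolding pattern_sup_def using that by (auto intro!: cSup_least)
  show "counting_path x \<Longrightarrow> f (real_path x) \<le> pattern_sup f n (pattern n x)" by (rule upper)
  show "counting_path x \<Longrightarrow> (\<And>y. counting_path y \<Longrightarrow> pattern n y = pattern n x \<Longrightarrow> f (real_path y) \<le> c)
      \<Longrightarrow> pattern_sup f n (pattern n x) \<le> c" by (rule least)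
  show "\<bar>pattern_sup f n p\<bar> \<le> B"
  proof (cases "\<exists>y. counting_path y \<and> pattern n y = p")
    case True
    then obtain y where y: "counting_path y" "p = pattern n y" by auto
    have "pattern_sup f n p \<le> B" unfolding y(2) using fB by (intro least y(1))
    moreover have "- B \<le> pattern_sup f n p" unfolding y(2) using fB(2)[OF y(1)] upper[OF y(1)] by linarith
    ultimately show ?thesis by (simp add: abs_le_iff)
  next
    case False
    have "counting_path (\<lambda>_. 0)" by (auto simp: counting_path_def mono_on_def)
    moreover have "pattern_sup f n p = 0" unfolding pattern_sup_def by (rule if_not_P[OF False])
    ultimately show ?thesis using fB[of "\<lambda>_. 0"] by simp
  qed
qed

text \<open>The approximation lies above f at every n. In the other direction, the set where f is
  below an intermediate \<open>c'\<close> is open and so finally contains the whole pattern class of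
  x.\<close>

lemma pattern_sup_tendsto:
  assumes f: "\<And>x. x \<in> cadlag \<Longrightarrow> \<bar>f x\<bar> \<le> B" and c: "continuous_map skorohod_J1 euclideanreal f"
    and x: "counting_path x"
  shows "(\<lambda>n. pattern_sup f n (pattern n x)) \<longlonglongrightarrow> f (real_path x)"
proof (rule order_tendstoI)
  fix a assume "a < f (real_path x)"
  then show "\<forall>\<^sub>F n in sequentially. a < pattern_sup f n (pattern n x)"
    using pattern_sup(2)[where f = f, OF f x] by (intro always_eventually allI) (rule less_le_trans)
next
  fix a assume "f (real_path x) < a"
  then obtain c' where c': "f (real_path x) < c'" "c' < a" using dense by blast
  define U where "U = {z \<in> topspace skorohod_J1. f z \<in> {..<c'}}"
  have "\<forall>S. open S \<longrightarrow> openin skorohod_J1 {z \<in> topspace skorohod_J1. f z \<in> S}"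
    using c by (simp add: continuous_map_def)
  then have "openin skorohod_J1 U" unfolding U_def by (rule allE[of _ "{..<c'}"]) simp
  then have U: "J1_open U" by (simp add: openin_skorohod_J1)
  have "real_path x \<in> U" using c' real_path_cadlag[OF x] by (simp add: U_def topspace_skorohod_J1)
  from eventually_pattern_in_open[OF U x this]
  show "\<forall>\<^sub>F n in sequentially. pattern_sup f n (pattern n x) < a"
  proof (rule eventually_mono)
    fix n assume n: "\<forall>y. counting_path y \<longrightarrow> pattern n y = pattern n x \<longrightarrow> real_path y \<in> U"
    have "pattern_sup f n (pattern n x) \<le> c'"
      by (rule pattern_sup(3)[where f = f, OF f x]) (use n in \<open>auto simp: U_def\<close>)
    then show "pattern_sup f n (pattern n x) < a" using c'(2) by simp
  qed
qed

text \<open>The grid level n is fixed by dominated convergence for the limit \<open>X0\<close>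
  alone, before i. For the family, \<open>pattern_sup f n\<close> only has to lie above f, which it
  does on every counting path.\<close>

lemma (in prob_space) eventually_path_expectation_le:
  fixes X :: "'i \<Rightarrow> 'b \<Rightarrow> real \<Rightarrow> nat" and X0 :: "'a \<Rightarrow> real \<Rightarrow> nat"
  assumes M': "prob_space M'"
    and X: "\<forall>\<^sub>F i in Fi. (\<forall>\<omega>\<in>space M'. counting_path (X i \<omega>)) \<and> (\<forall>t\<ge>0. (\<lambda>\<omega>. X i \<omega> t) \<in> M' \<rightarrow>\<^sub>M count_space UNIV)"
    and X0: "\<And>\<omega>. \<omega> \<in> space M \<Longrightarrow> counting_path (X0 \<omega>)" "\<And>t. 0 \<le> t \<Longrightarrow> (\<lambda>\<omega>. X0 \<omega> t) \<in> M \<rightarrow>\<^sub>M count_space UNIV"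
    and lim: "\<And>n p. ((\<lambda>i. measure M' {\<omega> \<in> space M'. pattern n (X i \<omega>) = p}) \<longlongrightarrow> prob {\<omega> \<in> space M. pattern n (X0 \<omega>) = p}) Fi"
    and f: "continuous_map skorohod_J1 euclideanreal f" "\<And>x. x \<in> cadlag \<Longrightarrow> \<bar>f x\<bar> \<le> B" and \<delta>: "0 < \<delta>"
  shows "\<forall>\<^sub>F i in Fi. (\<integral>\<omega>. f (real_path (X i \<omega>)) \<partial>M') \<le> expectation (\<lambda>\<omega>. f (real_path (X0 \<omega>))) + \<delta>"
proof -
  interpret M': prob_space M' by fact
  have pm0: "(\<lambda>\<omega>. pattern n (X0 \<omega>)) \<in> M \<rightarrow>\<^sub>M count_space UNIV" for n by (rule measurable_pattern[OF X0])
  have "(\<lambda>n. expectation (\<lambda>\<omega>. pattern_sup f n (pattern n (X0 \<omega>)))) \<longlonglongrightarrow> expectation (\<lambda>\<omega>. f (real_path (X0 \<omega>)))"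
  proof (rule integral_dominated_convergence[where w = "\<lambda>_. B"])
    show "(\<lambda>\<omega>. f (real_path (X0 \<omega>))) \<in> borel_measurable M"
      by (rule measurable_compose[OF measurable_real_path[OF X0] borel_measurable_continuous_map[OF f(1)]])
    show "(\<lambda>\<omega>. pattern_sup f n (pattern n (X0 \<omega>))) \<in> borel_measurable M" for n
      by (rule measurable_compose[OF pm0]) simp
    show "AE \<omega> in M. (\<lambda>n. pattern_sup f n (pattern n (X0 \<omega>))) \<longlonglongrightarrow> f (real_path (X0 \<omega>))"
      by (intro AE_I2 pattern_sup_tendsto[OF f(2,1)] X0)
    show "AE \<omega> in M. norm (pattern_sup f n (pattern n (X0 \<omega>))) \<le> B" for n
      using pattern_sup(1)[where f = f, OF f(2)] by (intro AE_I2) simp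
  qed simp
  from order_tendstoD(2)[OF this, of "expectation (\<lambda>\<omega>. f (real_path (X0 \<omega>))) + \<delta> / 2"] \<delta>
  obtain n where n: "expectation (\<lambda>\<omega>. pattern_sup f n (pattern n (X0 \<omega>))) < expectation (\<lambda>\<omega>. f (real_path (X0 \<omega>))) + \<delta> / 2"
    by (auto simp: eventually_sequentially)
  have "\<forall>\<^sub>F i in Fi. (\<lambda>\<omega>. pattern n (X i \<omega>)) \<in> M' \<rightarrow>\<^sub>M count_space UNIV"
    using X by (rule eventually_mono) (intro measurable_pattern, auto)
  from eventually_expectation_le[OF M' pm0 this lim pattern_sup(1)[where f = f, OF f(2)], of "\<delta> / 2"] \<delta>
  have "\<forall>\<^sub>F i in Fi. (\<integral>\<omega>. pattern_sup f n (pattern n (X i \<omega>)) \<partial>M') \<le> expectation (\<lambda>\<omega>. pattern_sup f n (pattern n (X0 \<omega>))) + \<delta> / 2"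
    by simp
  then show ?thesis using X
  proof eventually_elim
    case (elim i)
    have cp: "\<And>\<omega>. \<omega> \<in> space M' \<Longrightarrow> counting_path (X i \<omega>)" and me: "\<And>t. 0 \<le> t \<Longrightarrow> (\<lambda>\<omega>. X i \<omega> t) \<in> M' \<rightarrow>\<^sub>M count_space UNIV"
      using elim(2) by auto
    have "(\<integral>\<omega>. f (real_path (X i \<omega>)) \<partial>M') \<le> (\<integral>\<omega>. pattern_sup f n (pattern n (X i \<omega>)) \<partial>M')"
    proof (rule integral_mono)
      show "integrable M' (\<lambda>\<omega>. f (real_path (X i \<omega>)))"
        using f(2)[OF real_path_cadlag[OF cp]]
        by (intro M'.integrable_const_bound[of _ B] measurable_compose[OF measurable_real_path[OF cp me] borel_measurable_continuous_map[OF f(1)]])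
           auto
      show "integrable M' (\<lambda>\<omega>. pattern_sup f n (pattern n (X i \<omega>)))"
        using pattern_sup(1)[where f = f, OF f(2)]
        by (intro M'.integrable_const_bound[of _ B] measurable_compose[OF measurable_pattern[OF cp me]]) auto
      show "f (real_path (X i \<omega>)) \<le> pattern_sup f n (pattern n (X i \<omega>))" if "\<omega> \<in> space M'" for \<omega>
        by (rule pattern_sup(2)[where f = f, OF f(2) cp[OF that]])
    qed
    then show ?case using elim(1) n by linarith
  qed
qed

lemma (in prob_space) path_expectation_tendsto:
  fixes X :: "'i \<Rightarrow> 'b \<Rightarrow> real \<Rightarrow> nat" and X0 :: "'a \<Rightarrow> real \<Rightarrow> nat"
  assumes M': "prob_space M'"
    and X: "\<forall>\<^sub>F i in Fi. (\<forall>\<omega>\<in>space M'. counting_path (X i \<omega>)) \<and> (\<forall>t\<ge>0. (\<lambda>\<omega>. X i \<omega> t) \<in> M' \<rightarrow>\<^sub>M count_space UNIV)"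
    and X0: "\<And>\<omega>. \<omega> \<in> space M \<Longrightarrow> counting_path (X0 \<omega>)" "\<And>t. 0 \<le> t \<Longrightarrow> (\<lambda>\<omega>. X0 \<omega> t) \<in> M \<rightarrow>\<^sub>M count_space UNIV"
    and lim: "\<And>n p. ((\<lambda>i. measure M' {\<omega> \<in> space M'. pattern n (X i \<omega>) = p}) \<longlongrightarrow> prob {\<omega> \<in> space M. pattern n (X0 \<omega>) = p}) Fi"
    and f: "continuous_map skorohod_J1 euclideanreal f" "bounded (f ` topspace skorohod_J1)"
  shows "((\<lambda>i. \<integral>\<omega>. f (real_path (X i \<omega>)) \<partial>M') \<longlongrightarrow> expectation (\<lambda>\<omega>. f (real_path (X0 \<omega>)))) Fi"
proof -
  obtain B where B: "\<And>x. x \<in> cadlag \<Longrightarrow> \<bar>f x\<bar> \<le> B"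
    using f(2) by (auto simp: bounded_iff topspace_skorohod_J1)
  have nf: "continuous_map skorohod_J1 euclideanreal (\<lambda>x. - f x)" using f(1) by (rule continuous_map_minus)
  have nB: "\<And>x. x \<in> cadlag \<Longrightarrow> \<bar>- f x\<bar> \<le> B" using B by simp
  show ?thesis
  proof (rule tendstoI)
    fix e :: real assume e: "0 < e"
    then have e2: "0 < e / 2" by simp
    have "\<forall>\<^sub>F i in Fi. (\<integral>\<omega>. f (real_path (X i \<omega>)) \<partial>M') \<le> expectation (\<lambda>\<omega>. f (real_path (X0 \<omega>))) + e / 2"
      by (rule eventually_path_expectation_le[OF M' X X0 lim f(1) B e2])
    moreover have "\<forall>\<^sub>F i in Fi. (\<integral>\<omega>. - f (real_path (X i \<omega>)) \<partial>M') \<le> expectation (\<lambda>\<omega>. - f (real_path (X0 \<omega>))) + e / 2"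
      by (rule eventually_path_expectation_le[OF M' X X0 lim nf nB e2])
    ultimately show "\<forall>\<^sub>F i in Fi. dist (\<integral>\<omega>. f (real_path (X i \<omega>)) \<partial>M') (expectation (\<lambda>\<omega>. f (real_path (X0 \<omega>)))) < e"
    proof eventually_elim
      case (elim i)
      then show ?case using e by (auto simp: dist_real_def abs_less_iff)
    qed
  qed
qed

text \<open>The condition that jumps have size at most 1, expressed by attained values because
  patterns record the range: for a counting path without skips the range on \<open>[0, n]\<close> is
  determined by \<open>x n\<close>.\<close>

definition no_skip :: "(real \<Rightarrow> nat) \<Rightarrow> bool" where
  "no_skip x \<longleftrightarrow> (\<forall>t\<ge>0. \<forall>k\<le>x t. \<exists>s\<in>{0..t}. x s = k)"

lemma no_skip_image:
  assumes x: "counting_path x" "no_skip x" and t: "0 \<le> t"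
  shows "x ` {0..t} = {..x t}"
proof
  show "x ` {0..t} \<subseteq> {..x t}" using counting_path_mono[OF x(1)] by auto
  show "{..x t} \<subseteq> x ` {0..t}" using x(2) t by (force simp: no_skip_def)
qed

lemma simple_path_no_skip:
  assumes x: "counting_path x" "simple_path x"
  shows "no_skip x"
  unfolding no_skip_def
proof (intro allI impI)
  fix t k assume t: "0 \<le> t" and k: "k \<le> x t"
  show "\<exists>s\<in>{0..t}. x s = k"
  proof (cases "k = 0")
    case True
    then show ?thesis using x(1) t by (intro bexI[of _ 0]) (auto simp: counting_path_def)
  next
    case False
    then have k0: "0 < k" by simp
    let ?s = "first_passage (\<lambda>t. real (x t)) (real k)"
    have "x ?s = k" by (rule simple_path_first_passage[OF x t k k0])
    moreover have "0 < ?s" "?s \<le> t"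
      using first_passage_bounds[OF inc_path_of_counting_path[OF x(1)] t, of "real k"] k k0 by auto
    ultimately show ?thesis by (intro bexI[of _ ?s]) auto
  qed
qed

text \<open>The grid cell that contains the passage time of the skipped value carries the large
  increment: below k at its left end, above k at its right end.\<close>

lemma skip_increment:
  assumes x: "counting_path x" and skip: "0 \<le> t" "k \<le> x t" "\<And>s. s \<in> {0..t} \<Longrightarrow> x s \<noteq> k"
    and T: "t \<le> real T"
  shows "\<exists>j<T * 2 ^ n. 2 \<le> x (real (Suc j) / 2 ^ n) - x (real j / 2 ^ n)"
proof -
  have k0: "0 < k" using skip(3)[of 0] skip(1) x by (auto simp: counting_path_def)
  define \<sigma> where "\<sigma> = first_passage (\<lambda>t. real (x t)) (real k)"
  have le: "\<sigma> \<le> r \<longleftrightarrow> k \<le> x r" if "0 \<le> r" for r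
    using first_passage_le_iff[OF inc_path_of_counting_path[OF x] skip(1), of "real k" r] skip(2) that
    by (simp add: \<sigma>_def)
  have s: "0 < \<sigma>" "\<sigma> \<le> t"
    using first_passage_bounds[OF inc_path_of_counting_path[OF x] skip(1), of "real k"] skip(2) k0 by (auto simp: \<sigma>_def)
  have "k \<le> x \<sigma>" using le[of \<sigma>] s by simp
  then have big: "Suc k \<le> x \<sigma>" using skip(3)[of \<sigma>] s by simp
  \<comment> \<open>The cell is open on the left and closed on the right, hence the
    \<open>- 1\<close> after the ceiling; the ceiling is positive because \<open>\<sigma>\<close>
    is.\<close>
  define j where "j = nat \<lceil>\<sigma> * 2 ^ n\<rceil> - 1"
  have pos: "0 < \<sigma> * 2 ^ n" using s by simp
  then have j1: "real (Suc j) = of_int \<lceil>\<sigma> * 2 ^ n\<rceil>" unfolding j_def by (simp add: zero_less_ceiling)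
  have j: "real j < \<sigma> * 2 ^ n" "\<sigma> * 2 ^ n \<le> real (Suc j)" using j1 by linarith+
  have jj: "real j / 2 ^ n < \<sigma>" "\<sigma> \<le> real (Suc j) / 2 ^ n" using j by (simp_all add: field_simps)
  have "\<sigma> * 2 ^ n \<le> real T * 2 ^ n" using s T by simp
  then have "real j < real T * 2 ^ n" using j(1) by linarith
  then have "real j < real (T * 2 ^ n)" by simp
  then have "j < T * 2 ^ n" by (simp only: of_nat_less_iff)
  moreover have "x (real j / 2 ^ n) < k" using le[of "real j / 2 ^ n"] jj by simp
  moreover have "Suc k \<le> x (real (Suc j) / 2 ^ n)"
    using counting_path_mono[OF x, of \<sigma> "real (Suc j) / 2 ^ n"] jj s big by linarith
  ultimately show ?thesis by (intro exI[of _ j]) auto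
qed

text \<open>Quadratic in u, so that over \<open>T * 2 ^ n\<close> cells of width
  \<open>1 / 2 ^ n\<close> the total is of order \<open>1 / 2 ^ n\<close>.\<close>

lemma poisson_pmf_ge_2:
  assumes u: "0 < u" shows "measure (measure_pmf (poisson_pmf u)) {2..} \<le> u\<^sup>2"
proof -
  have "measure (measure_pmf (poisson_pmf u)) {2..} = 1 - measure (measure_pmf (poisson_pmf u)) {0, 1}"
  proof -
    have "{2..} = space (measure_pmf (poisson_pmf u)) - {0, 1}" by auto
    then show ?thesis by (simp only: measure_pmf.prob_compl sets_measure_pmf UNIV_I)
  qed
  also have "\<dots> = 1 - exp (- u) * (1 + u)"
    using u by (simp add: measure_measure_pmf_finite algebra_simps)
  also have "\<dots> \<le> 1 - (1 - u) * (1 + u)"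
    using exp_ge_add_one_self[of "- u"] u by (intro diff_left_mono mult_right_mono) auto
  finally show ?thesis by (simp add: power2_eq_square algebra_simps)
qed

section \<open>Increments and jumps of the Poisson process\<close>

locale poisson = prob_space M for M :: "'b measure" +
  fixes N :: "real \<Rightarrow> 'b \<Rightarrow> nat" and lam :: real
  assumes poisson: "is_poisson_process M N lam" and lam: "0 < lam"
begin

lemma cpath: "\<omega> \<in> space M \<Longrightarrow> counting_path (\<lambda>t. N t \<omega>)"
  and Nmeas: "0 \<le> t \<Longrightarrow> N t \<in> M \<rightarrow>\<^sub>M count_space UNIV"
  using poisson by (auto simp: is_poisson_process_def)

lemma increment_prob:
  assumes "0 \<le> s" "s < t"
  shows "prob {\<omega> \<in> space M. N t \<omega> - N s \<omega> \<in> S} = measure (measure_pmf (poisson_pmf (lam * (t - s)))) S"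
    and "{\<omega> \<in> space M. N t \<omega> - N s \<omega> \<in> S} \<in> events"
proof -
  have m: "(\<lambda>\<omega>. N t \<omega> - N s \<omega>) \<in> M \<rightarrow>\<^sub>M count_space UNIV"
    using assms by (intro measurable_diff_count_space Nmeas) auto
  have d: "distr M (count_space UNIV) (\<lambda>\<omega>. N t \<omega> - N s \<omega>) = measure_pmf (poisson_pmf (lam * (t - s)))"
    using poisson assms by (auto simp: is_poisson_process_def)
  show "prob {\<omega> \<in> space M. N t \<omega> - N s \<omega> \<in> S} = measure (measure_pmf (poisson_pmf (lam * (t - s)))) S"
    unfolding d[symmetric] using m by (subst measure_distr) (auto simp: vimage_def Int_def conj_commute)
  show "{\<omega> \<in> space M. N t \<omega> - N s \<omega> \<in> S} \<in> events"
    using measurable_sets[OF m, of S] by (simp add: vimage_def Int_def conj_commute)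
qed

lemma poisson_fdd:
  assumes a: "0 \<le> a 0" "\<And>j. a j < a (Suc j)"
  shows "prob {\<omega> \<in> space M. \<forall>j<J. N (a (Suc j)) \<omega> - N (a j) \<omega> = d j} = (\<Prod>j<J. pois (lam * (a (Suc j) - a j)) (d j))"
proof (cases "J = 0")
  case True
  then show ?thesis by (simp add: prob_space)
next
  case False
  have a0: "0 \<le> a j" for j using a by (induction j) (auto intro: less_imp_le order_trans)
  have "mono a" using a(2) by (intro incseq_SucI less_imp_le)
  then have "mono_on {..J} a" by (auto simp: mono_on_def mono_def)
  then have "indep_vars (\<lambda>_. count_space UNIV) (\<lambda>i \<omega>. N (a (Suc i)) \<omega> - N (a i) \<omega>) {..<J}"
    using poisson a(1) by (auto simp: is_poisson_process_def)
  from indep_varsD_finite[OF this, of "\<lambda>j. {d j}"] False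
  have "prob (\<Inter>j\<in>{..<J}. (\<lambda>\<omega>. N (a (Suc j)) \<omega> - N (a j) \<omega>) -` {d j} \<inter> space M)
    = (\<Prod>j<J. prob ((\<lambda>\<omega>. N (a (Suc j)) \<omega> - N (a j) \<omega>) -` {d j} \<inter> space M))" by auto
  also have "(\<Inter>j\<in>{..<J}. (\<lambda>\<omega>. N (a (Suc j)) \<omega> - N (a j) \<omega>) -` {d j} \<inter> space M)
    = {\<omega> \<in> space M. \<forall>j<J. N (a (Suc j)) \<omega> - N (a j) \<omega> = d j}" using False by auto
  also have "(\<Prod>j<J. prob ((\<lambda>\<omega>. N (a (Suc j)) \<omega> - N (a j) \<omega>) -` {d j} \<inter> space M)) = (\<Prod>j<J. pois (lam * (a (Suc j) - a j)) (d j))"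
  proof (rule prod.cong[OF refl])
    fix j
    have "0 < lam * (a (Suc j) - a j)" using lam a(2)[of j] by simp
    then show "prob ((\<lambda>\<omega>. N (a (Suc j)) \<omega> - N (a j) \<omega>) -` {d j} \<inter> space M) = pois (lam * (a (Suc j) - a j)) (d j)"
      using increment_prob(1)[OF a0 a(2), of j "{d j}"]
      by (simp add: vimage_def Int_def conj_commute measure_pmf_single pois_def)
  qed
  finally show ?thesis .
qed

text \<open>\<open>is_poisson_process\<close> prescribes the law of the increments but not unit
  jumps. A path that skips a value by time T lies in \<open>B T n\<close> for every n, while the
  probability of \<open>B T n\<close> is at most \<open>T * lam ^ 2 / 2 ^ n\<close>.\<close>

lemma poisson_no_skip: "AE \<omega> in M. no_skip (\<lambda>t. N t \<omega>)"
proof -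
  define C where "C n j = {\<omega> \<in> space M. N (real (Suc j) / 2 ^ n) \<omega> - N (real j / 2 ^ n) \<omega> \<in> {2..}}" for n j :: nat
  define B where "B T n = (\<Union>j\<in>{..<T * 2 ^ n}. C n j)" for T n :: nat
  have grid: "real j / 2 ^ n < real (Suc j) / 2 ^ n" "0 \<le> real j / 2 ^ n" for j n :: nat
    by (simp_all add: divide_strict_right_mono)
  have Ce: "C n j \<in> events" for n j
    unfolding C_def by (rule increment_prob(2)[OF grid(2,1)])
  have Be: "B T n \<in> events" for T n
    unfolding B_def using Ce by (intro sets.finite_UN) auto
  have Bp: "prob (B T n) \<le> (real T * lam\<^sup>2) * (1 / 2) ^ n" for T n
  proof -
    have "prob (B T n) \<le> (\<Sum>j\<in>{..<T * 2 ^ n}. prob (C n j))"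
      unfolding B_def using Ce by (intro finite_measure_subadditive_finite) auto
    also have "\<dots> \<le> (\<Sum>j\<in>{..<T * 2 ^ n}. (lam / 2 ^ n)\<^sup>2)"
    proof (rule sum_mono)
      fix j
      have w: "lam * (real (Suc j) / 2 ^ n - real j / 2 ^ n) = lam / 2 ^ n" by (simp add: field_simps)
      show "prob (C n j) \<le> (lam / 2 ^ n)\<^sup>2"
        unfolding C_def increment_prob(1)[OF grid(2,1)] w using lam by (intro poisson_pmf_ge_2) simp
    qed
    also have "\<dots> = (real T * lam\<^sup>2) * (1 / 2) ^ n" by (simp add: power2_eq_square field_simps power_divide)
    finally show ?thesis .
  qed
  have null: "(\<Inter>n. B T n) \<in> null_sets M" for T
  proof -
    have "prob (\<Inter>n. B T n) \<le> 0"
    proof (rule LIMSEQ_le_const)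
      show "(\<lambda>n. (real T * lam\<^sup>2) * (1 / 2) ^ n) \<longlonglongrightarrow> 0"
        by (intro tendsto_mult_right_zero LIMSEQ_realpow_zero) auto
      show "\<exists>n0. \<forall>n\<ge>n0. prob (\<Inter>n. B T n) \<le> (real T * lam\<^sup>2) * (1 / 2) ^ n"
        using Bp Be by (intro exI allI impI order_trans[OF finite_measure_mono Bp]) auto
    qed
    then have "prob (\<Inter>n. B T n) = 0" using measure_nonneg by (rule antisym)
    moreover have "(\<Inter>n. B T n) \<in> events" using Be by (intro sets.countable_INT) auto
    ultimately show ?thesis by (simp add: null_sets_def emeasure_eq_measure)
  qed
  have "AE \<omega> in M. \<forall>T. \<omega> \<notin> (\<Inter>n. B T n)"
    unfolding AE_all_countable using AE_not_in[OF null] by blast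
  then show ?thesis
    using AE_space
  proof eventually_elim
    case (elim \<omega>)
    note w = elim(2)
    show ?case
    proof (rule ccontr)
      assume "\<not> no_skip (\<lambda>t. N t \<omega>)"
      then obtain t k where tk: "0 \<le> t" "k \<le> N t \<omega>" "\<And>s. s \<in> {0..t} \<Longrightarrow> N s \<omega> \<noteq> k"
        by (auto simp: no_skip_def)
      obtain T where T: "t \<le> real T" using real_arch_simple by blast
      have "\<omega> \<in> B T n" for n
        using skip_increment[OF cpath[OF w] tk T, of n] w by (auto simp: B_def C_def)
      then show False using elim(1) by blast
    qed
  qed
qed

end

section \<open>Pattern probabilities as probabilities of grid increments\<close>

definition consistent :: "nat \<Rightarrow> nat list \<times> nat \<Rightarrow> bool" where
  "consistent n p \<longleftrightarrow> length (fst p) = Suc (n * 2 ^ n) \<and> fst p ! 0 = 0 \<and>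
     (\<forall>j<n * 2 ^ n. fst p ! j \<le> fst p ! Suc j) \<and> snd p = set_encode {..fst p ! (n * 2 ^ n)}"

text \<open>Without skipped values the second component of the pattern is a function of the last
  grid value, so the increments determine everything. The monotonicity in \<open>consistent\<close>
  makes truncated subtraction invertible when the values are summed up again.\<close>

lemma pattern_eq_iff_increments:
  assumes x: "counting_path x" "no_skip x"
  shows "pattern n x = p \<longleftrightarrow> consistent n p \<and>
    (\<forall>j<n * 2 ^ n. x (real (Suc j) / 2 ^ n) - x (real j / 2 ^ n) = fst p ! Suc j - fst p ! j)"
proof -
  let ?J = "n * 2 ^ n"
  let ?x = "\<lambda>j. x (real j / 2 ^ n)"
  have x0: "?x 0 = 0" using x(1) by (simp add: counting_path_def)
  have xm: "?x j \<le> ?x (Suc j)" for j by (rule counting_path_mono[OF x(1)]) (auto simp: divide_right_mono)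
  have xJ: "?x ?J = x (real n)" by simp
  have img: "x ` {0..real n} = {..x (real n)}" using no_skip_image[OF x] by simp
  have eq: "pattern n x = p \<longleftrightarrow> length (fst p) = Suc ?J \<and> (\<forall>j\<le>?J. ?x j = fst p ! j) \<and> snd p = set_encode {..x (real n)}"
    by (cases p) (auto simp: pattern_def img list_eq_iff_nth_eq less_Suc_eq_le simp del: upt_Suc)
  show ?thesis
  proof
    assume "pattern n x = p"
    then have p: "length (fst p) = Suc ?J" "\<And>j. j \<le> ?J \<Longrightarrow> fst p ! j = ?x j" "snd p = set_encode {..x (real n)}"
      using eq by auto
    show "consistent n p \<and> (\<forall>j<?J. ?x (Suc j) - ?x j = fst p ! Suc j - fst p ! j)"
      unfolding consistent_def using p(1,3) p(2)[of 0] p(2)[of ?J] p(2) x0 xm xJ by (auto simp: Suc_le_eq)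
  next
    assume c: "consistent n p \<and> (\<forall>j<?J. ?x (Suc j) - ?x j = fst p ! Suc j - fst p ! j)"
    have all: "?x j = fst p ! j" if "j \<le> ?J" for j
      using that
    proof (induction j)
      case 0
      then show ?case using c x0 by (simp add: consistent_def)
    next
      case (Suc j)
      then have "fst p ! j \<le> fst p ! Suc j" "?x j = fst p ! j"
        using c by (auto simp: consistent_def)
      moreover have "?x (Suc j) - ?x j = fst p ! Suc j - fst p ! j"
        using Suc.prems by (intro c[THEN conjunct2, rule_format]) simp
      ultimately show ?case using xm[of j] by linarith
    qed
    have "fst p ! ?J = x (real n)" using all[of ?J] xJ by simp
    then show "pattern n x = p" unfolding eq using c all by (auto simp: consistent_def)
  qed
qed

text \<open>Inconsistent patterns are null for every process without skips, so only increment events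
  remain to be compared between the thinned and the Poisson process.\<close>

lemma (in prob_space) pattern_prob:
  assumes cp: "\<And>\<omega>. \<omega> \<in> space M \<Longrightarrow> counting_path (\<lambda>t. X t \<omega>)"
    and meas: "\<And>t. 0 \<le> t \<Longrightarrow> X t \<in> M \<rightarrow>\<^sub>M count_space UNIV"
    and ns: "AE \<omega> in M. no_skip (\<lambda>t. X t \<omega>)"
  shows "prob {\<omega> \<in> space M. pattern n (\<lambda>t. X t \<omega>) = p} = (if consistent n p then
    prob {\<omega> \<in> space M. \<forall>j<n * 2 ^ n. X (real (Suc j) / 2 ^ n) \<omega> - X (real j / 2 ^ n) \<omega> = fst p ! Suc j - fst p ! j} else 0)"
proof -
  let ?E = "{\<omega> \<in> space M. \<forall>j<n * 2 ^ n. X (real (Suc j) / 2 ^ n) \<omega> - X (real j / 2 ^ n) \<omega> = fst p ! Suc j - fst p ! j}"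
  have pe: "{\<omega> \<in> space M. pattern n (\<lambda>t. X t \<omega>) = p} \<in> events"
    using measurable_sets[OF measurable_pattern[of M "\<lambda>\<omega> t. X t \<omega>" n, OF cp meas], of "{p}"]
    by (simp add: vimage_def Int_def conj_commute)
  have "{\<omega> \<in> space M. X (real (Suc j) / 2 ^ n) \<omega> - X (real j / 2 ^ n) \<omega> = c} \<in> events" for j c
  proof -
    have "(\<lambda>\<omega>. X (real (Suc j) / 2 ^ n) \<omega> - X (real j / 2 ^ n) \<omega>) \<in> M \<rightarrow>\<^sub>M count_space UNIV"
      by (intro measurable_diff_count_space meas) simp_all
    from measurable_sets[OF this, of "{c}"] show ?thesis by (simp add: vimage_def Int_def conj_commute)
  qed
  then have "{\<omega> \<in> space M. \<forall>j\<in>{..<n * 2 ^ n}. X (real (Suc j) / 2 ^ n) \<omega> - X (real j / 2 ^ n) \<omega> = fst p ! Suc j - fst p ! j} \<in> events"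
    by (intro sets.sets_Collect_finite_All) auto
  also have "{\<omega> \<in> space M. \<forall>j\<in>{..<n * 2 ^ n}. X (real (Suc j) / 2 ^ n) \<omega> - X (real j / 2 ^ n) \<omega> = fst p ! Suc j - fst p ! j} = ?E"
    by blast
  finally have Ee: "?E \<in> events" .
  have "prob {\<omega> \<in> space M. pattern n (\<lambda>t. X t \<omega>) = p} = prob (if consistent n p then ?E else {})"
  proof (rule finite_measure_eq_AE)
    show "AE \<omega> in M. (\<omega> \<in> {\<omega> \<in> space M. pattern n (\<lambda>t. X t \<omega>) = p}) = (\<omega> \<in> (if consistent n p then ?E else {}))"
      using ns
    proof eventually_elim
      case (elim \<omega>)
      then show ?case using pattern_eq_iff_increments[OF cp elim, of n p] by auto
    qed
    show "{\<omega> \<in> space M. pattern n (\<lambda>t. X t \<omega>) = p} \<in> events" by (rule pe)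
    show "(if consistent n p then ?E else {}) \<in> events"
      using Ee by (cases "consistent n p") (simp_all only: if_True if_False sets.empty_sets)
  qed
  then show ?thesis by simp
qed

section \<open>Paths of the thinned process\<close>

context thinning_family
begin

lemma thinned_counting_path:
  assumes e: "0 < \<epsilon>" and w: "\<omega> \<in> space M"
  shows "counting_path (\<lambda>t. thinned N \<beta> \<epsilon> t \<omega>)"
  unfolding counting_path_def
proof (intro conjI allI impI)
  show "thinned N \<beta> \<epsilon> 0 \<omega> = 0" using cpath[OF w] by (simp add: thinned_def counting_path_def)
  show "mono_on {0..} (\<lambda>t. thinned N \<beta> \<epsilon> t \<omega>)"
  proof (rule mono_onI)
    fix s t :: real assume st: "s \<in> {0..}" "t \<in> {0..}" "s \<le> t"
    have "N (s / \<epsilon>) \<omega> \<le> N (t / \<epsilon>) \<omega>"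
      using st e by (intro counting_path_mono[OF cpath[OF w]]) (auto simp: divide_right_mono)
    then show "thinned N \<beta> \<epsilon> s \<omega> \<le> thinned N \<beta> \<epsilon> t \<omega>" unfolding thinned_def by (intro sum_mono2) auto
  qed
  fix t :: real assume t: "0 \<le> t"
  obtain b where b: "t / \<epsilon> < b" "\<And>s. t / \<epsilon> \<le> s \<Longrightarrow> s < b \<Longrightarrow> N s \<omega> = N (t / \<epsilon>) \<omega>"
    using counting_path_right[OF cpath[OF w], of "t / \<epsilon>"] t e by auto
  have "\<forall>\<^sub>F s in at_right t. thinned N \<beta> \<epsilon> s \<omega> = thinned N \<beta> \<epsilon> t \<omega>"
    unfolding eventually_at_right_field
  proof (intro exI[of _ "b * \<epsilon>"] conjI allI impI)
    show "t < b * \<epsilon>" using b(1) e by (simp add: field_simps)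
    fix s assume "t < s" "s < b * \<epsilon>"
    then have "N (s / \<epsilon>) \<omega> = N (t / \<epsilon>) \<omega>" using e by (intro b(2)) (simp_all add: field_simps)
    then show "thinned N \<beta> \<epsilon> s \<omega> = thinned N \<beta> \<epsilon> t \<omega>" by (simp add: thinned_def)
  qed
  then show "((\<lambda>t. thinned N \<beta> \<epsilon> t \<omega>) \<longlongrightarrow> thinned N \<beta> \<epsilon> t \<omega>) (at_right t)" by (rule tendsto_eventually)
qed

text \<open>\<open>N\<close> attains every index up to its current value, and partial sums of zeros
  and ones attain every value on their way; the composition skips nothing.\<close>

lemma thinned_no_skip:
  assumes e: "0 < \<epsilon>" "\<epsilon> \<le> 1" and ns: "\<And>\<omega>. \<omega> \<in> space M \<Longrightarrow> no_skip (\<lambda>t. N t \<omega>)"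
  shows "AE \<omega> in M. no_skip (\<lambda>t. thinned N \<beta> \<epsilon> t \<omega>)"
proof -
  have "AE \<omega> in M. \<forall>i\<in>{1..}. \<beta> \<epsilon> i \<omega> = 0 \<or> \<beta> \<epsilon> i \<omega> = 1"
    using iid_bernoulli_probs(4)[OF iid[OF e]] e by (subst AE_ball_countable) auto
  then show ?thesis
    using AE_space
  proof eventually_elim
    case (elim \<omega>)
    define S where "S m = (\<Sum>i = 1..m. \<beta> \<epsilon> i \<omega>)" for m
    have step: "S (Suc m) \<le> Suc (S m)" for m
    proof -
      have "\<beta> \<epsilon> (Suc m) \<omega> = 0 \<or> \<beta> \<epsilon> (Suc m) \<omega> = 1" using elim(1) by simp
      then show ?thesis by (auto simp: S_def)
    qed
    have ivt: "\<exists>l\<le>m. S l = k" if "k \<le> S m" for k m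
      using that
    proof (induction m)
      case 0
      then show ?case by (auto simp: S_def)
    next
      case (Suc m)
      show ?case
      proof (cases "k \<le> S m")
        case True
        then show ?thesis using Suc.IH by (meson le_SucI)
      next
        case False
        then have "k = S (Suc m)" using Suc.prems step[of m] by linarith
        then show ?thesis by blast
      qed
    qed
    show ?case
      unfolding no_skip_def
    proof (intro allI impI)
      fix t k assume t: "0 \<le> t" and k: "k \<le> thinned N \<beta> \<epsilon> t \<omega>"
      then obtain l where l: "l \<le> N (t / \<epsilon>) \<omega>" "S l = k" using ivt[of k "N (t / \<epsilon>) \<omega>"] by (auto simp: thinned_def S_def)
      have "0 \<le> t / \<epsilon>" using t e by simp
      then obtain s where s: "s \<in> {0..t / \<epsilon>}" "N s \<omega> = l" using ns[OF elim(2)] l(1) unfolding no_skip_def by blast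
      then show "\<exists>s\<in>{0..t}. thinned N \<beta> \<epsilon> s \<omega> = k"
        using e l by (intro bexI[of _ "s * \<epsilon>"]) (auto simp: thinned_def S_def field_simps)
    qed
  qed
qed

end

section \<open>Weak convergence of the thinned process\<close>

theorem theorem1:
  fixes M :: "'a measure" and F :: "real \<Rightarrow> 'a measure"
    and N :: "real \<Rightarrow> 'a \<Rightarrow> nat" and A :: "real \<Rightarrow> 'a \<Rightarrow> real"
    and \<beta> :: "real \<Rightarrow> nat \<Rightarrow> 'a \<Rightarrow> nat" and lam :: real
    and M0 :: "'b measure" and N0 :: "real \<Rightarrow> 'b \<Rightarrow> nat"
  assumes "prob_space M" and "is_filtration M F"
    and "is_simple_counting_process M N"
    and "\<forall>t\<ge>0. N t \<in> F t \<rightarrow>\<^sub>M count_space UNIV"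
    and "is_compensator M F N A"
    and "\<forall>\<epsilon>. 0 < \<epsilon> \<and> \<epsilon> \<le> 1 \<longrightarrow>
           iid_bernoulli M \<epsilon> (\<beta> \<epsilon>) \<and> independent_of_process M (\<beta> \<epsilon>) N"
    and "0 < lam"
    and "converges_in_law euclideanreal M (\<lambda>t \<omega>. A t \<omega> / t) M (\<lambda>_. lam) at_top"
    and "prob_space M0" and "is_poisson_process M0 N0 lam"
  shows "converges_in_law skorohod_J1 M (\<lambda>\<epsilon>. sample_path (thinned N \<beta> \<epsilon>))
           M0 (sample_path N0) (at_right 0)"
proof -
  interpret compensated M F N A
    using assms(1-5) by (rule compensated.intro)
  have Nmeas: "N t \<in> M \<rightarrow>\<^sub>M count_space UNIV" if "0 \<le> t" for t
    using simple that by (auto simp: is_simple_counting_process_def)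
  interpret th: thinning_family M N lam \<beta>
    using counting Nmeas assms(6,7) counting_in_prob[OF assms(8,7)] by unfold_locales auto
  interpret P: poisson M0 N0 lam
    using assms(9,10,7) by (intro poisson.intro poisson_axioms.intro)
  have sp: "sample_path X \<omega> = real_path (\<lambda>t. X t \<omega>)" for X :: "real \<Rightarrow> 'x \<Rightarrow> nat" and \<omega>
    by (simp add: sample_path_def real_path_def)
  have ns: "no_skip (\<lambda>t. N t \<omega>)" if "\<omega> \<in> space M" for \<omega>
    by (rule simple_path_no_skip[OF counting[OF that] simple_paths[OF that]])
  have pos: "\<forall>\<^sub>F \<epsilon> in at_right (0::real). 0 < \<epsilon> \<and> \<epsilon> \<le> 1"
    unfolding eventually_at_right_field by (intro exI[of _ 1]) auto
  have X: "\<forall>\<^sub>F \<epsilon> in at_right 0. (\<forall>\<omega>\<in>space M. counting_path (\<lambda>t. thinned N \<beta> \<epsilon> t \<omega>))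
    \<and> (\<forall>t\<ge>0. (\<lambda>\<omega>. thinned N \<beta> \<epsilon> t \<omega>) \<in> M \<rightarrow>\<^sub>M count_space UNIV)"
    using pos by eventually_elim (use th.thinned_counting_path th.measurable_thinned in auto)
  \<comment> \<open>Almost surely neither process skips a value, so pattern probabilities become
    increment probabilities on the dyadic grid, or 0 for both. The limit supplied by
    \<open>thinned_fdd\<close> is exactly the product that \<open>poisson_fdd\<close>
    computes.\<close>
  have lim: "((\<lambda>\<epsilon>. prob {\<omega> \<in> space M. pattern n (\<lambda>t. thinned N \<beta> \<epsilon> t \<omega>) = p})
    \<longlongrightarrow> P.prob {\<omega> \<in> space M0. pattern n (\<lambda>t. N0 t \<omega>) = p}) (at_right 0)" for n p
  proof -
    define a where "a j = real j / 2 ^ n" for j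
    have a: "0 \<le> a 0" "\<And>j. a j < a (Suc j)" by (simp_all add: a_def divide_strict_right_mono)
    have "\<forall>\<^sub>F \<epsilon> in at_right 0. prob {\<omega> \<in> space M. pattern n (\<lambda>t. thinned N \<beta> \<epsilon> t \<omega>) = p}
      = (if consistent n p then prob {\<omega> \<in> space M. \<forall>j<n * 2 ^ n. thinned N \<beta> \<epsilon> (a (Suc j)) \<omega> - thinned N \<beta> \<epsilon> (a j) \<omega>
          = fst p ! Suc j - fst p ! j} else 0)"
      using pos unfolding a_def
      by eventually_elim (intro pattern_prob th.thinned_counting_path th.measurable_thinned th.thinned_no_skip ns, auto)
    moreover have "P.prob {\<omega> \<in> space M0. pattern n (\<lambda>t. N0 t \<omega>) = p}
      = (if consistent n p then (\<Prod>j<n * 2 ^ n. pois (lam * (a (Suc j) - a j)) (fst p ! Suc j - fst p ! j)) else 0)"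
      unfolding P.poisson_fdd[OF a, symmetric] unfolding a_def
      by (rule P.pattern_prob[OF P.cpath P.Nmeas P.poisson_no_skip])
    moreover have "((\<lambda>\<epsilon>. if consistent n p then prob {\<omega> \<in> space M. \<forall>j<n * 2 ^ n. thinned N \<beta> \<epsilon> (a (Suc j)) \<omega> - thinned N \<beta> \<epsilon> (a j) \<omega>
          = fst p ! Suc j - fst p ! j} else 0) \<longlongrightarrow>
      (if consistent n p then (\<Prod>j<n * 2 ^ n. pois (lam * (a (Suc j) - a j)) (fst p ! Suc j - fst p ! j)) else 0)) (at_right 0)"
      using th.thinned_fdd[OF a, of "n * 2 ^ n" "\<lambda>j. fst p ! Suc j - fst p ! j"] by (cases "consistent n p") auto
    ultimately show ?thesis by (simp add: tendsto_cong)
  qed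
  show ?thesis
    unfolding converges_in_law_def
  proof (intro conjI allI impI)
    show "\<forall>\<^sub>F \<epsilon> in at_right 0. sample_path (thinned N \<beta> \<epsilon>) \<in> M \<rightarrow>\<^sub>M borel_of skorohod_J1"
      using X
    proof eventually_elim
      case (elim \<epsilon>)
      have "(\<lambda>\<omega>. real_path (\<lambda>t. thinned N \<beta> \<epsilon> t \<omega>)) \<in> M \<rightarrow>\<^sub>M borel_of skorohod_J1"
        by (rule measurable_real_path) (use elim in auto)
      then show ?case by (simp add: sp[abs_def])
    qed
    have "(\<lambda>\<omega>. real_path (\<lambda>t. N0 t \<omega>)) \<in> M0 \<rightarrow>\<^sub>M borel_of skorohod_J1"
      by (rule measurable_real_path[OF P.cpath P.Nmeas])
    then show "sample_path N0 \<in> M0 \<rightarrow>\<^sub>M borel_of skorohod_J1" by (simp add: sp[abs_def])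
    fix f assume "continuous_map skorohod_J1 euclideanreal f \<and> bounded (f ` topspace skorohod_J1)"
    then show "((\<lambda>\<epsilon>. \<integral>\<omega>. f (sample_path (thinned N \<beta> \<epsilon>) \<omega>) \<partial>M) \<longlongrightarrow> (\<integral>\<omega>. f (sample_path N0 \<omega>) \<partial>M0)) (at_right 0)"
      unfolding sp by (intro P.path_expectation_tendsto[OF assms(1) X P.cpath P.Nmeas lim]) auto
  qed
qed

end
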